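(* Let $X$ be a white Lévy noise with triplet $(\mu,\sigma,V)$, $V=V_d+V_{ac}+V_{cs}$, and assume $X_0$ is either discrete, continuous, or discrete-continuous. Then: (1) If $X_0$ is discrete, and $H(X_0)<\infty$ and $H(A)<\infty$, where $A$ is the (discrete) random variable with distribution function $V(x)/\lambda$, $\lambda=\int_{\mathbb R\setminus\{0\}}dV(a)<\infty$, then there exist functions $m(n)$ and $\zeta(n)$ with $\lim_{n\to\infty}\sup_{m\ge m(n)}|\mathcal H_{m,n}(X)-\zeta(n)|=0$ and $c_1\log n\le\zeta(n)\le c_2\log n$ for some constants $0<c_1\le c_2<\infty$ independent of $n$. (2) If $X_0$ is discrete-continuous, set $\lambda=\int_{\mathbb R\setminus\{0\}}dV(a)$, $\alpha=\frac1\lambda\int_{\mathbb R\setminus\{0\}}dV_d(a)$ and $\kappa(n)=n\big(1-\exp[-\frac{\lambda}{n}(1-\alpha)]\big)$. Let $X_{0,D},X_{0,c}$ be the discrete and continuous parts of $X_0$, $X_{1,c}^{(n)}$ the continuous part of $X_1^{(n)}$, $A_c$ the continuous random variable with density $\frac{dV_{ac}(x)/dx}{\int_{\mathbb R\setminus\{0\}}dV_{ac}}$ and $A_D$ the discrete random variable with distribution $V_d/\int_{\mathbb R\setminus\{0\}}dV_d$ (when $V_d\not\equiv0$). If $H([X_0]_1)$, $h(X_{1,c}^{(n)})$ (for all $n$), $h(A_c)$, $H(X_{0,D})$ and $H(A_D)$ are well-defined and finite, then there exist functions $m(n)$ and $\zeta(n)$ with $$\lim_{n\to\infty}\sup_{m\ge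 m(n)}\left|\frac{\mathcal H_{m,n}(X)}{\kappa(n)}-\log m-\zeta(n)\right|=0$$ and $c_1\log n\le\zeta(n)\le c_2\log n$ for some constants $0<c_1\le c_2<\infty$ independent of $n$. (3) If $X_0$ is continuous with $\sigma>0$ or $\int_{\mathbb R\setminus\{0\}}dV_{ac}(a)=\infty$, $H([X_0]_1)<\infty$, and $h(X_1^{(n)})$ is well-defined for all $n$, then with $\kappa(n)=n$ and $\zeta(n)=h(X_1^{(n)})$ there exists $m(n)$ such that $$\lim_{n\to\infty}\sup_{m\ge m(n)}\left|\frac{\mathcal H_{m,n}(X)}{\kappa(n)}-\log m-\zeta(n)\right|=0,$$ and $\zeta(n)=h(X_1^{(n)})$ is non-increasing in $n$.
   Context: A white Lévy noise $X$ is a generalized random process on $\mathcal S'(\mathbb R)$ with characteristic functional $\mathbb E[e^{j\langle X,\varphi\rangle}]=\exp\big(\int_{\mathbb R} f(\varphi(t))\,dt\big)$ for $\varphi\in\mathcal S(\mathbb R)$, where the Lévy exponent is $f(\omega)=-\frac{\sigma^2}{2}\omega^2+j\mu\omega+\int_{\mathbb R\setminus\{0\}}\big(e^{j\omega a}-1-j\omega a\mathbf 1_{(-1,1)}(a)\big)\,dV(a)$, with $\sigma,\mu\in\mathbb R$ and $V$ non-decreasing, continuous at $0$, $\lim_{a\to-\infty}V(a)=0$, $\int_{\mathbb R\setminus\{0\}}\min\{1,a^2\}\,dV(a)<\infty$ and $\int_{\mathbb R\setminus[-1,1]}|a|^\theta dV(a)<\infty$ for some $\theta>0$; $(\mu,\sigma,V)$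 is called its triplet. $V=V_d+V_{ac}+V_{cs}$ is the decomposition of $V$ into its discrete (jump) part, absolutely continuous part and continuous singular part. For $n\in\mathbb N$, $i\in\mathbb Z$, $X_i^{(n)}=\int_{(i-1)/n}^{i/n}X(t)\,dt$ (increments of the associated Lévy process; i.i.d. in $i$), and $X_0=\int_0^1X(t)\,dt$. $[x]_m=\frac1m\lfloor\frac12+mx\rfloor$ and $\mathcal H_{m,n}(X)=n\,H([X_1^{(n)}]_m)$. $H$ is discrete entropy, $h$ differential entropy (natural logs); $h(p)$ is well-defined when $\int p|\log p|<\infty$. A random variable is discrete if it takes countably many values, continuous if its law is absolutely continuous w.r.t. Lebesgue measure, and discrete-continuous if for some countable set $\mathcal D$, $0<\Pr(X\in\mathcal D)<1$, its conditional law on $\mathcal D$ is discrete and its conditional law given $X\notin\mathcal D$ is absolutely continuous; these conditional variables are its discrete and continuous parts. *)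

theory Defs
  imports "HOL-Probability.Probability"
begin

text \<open>The Levy measure dV is represented as a measure nu on the Borel sets of the reals
  (no mass at 0).  The standing assumptions on V become assumptions on nu.\<close>

definition levy_triplet :: "real \<Rightarrow> real \<Rightarrow> real measure \<Rightarrow> bool" where
  "levy_triplet \<mu> \<sigma> \<nu> \<longleftrightarrow>
     sets \<nu> = sets borel \<and> emeasure \<nu> {0} = 0 \<and>
     (\<integral>\<^sup>+ a. ennreal (min 1 (a\<^sup>2)) \<partial>\<nu>) < \<infinity> \<and>
     (\<exists>\<theta>>0. (\<integral>\<^sup>+ a. ennreal (indicator {a. \<bar>a\<bar> > 1} a * \<bar>a\<bar> powr \<theta>) \<partial>\<nu>) < \<infinity>)"

definition levy_exponent :: "real \<Rightarrow> real \<Rightarrow> real measure \<Rightarrow> real \<Rightarrow> complex" where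
  "levy_exponent \<mu> \<sigma> \<nu> \<omega> =
     - complex_of_real (\<sigma>\<^sup>2 / 2 * \<omega>\<^sup>2) + \<i> * complex_of_real (\<mu> * \<omega>)
     + (\<integral> a. iexp (\<omega> * a) - 1 - \<i> * complex_of_real (\<omega> * a * indicator {-1<..<1} a) \<partial>\<nu>)"

definition discrete_law :: "real measure \<Rightarrow> bool" where
  "discrete_law M \<longleftrightarrow> (\<exists>D. countable D \<and> emeasure M (UNIV - D) = 0)"

definition continuous_law :: "real measure \<Rightarrow> bool" where
  "continuous_law M \<longleftrightarrow> absolutely_continuous lborel M"

definition cond_law :: "real measure \<Rightarrow> real set \<Rightarrow> real measure" where
  "cond_law M A = scale_measure (ennreal (1 / measure M A)) (density M (indicator A))"

definition dc_split :: "real measure \<Rightarrow> real set \<Rightarrow> bool" where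
  "dc_split M D \<longleftrightarrow> countable D \<and> 0 < measure M D \<and> measure M D < 1 \<and>
     discrete_law (cond_law M D) \<and> continuous_law (cond_law M (UNIV - D))"

definition dc_law :: "real measure \<Rightarrow> bool" where
  "dc_law M \<longleftrightarrow> (\<exists>D. dc_split M D)"

definition dentropy :: "real measure \<Rightarrow> ennreal" where
  "dentropy M = (\<integral>\<^sup>+ x. ennreal (- measure M {x} * ln (measure M {x})) \<partial>count_space UNIV)"

definition dens :: "real measure \<Rightarrow> real \<Rightarrow> real" where
  "dens M x = enn2real (RN_deriv lborel M x)"

definition dentropy_wd :: "real measure \<Rightarrow> bool" where
  "dentropy_wd M \<longleftrightarrow> absolutely_continuous lborel M \<and>
     integrable lborel (\<lambda>x. dens M x * \<bar>ln (dens M x)\<bar>)"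

definition diff_entropy :: "real measure \<Rightarrow> real" where
  "diff_entropy M = - (\<integral> x. dens M x * ln (dens M x) \<partial>lborel)"

definition quant :: "nat \<Rightarrow> real \<Rightarrow> real" where
  "quant m x = real_of_int \<lfloor>1/2 + real m * x\<rfloor> / real m"

definition Hq :: "nat \<Rightarrow> real measure \<Rightarrow> ennreal" where
  "Hq m M = dentropy (distr M borel (quant m))"

end

theory Submission
  imports Defs
begin

text \<open>
Write eta t = - t ln t and let the cells be the level sets of the quantizer with step 1/m.

The entropy of the quantized variable is the sum of eta over the cell masses. For a discrete law it
tends to the entropy of the law, by dominated convergence of - ln of the cell mass under the law
itself. For a law with density g and total mass q the sum minus q ln m is the integral of eta over
the cell averages of g; by Jensen it dominates the integral of eta(g), and the converse inequality
in the limit is Fatou's lemma applied to the nonnegative relative entropy integrand with respect to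
a log-Lipschitz reference density, with Lebesgue's differentiation theorem giving pointwise
convergence. For a mixture the defect eta(a) + eta(b) - eta(a + b) is at most 4 sqrt(a b), and its
sum over the cells vanishes because finitely many small cells carry almost all of the discrete mass.

If the Levy measure is finite, with total mass r, the law P n is, up to the drift d/n, compound
Poisson with rate r/n. Comparing the Poisson series of P n and P 1 term by term shows that off the
point d/n the measure n P n is at most e^r times a translate of P 1. Hence n times the entropies of
the atoms and of the density of P n differ from multiples of ln n by bounded amounts, which is the
logarithmic growth of zeta. The atoms of P n have total mass exp(- r_ac / n).

Since 1/n = 1/(n+1) + 1/(n(n+1)), the law P n is the convolution of P (n+1) with another law, and
convolution does not decrease differential entropy.
\<close>

section \<open>The function eta and quantization cells\<close>

text \<open>In the density limit no common integrable majorant for \<open>eta\<close> of the cell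
  averages is at hand; the quantitative input is finiteness of the entropy at step 1. It makes the
  logarithm of the reference density integrable under the law, and the Lipschitz bound lets every
  term of the relative entropy other than \<open>eta\<close> itself converge, so that Fatou's
  one-sided inequality becomes a limit. The assumption on step 1 concerns \<open>P 1\<close> alone.
  It reaches \<open>P n\<close> because a convolution factor is controlled, cell by cell, by three
  neighbouring cells of the convolution. Since \<open>eta\<close> is not monotone, each such
  transfer goes through one pointwise comparison that costs a linear term. The laws are given by
  characteristic functions only; every factorization, including the compound Poisson form, comes
  from their uniqueness. Two exclusions make that form available and usable: atoms rule out a
  Gaussian component, and a singular continuous part of the Levy measure would already be visible in
  the single-jump part of \<open>P 1\<close>. In the mixed case the set of atoms is not unique, so
  its mass is shown to be the same for every admissible choice.\<close>

definition eta :: "real \<Rightarrow> real" where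
  "eta t = - t * ln t"

lemma eta_0 [simp]: "eta 0 = 0"
  by (simp add: eta_def)

lemma borel_measurable_eta [measurable]: "eta \<in> borel_measurable borel"
  unfolding eta_def [abs_def] by measurable

lemma eta_nonneg: "0 \<le> t \<Longrightarrow> t \<le> 1 \<Longrightarrow> 0 \<le> eta t"
  by (cases "t = 0") (auto simp: eta_def mult_le_0_iff ln_le_zero_iff)

lemma eta_le: "0 \<le> t \<Longrightarrow> eta t \<le> 1 - t"
proof (cases "t = 0")
  case False
  assume "0 \<le> t"
  then have t: "t > 0" using False by simp
  have "ln (1/t) \<le> 1/t - 1" using t by (intro ln_le_minus_one) auto
  then have "t * ln (1/t) \<le> t * (1/t - 1)" using t by (intro mult_left_mono) auto
  then show ?thesis using t by (simp add: eta_def ln_div algebra_simps)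
qed auto

text \<open>Every logarithmic term originates here: with \<open>s = m\<close> the rule produces the
  \<open>ln m\<close> of the quantization, with \<open>s = n\<close> the \<open>ln n\<close> in the
  growth of zeta. It extends to zero factors because \<open>eta 0 = 0\<close>.\<close>

lemma eta_mult: "0 \<le> s \<Longrightarrow> 0 \<le> t \<Longrightarrow> eta (s * t) = s * eta t + eta s * t"
  by (cases "s = 0"; cases "t = 0") (auto simp: eta_def ln_mult algebra_simps)

text \<open>Gibbs' inequality in pointwise form, from \<open>ln y \<le> y - 1\<close> at
  \<open>y = u/t\<close>. The right side minus the left is the nonnegative relative entropy
  integrand of \<open>t\<close> against the reference value \<open>u\<close>; Jensen's inequality
  for \<open>eta\<close> is later obtained by integrating it with \<open>u\<close> equal to the
  mean.\<close>

lemma eta_le_cross: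
  assumes "0 \<le> t" "0 < u"
  shows "eta t \<le> u - t - t * ln u"
proof (cases "t = 0")
  case False
  then have t: "t > 0" using assms by simp
  have "ln (u/t) \<le> u/t - 1" using t assms by (intro ln_le_minus_one) auto
  then have "t * ln (u/t) \<le> t * (u/t - 1)" using t by (intro mult_left_mono) auto
  then show ?thesis using t assms by (simp add: eta_def ln_div algebra_simps)
qed (use assms in auto)

text \<open>Substitute for monotonicity, which \<open>eta\<close> lacks. The bound on
  \<open>eta t\<close> is Gibbs' inequality with reference \<open>u\<close>; the bound on
  \<open>- eta t\<close> comes from \<open>ln t \<le> ln C + ln u\<close>.\<close>

lemma abs_eta_dominated:
  assumes "0 \<le> t" "t \<le> C * u" "1 \<le> C" "0 \<le> u"
  shows "\<bar>eta t\<bar> \<le> (1 + C * ln C) * u + C * \<bar>eta u\<bar>"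
proof (cases "t = 0")
  case True then show ?thesis using assms by (auto intro!: add_nonneg_nonneg mult_nonneg_nonneg)
next
  case False
  then have t: "t > 0" using assms by simp
  then have u: "u > 0" using assms by (metis less_le mult_zero_right order_trans not_le)
  have lC: "0 \<le> ln C" using assms by simp
  have tu: "t * \<bar>ln u\<bar> \<le> C * u * \<bar>ln u\<bar>" using assms by (intro mult_right_mono) auto
  have e: "C * \<bar>eta u\<bar> = C * u * \<bar>ln u\<bar>" using u by (simp add: eta_def abs_mult)
  have "eta t \<le> u - t - t * ln u" using eta_le_cross[OF assms(1) u] .
  also have "\<dots> \<le> u + t * \<bar>ln u\<bar>" using t
    by (smt (verit) mult_left_mono mult_minus_right abs_ge_minus_self)
  also have "\<dots> \<le> u + C * u * \<bar>ln u\<bar> + C * ln C * u"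
    using tu lC assms by (simp add: add_increasing2)
  finally have 1: "eta t \<le> (1 + C * ln C) * u + C * \<bar>eta u\<bar>" by (simp add: e algebra_simps)
  have "ln t \<le> ln (C * u)" using assms t by (intro ln_mono) auto
  then have "t * ln t \<le> t * (ln C + ln u)"
    using t u assms by (intro mult_left_mono) (auto simp: ln_mult)
  also have "\<dots> \<le> C * u * ln C + t * \<bar>ln u\<bar>"
    using t assms lC by (simp add: distrib_left add_mono mult_right_mono)
  also have "\<dots> \<le> u + C * u * \<bar>ln u\<bar> + C * u * ln C" using tu u by simp
  finally have "- eta t \<le> (1 + C * ln C) * u + C * \<bar>eta u\<bar>" by (simp only: e) (simp add: eta_def algebra_simps)
  with 1 show ?thesis by auto
qed

lemma ln_one_plus_le_sqrt:
  assumes "0 \<le> (t::real)" shows "ln (1 + t) \<le> 2 * sqrt t"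
proof -
  have "1 + t \<le> (1 + sqrt t)\<^sup>2" using assms by (simp add: power2_eq_square algebra_simps)
  then have "ln (1 + t) \<le> ln ((1 + sqrt t)\<^sup>2)" using assms by (intro ln_mono) auto
  also have "\<dots> = 2 * ln (1 + sqrt t)" using assms by (subst ln_realpow) (auto intro: add_pos_nonneg)
  also have "\<dots> \<le> 2 * sqrt t" using assms ln_add_one_self_le_self[of "sqrt t"] by simp
  finally show ?thesis .
qed

text \<open>The defect is the sum of \<open>a * ln (1 + b/a)\<close> and the same with the roles
  exchanged; each is at most \<open>2 * sqrt (a * b)\<close>, which gives the constant 4.\<close>

lemma eta_add_defect:
  assumes "0 \<le> a" "0 \<le> b"
  shows "0 \<le> eta a + eta b - eta (a + b)" "eta a + eta b - eta (a + b) \<le> 4 * sqrt (a * b)"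
proof -
  have *: "0 \<le> a * ln ((a + b) / a) \<and> a * ln ((a + b) / a) \<le> 2 * sqrt (a * b)" if "a > 0" "b > 0" for a b :: real
  proof
    show "0 \<le> a * ln ((a + b) / a)" using that by (intro mult_nonneg_nonneg ln_ge_zero) auto
    have "ln ((a + b) / a) = ln (1 + b/a)" using that by (simp add: add_divide_distrib)
    also have "\<dots> \<le> 2 * sqrt (b/a)" using that by (intro ln_one_plus_le_sqrt) auto
    finally have "a * ln ((a + b) / a) \<le> a * (2 * sqrt (b/a))" using that by (intro mult_left_mono) auto
    also have "\<dots> = 2 * sqrt (a * b)"
      using that by (simp add: real_sqrt_mult real_sqrt_divide field_simps)
    finally show "a * ln ((a + b) / a) \<le> 2 * sqrt (a * b)" .
  qed
  have e: "eta a + eta b - eta (a + b) = a * ln ((a+b)/a) + b * ln ((b+a)/b)" if "a > 0" "b > 0"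
    using that by (simp add: eta_def ln_div algebra_simps)
  show "0 \<le> eta a + eta b - eta (a + b)"
    using e *[of a b] *[of b a] assms by (cases "a = 0"; cases "b = 0") auto
  show "eta a + eta b - eta (a + b) \<le> 4 * sqrt (a * b)"
    using e *[of a b] *[of b a] assms by (cases "a = 0"; cases "b = 0") (auto simp: mult.commute)
qed

text \<open>The integer index of the quantized value. For \<open>m \<ge> 1\<close> its level sets
  are half-open intervals of length \<open>1/m\<close> centred at \<open>k/m\<close>, so sums over
  cells become sums over the integers.\<close>

definition cell :: "nat \<Rightarrow> real \<Rightarrow> int" where
  "cell m x = \<lfloor>1/2 + real m * x\<rfloor>"

lemma measurable_cell [measurable]: "cell m \<in> measurable borel (count_space UNIV)"
  unfolding cell_def by measurable

lemma quant_eq_cell: "quant m x = real_of_int (cell m x) / real m"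
  by (simp add: quant_def cell_def)

lemma cell_vimage:
  assumes "m \<ge> 1"
  shows "cell m -` {k} = {(of_int k - 1/2) / real m ..< (of_int k + 1/2) / real m}"
proof (rule set_eqI)
  fix x
  have m: "0 < real m" using assms by simp
  have "x \<in> cell m -` {k} \<longleftrightarrow> of_int k \<le> 1/2 + real m * x \<and> 1/2 + real m * x < of_int k + 1"
    by (simp add: cell_def floor_eq_iff)
  also have "\<dots> \<longleftrightarrow> x \<in> {(of_int k - 1/2) / real m ..< (of_int k + 1/2) / real m}"
    unfolding atLeastLessThan_iff pos_divide_le_eq[OF m] pos_less_divide_eq[OF m] by (auto simp: mult.commute)
  finally show "x \<in> cell m -` {k} \<longleftrightarrow> x \<in> {(of_int k - 1/2) / real m ..< (of_int k + 1/2) / real m}" .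
qed

lemma cell_vimage_sets [measurable]: "cell m -` A \<in> sets borel"
  using measurable_sets[OF measurable_cell, of A m] by simp

lemma emeasure_lborel_cell:
  assumes "m \<ge> 1"
  shows "emeasure lborel (cell m -` {k}) = ennreal (1 / real m)"
  using assms by (simp add: cell_vimage divide_right_mono flip: diff_divide_distrib)

lemma cell_eq_imp_dist:
  assumes "m \<ge> 1" "cell m x = cell m y"
  shows "\<bar>x - y\<bar> < 1 / real m"
proof -
  have "x \<in> cell m -` {cell m y}" "y \<in> cell m -` {cell m y}" using assms by auto
  then have "x - y < (of_int (cell m y) + 1/2) / real m - (of_int (cell m y) - 1/2) / real m"
     "y - x < (of_int (cell m y) + 1/2) / real m - (of_int (cell m y) - 1/2) / real m"
    unfolding cell_vimage[OF assms(1)] by simp_all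
  then show ?thesis by (simp flip: diff_divide_distrib)
qed

text \<open>The weights \<open>w\<close> are left abstract so that the same push-forward serves
  finite measures, with the cell masses, and Lebesgue measure, with the constant weight
  \<open>1/m\<close>. Integrals of functions constant on cells thus become sums.\<close>

lemma distr_cell_eq_density:
  assumes [measurable_cong]: "sets M = sets borel"
    and w: "\<And>k. emeasure M (cell m -` {k}) = ennreal (w k)"
  shows "distr M (count_space UNIV) (cell m) = density (count_space UNIV) (\<lambda>k. ennreal (w k))"
proof (rule measure_eqI_countable)
  fix k :: int
  have sp: "space M = UNIV" using assms(1) sets_eq_imp_space_eq by force
  show "emeasure (distr M (count_space UNIV) (cell m)) {k} =
      emeasure (density (count_space UNIV) (\<lambda>k. ennreal (w k))) {k}"
    by (simp add: emeasure_distr emeasure_density sp w nn_integral_count_space_indicator[symmetric]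
        nn_integral_count_space_finite)
qed auto

lemma nn_integral_cell:
  assumes [measurable_cong]: "sets M = sets borel"
    and w: "\<And>k. emeasure M (cell m -` {k}) = ennreal (w k)"
  shows "(\<integral>\<^sup>+x. f (cell m x) \<partial>M) = (\<integral>\<^sup>+k. ennreal (w k) * f k \<partial>count_space UNIV)"
proof -
  have "(\<integral>\<^sup>+x. f (cell m x) \<partial>M) = (\<integral>\<^sup>+k. f k \<partial>distr M (count_space UNIV) (cell m))"
    by (subst nn_integral_distr) auto
  also have "\<dots> = (\<integral>\<^sup>+k. ennreal (w k) * f k \<partial>count_space UNIV)"
    unfolding distr_cell_eq_density[OF assms] by (subst nn_integral_density) auto
  finally show ?thesis .
qed

lemma integrable_cell_iff:
  fixes f :: "int \<Rightarrow> real"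
  assumes [measurable_cong]: "sets M = sets borel"
    and w: "\<And>k. emeasure M (cell m -` {k}) = ennreal (w k)" "\<And>k. 0 \<le> w k"
  shows "integrable M (\<lambda>x. f (cell m x)) \<longleftrightarrow> integrable (count_space UNIV) (\<lambda>k. w k * f k)"
proof -
  have "integrable M (\<lambda>x. f (cell m x)) \<longleftrightarrow> integrable (distr M (count_space UNIV) (cell m)) f"
    by (subst integrable_distr_eq) auto
  also have "\<dots> \<longleftrightarrow> integrable (count_space UNIV) (\<lambda>k. w k * f k)"
    unfolding distr_cell_eq_density[OF assms(1,2)] by (subst integrable_real_density) (auto simp: w)
  finally show ?thesis .
qed

lemma integral_cell:
  fixes f :: "int \<Rightarrow> real"
  assumes [measurable_cong]: "sets M = sets borel"
    and w: "\<And>k. emeasure M (cell m -` {k}) = ennreal (w k)" "\<And>k. 0 \<le> w k"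
  shows "(\<integral>x. f (cell m x) \<partial>M) = (\<integral>k. w k * f k \<partial>count_space UNIV)"
proof -
  have "(\<integral>x. f (cell m x) \<partial>M) = (\<integral>k. f k \<partial>distr M (count_space UNIV) (cell m))"
    by (subst integral_distr) auto
  also have "\<dots> = (\<integral>k. w k * f k \<partial>count_space UNIV)"
    unfolding distr_cell_eq_density[OF assms(1,2)] by (subst integral_real_density) (auto simp: w)
  finally show ?thesis .
qed

definition mass :: "nat \<Rightarrow> real measure \<Rightarrow> int \<Rightarrow> real" where
  "mass m M k = measure M (cell m -` {k})"

lemma mass_nonneg [simp]: "0 \<le> mass m M k"
  by (simp add: mass_def)

text \<open>The sum over all reals in \<open>dentropy\<close> reduces to the integers because the
  quantizer takes values in the multiples of \<open>1/m\<close> and distinct indices give distinct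
  values.\<close>

lemma Hq_eq:
  assumes m: "m \<ge> 1" and M: "sets M = sets borel"
  shows "Hq m M = (\<integral>\<^sup>+k. ennreal (eta (mass m M k)) \<partial>count_space UNIV)"
proof -
  note [measurable_cong] = M
  have sp: "space M = UNIV" using M sets_eq_imp_space_eq by force
  let ?N = "distr M borel (quant m)"
  have q[measurable]: "quant m \<in> borel_measurable M"
    unfolding quant_def by measurable
  let ?h = "\<lambda>k::int. real_of_int k / real m"
  have inj: "inj ?h" using m by (auto intro!: injI)
  have 1: "measure ?N {?h k} = mass m M k" for k
  proof -
    have "quant m -` {?h k} = cell m -` {k}"
      using m by (auto simp: quant_eq_cell)
    then show ?thesis by (simp add: measure_distr sp mass_def)
  qed
  have 2: "measure ?N {x} = 0" if "x \<notin> range ?h" for x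
  proof -
    have "quant m -` {x} = {}" using that by (auto simp: quant_eq_cell)
    then show ?thesis by (simp add: measure_distr)
  qed
  have "Hq m M = (\<integral>\<^sup>+x. ennreal (eta (measure ?N {x})) \<partial>count_space UNIV)"
    by (simp add: Hq_def dentropy_def eta_def)
  also have "\<dots> = (\<integral>\<^sup>+x. ennreal (eta (measure ?N {x})) * indicator (range ?h) x \<partial>count_space UNIV)"
    using 2 by (intro nn_integral_cong) (auto simp: indicator_def eta_def)
  also have "\<dots> = (\<integral>\<^sup>+x. ennreal (eta (measure ?N {x})) \<partial>count_space (range ?h))"
    by (subst nn_integral_count_space_indicator) auto
  also have "\<dots> = (\<integral>\<^sup>+k. ennreal (eta (measure ?N {?h k})) \<partial>count_space UNIV)"
    by (subst nn_integral_bij_count_space[symmetric, of ?h UNIV]) (auto simp: inj inj_on_imp_bij_betw)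
  also have "\<dots> = (\<integral>\<^sup>+k. ennreal (eta (mass m M k)) \<partial>count_space UNIV)" by (simp only: 1)
  finally show ?thesis .
qed

section \<open>Cell masses of a finite Borel measure\<close>

context finite_borel_measure
begin

lemma space_UNIV [simp]: "space M = UNIV"
  using M_is_borel sets_eq_imp_space_eq by force

lemma emeasure_cell: "emeasure M (cell m -` {k}) = ennreal (mass m M k)"
  by (simp add: mass_def emeasure_eq_measure)

lemmas nn_integral_mass = nn_integral_cell[OF M_is_borel emeasure_cell]
lemmas integrable_mass_iff = integrable_cell_iff[OF M_is_borel emeasure_cell mass_nonneg]
lemmas integral_mass = integral_cell[OF M_is_borel emeasure_cell mass_nonneg]

lemma mass_sums: "integrable (count_space UNIV) (mass m M)" "(\<integral>k. mass m M k \<partial>count_space UNIV) = measure M UNIV"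
  using integrable_mass_iff[where m=m and f="\<lambda>_. 1"] integral_mass[where m=m and f="\<lambda>_. 1"] by simp_all

lemma mass_le: "mass m M k \<le> measure M UNIV"
  unfolding mass_def using bounded_measure[of "cell m -` {k}"] by simp

text \<open>Total mass at most 1 makes every \<open>eta\<close> term nonnegative, so the truncation
  at 0 in \<open>ennreal\<close> changes nothing.\<close>

lemma Hq_finite_iff:
  assumes "m \<ge> 1" "measure M UNIV \<le> 1"
  shows "Hq m M < \<infinity> \<longleftrightarrow> integrable (count_space UNIV) (\<lambda>k. eta (mass m M k))"
proof -
  have "0 \<le> eta (mass m M k)" for k
    using mass_le[of m k] assms by (intro eta_nonneg) auto
  then show ?thesis unfolding Hq_eq[OF assms(1) M_is_borel]
    by (subst integrable_iff_bounded) auto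
qed

lemma enn2real_Hq:
  assumes "m \<ge> 1" "measure M UNIV \<le> 1"
  shows "enn2real (Hq m M) = (\<integral>k. eta (mass m M k) \<partial>count_space UNIV)"
proof -
  have "0 \<le> eta (mass m M k)" for k
    using mass_le[of m k] assms by (intro eta_nonneg) auto
  then show ?thesis unfolding Hq_eq[OF assms(1) M_is_borel]
    by (subst integral_eq_nn_integral) auto
qed

lemma measure_cell_tendsto: "(\<lambda>m. mass m M (cell m x)) \<longlonglongrightarrow> measure M {x}"
proof (rule tendsto_sandwich[where f="\<lambda>_. measure M {x}"])
  \<comment> \<open>The cells around x for varying m are not nested; the closed balls of radius
    \<open>1/(m+1)\<close> are, and the cell at resolution m lies in the ball of index
    \<open>m - 1\<close>.\<close>
  let ?B = "\<lambda>m. cball x (1 / real (Suc m))"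
  have "(\<lambda>m. measure M (?B m)) \<longlonglongrightarrow> measure M (\<Inter>m. ?B m)"
  proof (rule finite_Lim_measure_decseq)
    show "decseq ?B"
      by (intro decseq_SucI subset_cball) (auto simp: field_simps)
  qed auto
  moreover have "(\<Inter>m. ?B m) = {x}"
  proof -
    have "y = x" if "\<forall>m. dist x y \<le> 1 / real (Suc m)" for y
    proof -
      have "(\<lambda>m. 1 / real (Suc m)) \<longlonglongrightarrow> 0" using LIMSEQ_inverse_real_of_nat by (simp add: inverse_eq_divide)
      then have "dist x y \<le> 0" by (rule LIMSEQ_le_const) (use that in auto)
      then show ?thesis by simp
    qed
    then show ?thesis by auto
  qed
  ultimately have "(\<lambda>m. measure M (?B m)) \<longlonglongrightarrow> measure M {x}" by simp
  then have "(\<lambda>m. measure M (?B (m - 1))) \<longlonglongrightarrow> measure M {x}"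
    by (rule filterlim_compose) (rule filterlim_minus_const_nat_at_top)
  then show "(\<lambda>m. measure M (?B (m - 1))) \<longlonglongrightarrow> measure M {x}" .
  show "\<forall>\<^sub>F m in sequentially. mass m M (cell m x) \<le> measure M (?B (m - 1))"
  proof (rule eventually_sequentiallyI[of 1])
    fix m :: nat assume m: "1 \<le> m"
    have "cell m -` {cell m x} \<subseteq> ?B (m - 1)"
    proof
      fix y assume "y \<in> cell m -` {cell m x}"
      then have "\<bar>x - y\<bar> < 1 / real m" by (intro cell_eq_imp_dist m) auto
      then show "y \<in> ?B (m - 1)" using m by (simp add: dist_real_def)
    qed
    then show "mass m M (cell m x) \<le> measure M (?B (m - 1))"
      unfolding mass_def by (intro finite_measure_mono) auto
  qed
  show "\<forall>\<^sub>F m in sequentially. measure M {x} \<le> mass m M (cell m x)"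
    unfolding mass_def by (intro always_eventually allI finite_measure_mono) auto
qed auto

end

section \<open>Quantized entropy of discrete and mixed measures\<close>

lemma countable_in_borel: "countable S \<Longrightarrow> S \<in> sets (borel :: real measure)"
  by (rule sets.countable) auto

context finite_borel_measure
begin

lemma discrete_eq_distr_count:
  assumes S: "countable S" "emeasure M (UNIV - S) = 0"
  shows "M = distr (density (count_space UNIV) (\<lambda>x. ennreal (measure M {x}))) borel (\<lambda>x. x)"
proof (rule measure_eqI)
  show "sets M = sets (distr (density (count_space UNIV) (\<lambda>x. ennreal (measure M {x}))) borel (\<lambda>x. x))"
    by (simp add: M_is_borel)
  fix A assume A: "A \<in> sets M"
  then have [measurable]: "A \<in> sets borel" by (simp add: M_is_borel)
  have Sm[measurable]: "S \<in> sets borel" using S(1) by (rule countable_in_borel)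
  have 0: "emeasure M (A - S) = 0"
    using emeasure_mono[of "A - S" "UNIV - S" M] S(2) by (simp add: M_is_borel) auto
  have z: "measure M {x} = 0" if "x \<notin> S" for x
    using emeasure_mono[of "{x}" "UNIV - S" M] S(2) that by (simp add: M_is_borel measure_def)
  have "emeasure M A = emeasure M (A \<inter> S)"
    using 0 A Sm by (metis M_is_borel emeasure_Diff_null_set null_setsI sets.Diff Diff_Diff_Int)
  also have "\<dots> = (\<integral>\<^sup>+x. emeasure M {x} \<partial>count_space (A \<inter> S))"
    using S(1) by (intro emeasure_countable_singleton) (auto simp: M_is_borel)
  also have "\<dots> = (\<integral>\<^sup>+x. ennreal (measure M {x}) * indicator (A \<inter> S) x \<partial>count_space UNIV)"
    by (subst nn_integral_count_space_indicator) (auto simp: emeasure_eq_measure)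
  also have "\<dots> = (\<integral>\<^sup>+x. ennreal (measure M {x}) * indicator A x \<partial>count_space UNIV)"
    using z by (intro nn_integral_cong) (auto simp: indicator_def)
  also have "\<dots> = emeasure (distr (density (count_space UNIV) (\<lambda>x. ennreal (measure M {x}))) borel (\<lambda>x. x)) A"
    by (subst emeasure_distr) (auto simp: emeasure_density)
  finally show "emeasure M A = emeasure (distr (density (count_space UNIV) (\<lambda>x. ennreal (measure M {x}))) borel (\<lambda>x. x)) A" .
qed

lemma discrete_integral:
  fixes f :: "real \<Rightarrow> real"
  assumes S: "countable S" "emeasure M (UNIV - S) = 0" and [measurable]: "f \<in> borel_measurable borel"
  shows "integrable M f \<longleftrightarrow> integrable (count_space UNIV) (\<lambda>x. measure M {x} * f x)"
    and "(\<integral>x. f x \<partial>M) = (\<integral>x. measure M {x} * f x \<partial>count_space UNIV)"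
proof -
  have "integrable M f \<longleftrightarrow> integrable (density (count_space UNIV) (\<lambda>x. ennreal (measure M {x}))) f"
    by (subst discrete_eq_distr_count[OF S]) (subst integrable_distr_eq, auto)
  also have "\<dots> \<longleftrightarrow> integrable (count_space UNIV) (\<lambda>x. measure M {x} * f x)"
    by (subst integrable_real_density) auto
  finally show "integrable M f \<longleftrightarrow> integrable (count_space UNIV) (\<lambda>x. measure M {x} * f x)" .
  have "(\<integral>x. f x \<partial>M) = (\<integral>x. f x \<partial>density (count_space UNIV) (\<lambda>x. ennreal (measure M {x})))"
    by (subst discrete_eq_distr_count[OF S]) (subst integral_distr, auto)
  also have "\<dots> = (\<integral>x. measure M {x} * f x \<partial>count_space UNIV)"
    by (subst integral_real_density) auto
  finally show "(\<integral>x. f x \<partial>M) = (\<integral>x. measure M {x} * f x \<partial>count_space UNIV)" .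
qed

lemma measurable_atom_mass [measurable]: "(\<lambda>x. measure M {x}) \<in> borel_measurable borel"
proof (rule borel_measurable_LIMSEQ_real)
  show "(\<lambda>m. mass m M (cell m x)) \<longlonglongrightarrow> measure M {x}" for x by (rule measure_cell_tendsto)
qed measurable

text \<open>The majorant is \<open>- ln\<close> of the atom mass: the cell contains its atom, so its
  mass is no smaller, and total mass at most 1 keeps both logarithms nonpositive. Integrability of
  this majorant under the law is finiteness of the entropy of the atoms.\<close>

lemma discrete_quantized_entropy:
  assumes S: "countable S" "emeasure M (UNIV - S) = 0" and le1: "measure M UNIV \<le> 1"
    and fin: "integrable (count_space UNIV) (\<lambda>x. eta (measure M {x}))"
  shows "integrable (count_space UNIV) (\<lambda>k. eta (mass m M k))"
    and "(\<lambda>m. \<integral>k. eta (mass m M k) \<partial>count_space UNIV) \<longlonglongrightarrow> (\<integral>x. eta (measure M {x}) \<partial>count_space UNIV)"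
proof -
  let ?w = "\<lambda>x. - ln (measure M {x})"
  let ?s = "\<lambda>m x. - ln (mass m M (cell m x))"
  have Sm[measurable]: "S \<in> sets borel" using S(1) by (rule countable_in_borel)
  note [measurable_cong] = M_is_borel
  have eta1: "eta = (\<lambda>t. t * (- ln t))" by (auto simp: eta_def)
  have w: "integrable M ?w" using fin discrete_integral(1)[OF S, of ?w] by (simp add: eta1)
  have wi: "(\<integral>x. ?w x \<partial>M) = (\<integral>x. eta (measure M {x}) \<partial>count_space UNIV)"
    using discrete_integral(2)[OF S, of ?w] by (simp add: eta1)
  \<comment> \<open>The points of \<open>S\<close> without mass are countably many null singletons,
    hence a null set; off it the logarithm is continuous at the limit.\<close>
  have pos: "AE x in M. 0 < measure M {x}"
  proof -
    let ?Z = "{x \<in> S. measure M {x} = 0}"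
    have Z: "countable ?Z" using S(1) by (rule countable_subset[rotated]) auto
    have "emeasure M ?Z = (\<integral>\<^sup>+x. emeasure M {x} \<partial>count_space ?Z)"
      using Z by (intro emeasure_countable_singleton) (auto simp: M_is_borel)
    also have "\<dots> = (\<integral>\<^sup>+x. 0 \<partial>count_space ?Z)"
      by (intro nn_integral_cong) (auto simp: emeasure_eq_measure)
    finally have "?Z \<in> null_sets M"
      using countable_in_borel[OF Z] by (auto simp: M_is_borel)
    moreover have "UNIV - S \<in> null_sets M" using S(2) by (auto simp: M_is_borel)
    ultimately have "AE x in M. x \<notin> ?Z" "AE x in M. x \<notin> UNIV - S" by (simp_all only: AE_not_in)
    then show ?thesis by eventually_elim (auto simp: less_le)
  qed
  have le: "measure M {x} \<le> mass m M (cell m x)" for m x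
    unfolding mass_def by (intro finite_measure_mono) auto
  have bound: "AE x in M. norm (?s m x) \<le> ?w x" for m
    using pos
  proof eventually_elim
    fix x assume x: "0 < measure M {x}"
    have "ln (measure M {x}) \<le> ln (mass m M (cell m x))" using x le[of x m] by (intro ln_mono) auto
    moreover have "ln (mass m M (cell m x)) \<le> 0"
      using x le[of x m] mass_le[of m "cell m x"] le1 by (subst ln_le_zero_iff) auto
    ultimately show "norm (?s m x) \<le> ?w x" by simp
  qed
  have lim: "AE x in M. (\<lambda>m. ?s m x) \<longlonglongrightarrow> ?w x"
    using pos
  proof eventually_elim
    fix x assume x: "0 < measure M {x}"
    show "(\<lambda>m. ?s m x) \<longlonglongrightarrow> ?w x"
      using x by (intro tendsto_intros measure_cell_tendsto) auto
  qed
  have "integrable M (?s m)" for m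
    using bound[of m] by (intro Bochner_Integration.integrable_bound[OF w]) (auto elim!: eventually_mono)
  then show "integrable (count_space UNIV) (\<lambda>k. eta (mass m M k))"
    using integrable_mass_iff[where m=m and f="\<lambda>k. - ln (mass m M k)"] by (simp add: eta1)
  have "(\<lambda>m. \<integral>x. ?s m x \<partial>M) \<longlonglongrightarrow> (\<integral>x. ?w x \<partial>M)"
    by (rule integral_dominated_convergence[OF _ _ w lim bound]) auto
  then show "(\<lambda>m. \<integral>k. eta (mass m M k) \<partial>count_space UNIV) \<longlonglongrightarrow> (\<integral>x. eta (measure M {x}) \<partial>count_space UNIV)"
    unfolding wi integral_mass[where f="\<lambda>k. - ln (mass m M k)" and m=m for m] by (simp add: eta1)
qed

end

text \<open>Two regimes. The finitely many cells meeting a finite set F that carries nearly all of A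
  are treated with \<open>4 * sqrt\<close> of the B-mass, which vanishes because B has no atoms. On
  the other cells the geometric mean is split by Young's inequality so that the small A-mass takes
  the large weight.\<close>

lemma eta_defect_vanishes:
  assumes A: "finite_borel_measure A" and B: "finite_borel_measure B"
    and S: "countable S" "emeasure A (UNIV - S) = 0"
    and le: "measure A UNIV \<le> 1" "measure B UNIV \<le> 1"
    and noatom: "\<And>x. measure B {x} = 0"
  shows "integrable (count_space UNIV) (\<lambda>k. eta (mass m A k) + eta (mass m B k) - eta (mass m A k + mass m B k))"
    and "(\<lambda>m. \<integral>k. eta (mass m A k) + eta (mass m B k) - eta (mass m A k + mass m B k) \<partial>count_space UNIV) \<longlonglongrightarrow> 0"
proof -
  interpret A: finite_borel_measure A by fact
  interpret B: finite_borel_measure B by fact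
  have Sm[measurable]: "S \<in> sets borel" using S(1) by (rule countable_in_borel)
  note [measurable_cong] = A.M_is_borel B.M_is_borel
  let ?a = "\<lambda>m k. mass m A k" and ?b = "\<lambda>m k. mass m B k"
  let ?J = "\<lambda>m k. eta (?a m k) + eta (?b m k) - eta (?a m k + ?b m k)"
  have J0: "0 \<le> ?J m k" for m k by (intro eta_add_defect) auto
  have J1: "?J m k \<le> 4 * sqrt (?a m k * ?b m k)" for m k by (intro eta_add_defect) auto
  have young: "?J m k \<le> 2 * (s * ?a m k + ?b m k / s)" if "s > 0" for m k s
  proof -
    have "2 * sqrt (?a m k * ?b m k) = 2 * sqrt (s * ?a m k) * sqrt (?b m k / s)"
      using that by (simp flip: real_sqrt_mult)
    also have "\<dots> \<le> (sqrt (s * ?a m k))\<^sup>2 + (sqrt (?b m k / s))\<^sup>2"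
      by (rule sum_squares_bound)
    also have "\<dots> = s * ?a m k + ?b m k / s" using that by simp
    finally show ?thesis using J1[of m k] by simp
  qed
  show int: "integrable (count_space UNIV) (?J m)" for m
  proof (rule Bochner_Integration.integrable_bound[where f="\<lambda>k. 2 * (1 * ?a m k + ?b m k / 1)"])
    show "integrable (count_space UNIV) (\<lambda>k. 2 * (1 * ?a m k + ?b m k / 1))"
      using A.mass_sums[of m] B.mass_sums[of m] by simp
    show "AE k in count_space UNIV. norm (?J m k) \<le> norm (2 * (1 * ?a m k + ?b m k / 1))"
      using young[of 1 m] J0[of m] by (intro AE_I2) (auto simp: abs_of_nonneg intro: order_trans)
  qed auto
  show "(\<lambda>m. \<integral>k. ?J m k \<partial>count_space UNIV) \<longlonglongrightarrow> 0"
  proof (rule LIMSEQ_I)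
    fix e :: real assume e: "0 < e"
    \<comment> \<open>With this s the B-term, at most \<open>2/s\<close>, is at most
      \<open>e/4\<close>; the bound \<open>e / (8 * s)\<close> on the mass off F makes the A-term,
      with weight \<open>2 * s\<close>, less than \<open>e/4\<close> as well. The cells of F get a
      third quarter.\<close>
    define s where "s = 8 / e"
    have s: "s > 0" using e by (simp add: s_def)
    obtain F where F: "finite F" "measure A (UNIV - F) < e / (8 * s)"
    proof -
      have "\<exists>F. finite F \<and> measure A (UNIV - F) < d" if d: "d > 0" for d
      proof -
        have "(\<lambda>n. measure A (from_nat_into S ` {..<n})) \<longlonglongrightarrow> measure A (\<Union>n. from_nat_into S ` {..<n})"
          by (rule A.finite_Lim_measure_incseq) (auto simp: incseq_def A.M_is_borel intro!: countable_in_borel)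
        then have "(\<lambda>n. measure A UNIV - measure A (from_nat_into S ` {..<n})) \<longlonglongrightarrow> measure A UNIV - measure A (\<Union>n. from_nat_into S ` {..<n})"
          by (intro tendsto_intros)
        moreover have "measure A (\<Union>n. from_nat_into S ` {..<n}) = measure A UNIV"
        proof (rule antisym)
          have S0: "measure A S = measure A UNIV"
            using A.finite_measure_compl[of S] S(2) by (simp add: A.M_is_borel measure_def)
          have "S \<subseteq> (\<Union>n. from_nat_into S ` {..<n})"
          proof
            fix x assume "x \<in> S"
            then obtain n where "x = from_nat_into S n" using S(1) by (metis from_nat_into_surj)
            then show "x \<in> (\<Union>n. from_nat_into S ` {..<n})" by (auto intro!: exI[of _ "Suc n"])
          qed
          then show "measure A UNIV \<le> measure A (\<Union>n. from_nat_into S ` {..<n})"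
            unfolding S0[symmetric] by (intro A.finite_measure_mono) (auto simp: A.M_is_borel intro!: countable_in_borel)
        qed (use A.bounded_measure in auto)
        ultimately have "(\<lambda>n. measure A UNIV - measure A (from_nat_into S ` {..<n})) \<longlonglongrightarrow> 0" by simp
        then have "\<forall>\<^sub>F n in sequentially. measure A UNIV - measure A (from_nat_into S ` {..<n}) < d"
          using d by (rule order_tendstoD)
        then obtain n where n: "measure A UNIV - measure A (from_nat_into S ` {..<n}) < d"
          by (auto simp: eventually_sequentially)
        have "from_nat_into S ` {..<n} \<in> sets A" by (auto simp: A.M_is_borel intro!: countable_in_borel)
        then show ?thesis
          using n A.finite_measure_compl[of "from_nat_into S ` {..<n}"]
          by (intro exI[of _ "from_nat_into S ` {..<n}"]) auto
      qed
      from this[of "e / (8 * s)"] e s that show ?thesis by auto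
    qed
    let ?g = "\<lambda>m. \<Sum>x\<in>F. 4 * sqrt (?b m (cell m x))"
    have "?g \<longlonglongrightarrow> (\<Sum>x\<in>F. 4 * sqrt 0)"
    proof (intro tendsto_intros tendsto_real_sqrt)
      show "(\<lambda>m. ?b m (cell m x)) \<longlonglongrightarrow> 0" for x using B.measure_cell_tendsto[of x] by (simp add: noatom)
    qed
    then have "\<forall>\<^sub>F m in sequentially. ?g m < e / 4" using e by (intro order_tendstoD) auto
    then obtain N where N: "\<And>m. m \<ge> N \<Longrightarrow> ?g m < e / 4" by (auto simp: eventually_sequentially)
    show "\<exists>no. \<forall>m\<ge>no. norm ((\<integral>k. ?J m k \<partial>count_space UNIV) - 0) < e"
    proof (intro exI allI impI)
      fix m assume m: "N \<le> m"
      let ?K = "cell m ` F"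
      let ?i = "\<lambda>k. indicator (- ?K) k :: real"
      let ?U = "\<lambda>k. 4 * sqrt (?b m k) * indicator ?K k + (2 * s * (?a m k * ?i k) + 2 / s * ?b m k)"
      have ia: "integrable (count_space UNIV) (\<lambda>k. ?a m k * ?i k)"
        "(\<integral>k. ?a m k * ?i k \<partial>count_space UNIV) = measure A (cell m -` (- ?K))"
      proof -
        have *: "?i (cell m x) = indicator (cell m -` (- ?K)) x" for x by (simp add: indicator_def)
        show "integrable (count_space UNIV) (\<lambda>k. ?a m k * ?i k)"
          unfolding A.integrable_mass_iff[where m=m and f="?i", symmetric] *
          by (intro integrable_real_indicator) (auto simp: A.M_is_borel A.emeasure_eq_measure)
        show "(\<integral>k. ?a m k * ?i k \<partial>count_space UNIV) = measure A (cell m -` (- ?K))"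
          unfolding A.integral_mass[where m=m and f="?i", symmetric] * by simp
      qed
      have "measure A (cell m -` (- ?K)) \<le> measure A (UNIV - F)"
      proof (intro A.finite_measure_mono)
        show "UNIV - F \<in> sets A" using F(1) countable_in_borel[of F] by (simp add: A.M_is_borel countable_finite sets.Diff)
      qed auto
      then have a1: "2 * s * (\<integral>k. ?a m k * ?i k \<partial>count_space UNIV) < e / 4"
      proof -
        assume "measure A (cell m -` (- ?K)) \<le> measure A (UNIV - F)"
        then have "2 * s * measure A (cell m -` (- ?K)) \<le> 2 * s * measure A (UNIV - F)" using s by simp
        also have "\<dots> < 2 * s * (e / (8 * s))" using F(2) s by (intro mult_strict_left_mono) auto
        also have "\<dots> = e / 4" using s by simp
        finally show ?thesis by (simp add: ia)
      qed
      have "2 / s * measure B UNIV \<le> 2 / s * 1" using le s by (intro mult_left_mono) auto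
      then have a2: "2 / s * measure B UNIV \<le> e / 4" by (simp add: s_def)
      have ik: "integrable (count_space UNIV) (\<lambda>k. 4 * sqrt (?b m k) * indicator ?K k)"
         and ikv: "(\<integral>k. 4 * sqrt (?b m k) * indicator ?K k \<partial>count_space UNIV) = (\<Sum>k\<in>?K. 4 * sqrt (?b m k))"
      proof -
        have "has_bochner_integral (count_space UNIV) (\<lambda>k. \<Sum>j\<in>?K. 4 * sqrt (?b m j) * indicator {j} k) (\<Sum>j\<in>?K. 4 * sqrt (?b m j) * 1)"
          by (intro has_bochner_integral_sum has_bochner_integral_mult_right)
             (auto simp: has_bochner_integral_iff)
        moreover have "(\<lambda>k. \<Sum>j\<in>?K. 4 * sqrt (?b m j) * indicator {j} k) = (\<lambda>k. 4 * sqrt (?b m k) * indicator ?K k)"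
          using F(1) by (auto simp: fun_eq_iff indicator_def sum.delta if_distrib cong: if_cong)
        ultimately show "integrable (count_space UNIV) (\<lambda>k. 4 * sqrt (?b m k) * indicator ?K k)"
          "(\<integral>k. 4 * sqrt (?b m k) * indicator ?K k \<partial>count_space UNIV) = (\<Sum>k\<in>?K. 4 * sqrt (?b m k))"
          by (auto simp: has_bochner_integral_iff)
      qed
      have iU: "integrable (count_space UNIV) ?U"
        using ik ia B.mass_sums[of m] by (intro Bochner_Integration.integrable_add integrable_mult_right) auto
      have "(\<integral>k. ?J m k \<partial>count_space UNIV) \<le> (\<integral>k. ?U k \<partial>count_space UNIV)"
      proof (rule integral_mono[OF int iU])
        fix k
        show "?J m k \<le> ?U k"
        proof (cases "k \<in> ?K")
          case True
          have "?a m k * ?b m k \<le> 1 * ?b m k" using A.mass_le[of m k] le by (intro mult_right_mono) auto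
          then have "4 * sqrt (?a m k * ?b m k) \<le> 4 * sqrt (?b m k)" by simp
          moreover have "0 \<le> 2 / s * ?b m k" using s by simp
          moreover have "?U k = 4 * sqrt (?b m k) + 2 / s * ?b m k" using True by simp
          ultimately show ?thesis using J1[of m k] by linarith
        next
          case False
          then show ?thesis using young[OF s, of m k] by (simp add: algebra_simps)
        qed
      qed
      also have "\<dots> = (\<Sum>k\<in>?K. 4 * sqrt (?b m k)) + (2 * s * (\<integral>k. ?a m k * ?i k \<partial>count_space UNIV) + 2 / s * measure B UNIV)"
        using ik ia B.mass_sums[of m] by (simp add: ikv)
      finally have 1: "(\<integral>k. ?J m k \<partial>count_space UNIV) \<le>
          (\<Sum>k\<in>?K. 4 * sqrt (?b m k)) + (2 * s * (\<integral>k. ?a m k * ?i k \<partial>count_space UNIV) + 2 / s * measure B UNIV)" .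
      \<comment> \<open>Points of F may share a cell, so the sum over the image is only bounded by
        the sum over F.\<close>
      have "(\<Sum>k\<in>?K. 4 * sqrt (?b m k)) \<le> ?g m"
        using sum_image_le[OF F(1), of "\<lambda>k. 4 * sqrt (?b m k)" "cell m"] by (simp add: o_def)
      then have "(\<integral>k. ?J m k \<partial>count_space UNIV) < e"
        using 1 N[OF m] a1 a2 e by linarith
      moreover have "0 \<le> (\<integral>k. ?J m k \<partial>count_space UNIV)" using J0 by (intro Bochner_Integration.integral_nonneg) auto
      ultimately show "norm ((\<integral>k. ?J m k \<partial>count_space UNIV) - 0) < e" by simp
    qed
  qed
qed

section \<open>Quantized entropy of measures with a density\<close>

lemma AE_lborel_if_negligible:
  assumes "negligible N" "\<And>x. x \<notin> N \<Longrightarrow> P x"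
  shows "AE x in lborel. P (x::real)"
proof -
  have "N \<in> null_sets lebesgue" using assms(1) by (simp add: negligible_iff_null_sets)
  then have "AE x in lebesgue. P x"
    by (rule AE_I') (use assms(2) in auto)
  then show ?thesis by (simp add: AE_completion_iff)
qed

text \<open>The estimate is kept in the form with factor h, not as a quotient, so that left and
  right estimates can be added over adjacent intervals.\<close>

lemma lebesgue_right_differentiation:
  fixes g :: "real \<Rightarrow> real"
  assumes "integrable lborel g"
  shows "AE x in lborel. \<forall>e>0. \<exists>d>0. \<forall>h. 0 < h \<and> h < d \<longrightarrow>
           \<bar>(\<integral>t. indicator {x..x+h} t * g t \<partial>lborel) - h * g x\<bar> \<le> e * h"
proof -
  have "g integrable_on cbox a b" for a b
    using integrable_on_lborel[OF assms] integrable_on_subcbox[of g UNIV a b] by simp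
  then obtain N where N: "negligible N"
     "\<And>x e. \<lbrakk>x \<notin> N; 0 < e\<rbrakk> \<Longrightarrow> \<exists>d>0. \<forall>h. 0 < h \<and> h < d \<longrightarrow>
         norm(integral (cbox x (x + h *\<^sub>R One)) g /\<^sub>R h ^ DIM(real) - g x) < e"
    using integrable_ccontinuous_explicit[of g] by metis
  have eq: "integral {a..b} g = (\<integral>t. indicator {a..b} t * g t \<partial>lborel)" for a b
  proof -
    have "set_integrable lborel {a..b} g"
      unfolding set_integrable_def using assms by (intro integrable_mult_indicator) auto
    then show ?thesis using set_borel_integral_eq_integral(2)[of "{a..b}" g]
      by (simp add: set_lebesgue_integral_def)
  qed
  show ?thesis
  proof (rule AE_lborel_if_negligible[OF N(1)], intro allI impI)
    fix x e :: real assume "x \<notin> N" "0 < e"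
    then obtain d where d: "d > 0" "\<And>h. 0 < h \<Longrightarrow> h < d \<Longrightarrow>
         norm(integral (cbox x (x + h *\<^sub>R One)) g /\<^sub>R h ^ DIM(real) - g x) < e"
      using N(2) by metis
    show "\<exists>d>0. \<forall>h. 0 < h \<and> h < d \<longrightarrow>
           \<bar>(\<integral>t. indicator {x..x+h} t * g t \<partial>lborel) - h * g x\<bar> \<le> e * h"
    proof (intro exI[of _ d] conjI d(1) allI impI)
      fix h assume h: "0 < h \<and> h < d"
      have "\<bar>integral {x..x+h} g / h - g x\<bar> < e"
        using d(2)[of h] h by (simp add: divide_inverse_commute)
      then have "\<bar>integral {x..x+h} g / h - g x\<bar> * h \<le> e * h" using h by (intro mult_right_mono) auto
      moreover have "\<bar>integral {x..x+h} g / h - g x\<bar> * h = \<bar>(integral {x..x+h} g / h - g x) * h\<bar>"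
        using h by (simp add: abs_mult)
      moreover have "(integral {x..x+h} g / h - g x) * h = integral {x..x+h} g - h * g x"
        using h by (simp add: field_simps)
      ultimately show "\<bar>(\<integral>t. indicator {x..x+h} t * g t \<partial>lborel) - h * g x\<bar> \<le> e * h"
        by (simp add: eq)
    qed
  qed
qed

text \<open>Reflection in the origin of the right-sided statement.\<close>

lemma lebesgue_left_differentiation:
  fixes g :: "real \<Rightarrow> real"
  assumes g: "integrable lborel g"
  shows "AE x in lborel. \<forall>e>0. \<exists>d>0. \<forall>h. 0 < h \<and> h < d \<longrightarrow>
           \<bar>(\<integral>t. indicator {x-h..x} t * g t \<partial>lborel) - h * g x\<bar> \<le> e * h"
proof -
  have "integrable lborel (\<lambda>x. g (- x))"
    using lborel_integrable_real_affine[OF g, of "-1" 0] by simp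
  from lebesgue_right_differentiation[OF this]
  have *: "AE x in distr lborel borel uminus. \<forall>e>0. \<exists>d>0. \<forall>h. 0 < h \<and> h < d \<longrightarrow>
           \<bar>(\<integral>t. indicator {x..x+h} t * g (- t) \<partial>lborel) - h * g (- x)\<bar> \<le> e * h"
    by (subst lborel_distr_uminus)
  have "AE x in lborel. \<forall>e>0. \<exists>d>0. \<forall>h. 0 < h \<and> h < d \<longrightarrow>
           \<bar>(\<integral>t. indicator {-x..-x+h} t * g (- t) \<partial>lborel) - h * g x\<bar> \<le> e * h"
    using AE_distrD[OF _ *] by simp
  moreover have "(\<integral>t. indicator {-x..-x+h} t * g (- t) \<partial>lborel) = (\<integral>t. indicator {x-h..x} t * g t \<partial>lborel)" for x h
    by (subst lborel_integral_real_affine[of "-1" _ 0]) (auto intro!: Bochner_Integration.integral_cong simp: indicator_def)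
  ultimately show ?thesis by simp
qed

text \<open>A cell around x need be neither centred at x nor one-sided. It is cut at x and the two
  one-sided estimates are added; their errors are proportional to the lengths of the pieces, which
  sum to \<open>1/m\<close>.\<close>

lemma lebesgue_differentiation_cell:
  fixes g :: "real \<Rightarrow> real"
  assumes g: "integrable lborel g"
  shows "AE x in lborel. (\<lambda>m. real m * (\<integral>t. indicator (cell m -` {cell m x}) t * g t \<partial>lborel)) \<longlonglongrightarrow> g x"
  using lebesgue_right_differentiation[OF g] lebesgue_left_differentiation[OF g]
proof eventually_elim
  fix x
  assume R: "\<forall>e>0. \<exists>d>0. \<forall>h. 0 < h \<and> h < d \<longrightarrow>
           \<bar>(\<integral>t. indicator {x..x+h} t * g t \<partial>lborel) - h * g x\<bar> \<le> e * h"
    and L: "\<forall>e>0. \<exists>d>0. \<forall>h. 0 < h \<and> h < d \<longrightarrow>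
           \<bar>(\<integral>t. indicator {x-h..x} t * g t \<partial>lborel) - h * g x\<bar> \<le> e * h"
  let ?I = "\<lambda>A. \<integral>t. indicator A t * g t \<partial>lborel"
  have int: "integrable lborel (\<lambda>t. indicator A t * g t)" if "A \<in> sets borel" for A
    using integrable_mult_indicator[OF _ g, of A] that by simp
  have single: "?I {x..x} = 0"
  proof -
    have "AE t in lborel. indicator {x..x} t * g t = 0"
      using AE_lborel_singleton[of x] by eventually_elim (auto simp: indicator_def)
    then show ?thesis using integral_cong_AE[of "\<lambda>t. indicator {x..x} t * g t" lborel "\<lambda>_. 0"] g by simp
  qed
  show "(\<lambda>m. real m * ?I (cell m -` {cell m x})) \<longlonglongrightarrow> g x"
  proof (rule LIMSEQ_I)
    fix e :: real assume e: "0 < e"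
    obtain d1 where d1: "d1 > 0" "\<And>h. 0 < h \<Longrightarrow> h < d1 \<Longrightarrow> \<bar>?I {x..x+h} - h * g x\<bar> \<le> e/2 * h"
      using R[rule_format, of "e/2"] e by auto
    obtain d2 where d2: "d2 > 0" "\<And>h. 0 < h \<Longrightarrow> h < d2 \<Longrightarrow> \<bar>?I {x-h..x} - h * g x\<bar> \<le> e/2 * h"
      using L[rule_format, of "e/2"] e by auto
    obtain N where N: "N > 0" "inverse (real N) < min d1 d2"
      using reals_Archimedean[of "min d1 d2"] d1 d2 by (metis min_less_iff_conj zero_less_Suc)
    show "\<exists>no. \<forall>m\<ge>no. norm (real m * ?I (cell m -` {cell m x}) - g x) < e"
    proof (intro exI allI impI)
      fix m assume m: "N \<le> m"
      then have m1: "m \<ge> 1" using N by simp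
      define l u where "l = (of_int (cell m x) - 1/2) / real m" and "u = (of_int (cell m x) + 1/2) / real m"
      have c: "cell m -` {cell m x} = {l..<u}" unfolding l_def u_def by (rule cell_vimage[OF m1])
      have "x \<in> cell m -` {cell m x}" by simp
      then have lu: "l \<le> x" "x < u" unfolding c by auto
      have ul: "u - l = 1 / real m" unfolding u_def l_def by (simp flip: diff_divide_distrib)
      have "1 / real m \<le> inverse (real N)" using m N by (simp add: field_simps)
      then have sm: "u - l < d1" "u - l < d2" using N ul by auto
      have r: "\<bar>?I {x..u} - (u - x) * g x\<bar> \<le> e/2 * (u - x)"
        using d1(2)[of "u - x"] lu sm by simp
      \<comment> \<open>x may be the left end of its half-open cell; then the left piece degenerates
        to a point and \<open>single\<close> replaces the estimate.\<close>
      have l: "\<bar>?I {l..x} - (x - l) * g x\<bar> \<le> e/2 * (x - l)"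
        using d2(2)[of "x - l"] lu sm single by (cases "l = x") auto
      have "?I {l..<u} = ?I {l..x} + ?I {x..u}"
      proof -
        have "?I {l..<u} = (\<integral>t. indicator {l..x} t * g t + indicator {x..u} t * g t \<partial>lborel)"
        proof (rule integral_cong_AE)
          show "AE t in lborel. indicator {l..<u} t * g t = indicator {l..x} t * g t + indicator {x..u} t * g t"
            using AE_lborel_singleton[of x] AE_lborel_singleton[of u]
            by eventually_elim (use lu in \<open>auto simp: indicator_def\<close>)
        qed (use int in \<open>auto intro: borel_measurable_integrable\<close>)
        then show ?thesis using int by simp
      qed
      then have "\<bar>?I {l..<u} - (u - l) * g x\<bar> \<le> e/2 * (u - l)"
      proof -
        assume "?I {l..<u} = ?I {l..x} + ?I {x..u}"
        then have "?I {l..<u} - (u - l) * g x = (?I {l..x} - (x - l) * g x) + (?I {x..u} - (u - x) * g x)"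
          by (simp add: algebra_simps)
        moreover have "e/2 * (u - l) = e/2 * (x - l) + e/2 * (u - x)" by (simp add: field_simps)
        ultimately show ?thesis using l r by linarith
      qed
      then have "real m * \<bar>?I {l..<u} - (u - l) * g x\<bar> \<le> real m * (e/2 * (u - l))"
        by (intro mult_left_mono) auto
      then have "\<bar>real m * (?I {l..<u} - (u - l) * g x)\<bar> \<le> e/2"
        using m1 by (simp only: abs_mult ul) simp
      moreover have "real m * (?I {l..<u} - (u - l) * g x) = real m * ?I {l..<u} - g x"
        using m1 by (simp add: ul field_simps)
      ultimately show "norm (real m * ?I (cell m -` {cell m x}) - g x) < e"
        using e by (simp add: c)
    qed
  qed
qed

text \<open>The kernel lies below the exponential density plus its reflection, each of mass 1. The
  bound is uniform in y, which gives integrability of the smoothed density.\<close>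

lemma laplace_kernel_integral_finite:
  "(\<integral>\<^sup>+x. ennreal (exp (- \<bar>x - y\<bar>)) \<partial>lborel) \<le> 2" for y :: real
proof -
  have "(\<integral>\<^sup>+x. ennreal (exp (- \<bar>x - y\<bar>)) \<partial>lborel) = (\<integral>\<^sup>+x. ennreal (exp (- \<bar>x\<bar>)) \<partial>lborel)"
    by (subst nn_integral_real_affine[of _ 1 y]) auto
  also have "\<dots> \<le> (\<integral>\<^sup>+x. ennreal (exponential_density 1 x) + ennreal (exponential_density 1 (- x)) \<partial>lborel)"
    by (intro nn_integral_mono) (auto simp: exponential_density_def simp flip: ennreal_plus)
  also have "\<dots> = (\<integral>\<^sup>+x. ennreal (exponential_density 1 x) \<partial>lborel) + (\<integral>\<^sup>+x. ennreal (exponential_density 1 (- x)) \<partial>lborel)"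
    by (rule nn_integral_add) auto
  also have "(\<integral>\<^sup>+x. ennreal (exponential_density 1 (- x)) \<partial>lborel) = (\<integral>\<^sup>+x. ennreal (exponential_density 1 x) \<partial>lborel)"
    by (subst nn_integral_real_affine[of _ "-1" 0]) auto
  also have "(\<integral>\<^sup>+x. ennreal (exponential_density 1 x) \<partial>lborel) = 1"
    using prob_space.emeasure_space_1[OF prob_space_exponential_density[of 1]] by (simp add: emeasure_density)
  finally show ?thesis by (simp add: one_add_one)
qed

text \<open>At \<open>l = 0\<close>, where \<open>ln\<close> is not continuous, the bound
  \<open>eta t \<le> 2 * sqrt t\<close> takes over; it follows from \<open>eta_mult\<close> applied
  to \<open>sqrt t * sqrt t\<close>.\<close>

lemma eta_tendsto:
  assumes x: "x \<longlonglongrightarrow> l" and x0: "\<And>m. 0 \<le> x m"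
  shows "(\<lambda>m. eta (x m)) \<longlonglongrightarrow> eta l"
proof -
  have l: "0 \<le> l" using x x0 by (intro LIMSEQ_le_const[OF x]) auto
  show ?thesis
  proof (cases "l = 0")
    case False
    then show ?thesis unfolding eta_def using x by (intro tendsto_intros) auto
  next
    case True
    have b: "eta t \<le> 2 * sqrt t" if "0 \<le> t" for t
    proof -
      have "eta t = 2 * (sqrt t * eta (sqrt t))"
        using eta_mult[of "sqrt t" "sqrt t"] that by simp
      also have "sqrt t * eta (sqrt t) \<le> sqrt t * (1 - sqrt t)"
        using that by (intro mult_left_mono eta_le) auto
      also have "\<dots> \<le> sqrt t * 1" using that by (intro mult_left_mono) auto
      finally show ?thesis by simp
    qed
    have s: "(\<lambda>m. 2 * sqrt (x m)) \<longlonglongrightarrow> 2 * sqrt 0"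
      using x True by (intro tendsto_intros) auto
    have "\<forall>\<^sub>F m in sequentially. x m < 1" using x True by (intro order_tendstoD) auto
    then have "\<forall>\<^sub>F m in sequentially. 0 \<le> eta (x m)"
      by eventually_elim (use x0 in \<open>auto intro: eta_nonneg\<close>)
    then have "(\<lambda>m. eta (x m)) \<longlonglongrightarrow> 0"
    proof (rule tendsto_sandwich)
      show "\<forall>\<^sub>F m in sequentially. eta (x m) \<le> 2 * sqrt (x m)"
        using b x0 by (intro always_eventually allI) blast
      show "(\<lambda>m. 2 * sqrt (x m)) \<longlonglongrightarrow> 0" using s by simp
    qed simp
    then show ?thesis using True by simp
  qed
qed

text \<open>Finite rather than probability measures, because the continuous part of a mixed law is
  used without normalization.\<close>

locale density_measure =
  fixes g :: "real \<Rightarrow> real" and B :: "real measure"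
  assumes g_meas [measurable]: "g \<in> borel_measurable borel"
    and g_nonneg: "\<And>x. 0 \<le> g x"
    and g_int: "integrable lborel g"
    and B_def: "B = density lborel (\<lambda>x. ennreal (g x))"
begin

lemma sets_B [simp, measurable_cong]: "sets B = sets borel"
  by (simp add: B_def)

lemma emeasure_B: "A \<in> sets borel \<Longrightarrow> emeasure B A = ennreal (\<integral>t. indicator A t * g t \<partial>lborel)"
proof -
  assume [measurable]: "A \<in> sets borel"
  have "emeasure B A = (\<integral>\<^sup>+t. ennreal (indicator A t * g t) \<partial>lborel)"
    unfolding B_def by (subst emeasure_density) (auto intro!: nn_integral_cong simp: indicator_def)
  also have "\<dots> = ennreal (\<integral>t. indicator A t * g t \<partial>lborel)"
    using integrable_mult_indicator[OF _ g_int, of A] g_nonneg by (intro nn_integral_eq_integral) auto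
  finally show ?thesis .
qed

lemma measure_B: "A \<in> sets borel \<Longrightarrow> measure B A = (\<integral>t. indicator A t * g t \<partial>lborel)"
  using emeasure_B[of A] g_nonneg by (simp add: measure_def)

sublocale finite_borel_measure B
proof (intro finite_borel_measure.intro finite_measureI finite_borel_measure_axioms.intro)
  have "space B = UNIV" by (simp add: B_def)
  then show "emeasure B (space B) \<noteq> \<infinity>" using emeasure_B[of UNIV] by simp
qed simp

lemma measure_B_UNIV: "measure B UNIV = (\<integral>t. g t \<partial>lborel)"
  using measure_B[of UNIV] by simp

lemma integrable_B_iff: "f \<in> borel_measurable borel \<Longrightarrow> integrable B f \<longleftrightarrow> integrable lborel (\<lambda>x. g x * f x :: real)"
  unfolding B_def by (subst integrable_real_density) (auto simp: g_nonneg)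

lemma integral_B: "f \<in> borel_measurable borel \<Longrightarrow> (\<integral>x. f x \<partial>B) = (\<integral>x. g x * f x \<partial>lborel)" for f :: "real \<Rightarrow> real"
  unfolding B_def by (subst integral_real_density) (auto simp: g_nonneg)

lemma AE_B_iff: "(AE x in B. P x) \<longleftrightarrow> (AE x in lborel. 0 < g x \<longrightarrow> P x)"
  unfolding B_def by (subst AE_density) (auto simp: g_nonneg)

lemma measure_B_singleton: "measure B {x} = 0"
proof -
  have "emeasure B {x} = 0"
  proof -
    have "{x} \<in> null_sets lborel" by auto
    then have "{x} \<in> null_sets B"
      unfolding B_def using absolutely_continuousI_density[of "\<lambda>x. ennreal (g x)" lborel]
      by (auto simp: absolutely_continuous_def)
    then show ?thesis by auto
  qed
  then show ?thesis by (simp add: measure_def)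
qed

text \<open>The cells without mass are countably many null sets.\<close>

lemma AE_mass_pos: "AE x in B. 0 < mass m B (cell m x)"
proof -
  have "(\<integral>\<^sup>+x. (if mass m B (cell m x) = 0 then 1 else 0) \<partial>B) = 0"
    by (subst nn_integral_mass[where f="\<lambda>k. if mass m B k = 0 then 1 else 0"])
       (auto simp: nn_integral_0_iff_AE AE_count_space)
  then have "AE x in B. (if mass m B (cell m x) = 0 then 1 else 0 :: ennreal) = 0"
    by (subst (asm) nn_integral_0_iff_AE) auto
  then show ?thesis by eventually_elim (auto simp: less_le split: if_splits)
qed

text \<open>The reference density of the relative entropy argument: convolution with the Laplace kernel makes its
  logarithm Lipschitz.\<close>

definition smooth :: "real \<Rightarrow> real" where
  "smooth x = (\<integral>y. exp (- \<bar>x - y\<bar>) \<partial>B)"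

lemma integrable_kernel: "integrable B (\<lambda>y. exp (- \<bar>x - y\<bar>))"
  by (rule integrable_const_bound[where B=1]) auto

lemma smooth_measurable [measurable]: "smooth \<in> borel_measurable borel"
  unfolding smooth_def by measurable

lemma smooth_le: "smooth x \<le> measure B UNIV"
proof -
  have "smooth x \<le> (\<integral>y. 1 \<partial>B)" unfolding smooth_def
    by (intro integral_mono integrable_kernel) auto
  then show ?thesis by simp
qed

lemma smooth_pos: "measure B UNIV > 0 \<Longrightarrow> 0 < smooth x"
proof -
  assume q: "measure B UNIV > 0"
  have "0 \<le> smooth x" unfolding smooth_def by (intro Bochner_Integration.integral_nonneg) auto
  moreover have "smooth x \<noteq> 0"
  proof
    assume "smooth x = 0"
    then have "AE y in B. exp (- \<bar>x - y\<bar>) = 0" unfolding smooth_def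
      using integral_nonneg_eq_0_iff_AE[OF integrable_kernel[of x]] by auto
    then have "AE y in B. False" by simp
    then have "emeasure B UNIV = 0" by (simp add: AE_iff_null null_sets_def)
    then show False using q by (simp add: measure_def)
  qed
  ultimately show ?thesis by simp
qed

text \<open>The triangle inequality for the exponent, integrated. This comparison of values at two
  points gives the Lipschitz bound on the logarithm and lets the midpoint of a cell stand for any of
  its points.\<close>

lemma smooth_shift: "smooth x \<le> exp \<bar>x - z\<bar> * smooth z"
proof -
  have "smooth x \<le> (\<integral>y. exp \<bar>x - z\<bar> * exp (- \<bar>z - y\<bar>) \<partial>B)"
    unfolding smooth_def by (intro integral_mono integrable_kernel integrable_mult_right) (auto simp flip: exp_add)
  then show ?thesis by (simp add: smooth_def)
qed

lemma ln_smooth_lipschitz: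
  assumes "measure B UNIV > 0"
  shows "\<bar>ln (smooth x) - ln (smooth z)\<bar> \<le> \<bar>x - z\<bar>"
proof -
  have "ln (smooth x) \<le> \<bar>x - z\<bar> + ln (smooth z)" for x z
  proof -
    have "ln (smooth x) \<le> ln (exp \<bar>x - z\<bar> * smooth z)"
      using smooth_shift[of x z] smooth_pos[OF assms] by (intro ln_mono) auto
    also have "\<dots> = \<bar>x - z\<bar> + ln (smooth z)"
      using smooth_pos[OF assms, of z] by (subst ln_mult) auto
    finally show ?thesis .
  qed
  from this[of x z] this[of z x] show ?thesis by linarith
qed

lemma smooth_integrable: "integrable lborel smooth"
proof (rule integrableI_nonneg)
  show "AE x in lborel. 0 \<le> smooth x" unfolding smooth_def by (auto intro!: Bochner_Integration.integral_nonneg)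
  interpret pair_sigma_finite lborel B ..
  have "(\<integral>\<^sup>+x. ennreal (smooth x) \<partial>lborel) = (\<integral>\<^sup>+x. \<integral>\<^sup>+y. ennreal (exp (- \<bar>x - y\<bar>)) \<partial>B \<partial>lborel)"
    unfolding smooth_def by (intro nn_integral_cong nn_integral_eq_integral[symmetric] integrable_kernel) auto
  also have "\<dots> = (\<integral>\<^sup>+y. \<integral>\<^sup>+x. ennreal (exp (- \<bar>x - y\<bar>)) \<partial>lborel \<partial>B)"
    by (rule Fubini'[symmetric]) measurable
  also have "\<dots> \<le> (\<integral>\<^sup>+y. 2 \<partial>B)"
    by (intro nn_integral_mono laplace_kernel_integral_finite)
  also have "\<dots> < \<infinity>" by (simp add: emeasure_eq_measure ennreal_mult_less_top)
  finally show "(\<integral>\<^sup>+x. ennreal (smooth x) \<partial>lborel) < \<infinity>" .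
qed simp

text \<open>Two points of one cell of step 1 are less than 1 apart, so the kernel is at least
  \<open>exp (- 1)\<close> there. This is the link from the entropy at step 1 to the reference
  density.\<close>

lemma smooth_ge_mass: "exp (- 1) * mass 1 B (cell 1 x) \<le> smooth x"
proof -
  have "exp (- 1) * mass 1 B (cell 1 x) = (\<integral>y. exp (- 1) * indicator (cell 1 -` {cell 1 x}) y \<partial>B)"
    by (simp add: mass_def)
  also have "\<dots> \<le> smooth x" unfolding smooth_def
  proof (intro integral_mono integrable_kernel)
    fix y show "exp (- 1) * indicator (cell 1 -` {cell 1 x}) y \<le> exp (- \<bar>x - y\<bar>)"
      using cell_eq_imp_dist[of 1 x y] by (auto simp: indicator_def)
  qed (auto simp: emeasure_eq_measure)
  finally show ?thesis .
qed

text \<open>The logarithm lies between \<open>ln\<close> of the step 1 cell mass minus 1 and 0, the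
  upper bound because the total mass is at most 1. The integral of \<open>- ln\<close> of the cell
  mass under B is the entropy at step 1.\<close>

lemma integrable_ln_smooth:
  assumes q: "measure B UNIV > 0" "measure B UNIV \<le> 1"
    and H1: "integrable (count_space UNIV) (\<lambda>k. eta (mass 1 B k))"
  shows "integrable B (\<lambda>x. ln (smooth x))"
proof (rule Bochner_Integration.integrable_bound)
  have "integrable (count_space UNIV) (\<lambda>k. mass 1 B k * (1 - ln (mass 1 B k)))"
    using Bochner_Integration.integrable_add[OF mass_sums(1)[of 1] H1] by (simp add: eta_def algebra_simps)
  then show "integrable B (\<lambda>x. 1 - ln (mass 1 B (cell 1 x)))"
    by (subst integrable_mass_iff[where f="\<lambda>k. 1 - ln (mass 1 B k)"])
  show "AE x in B. norm (ln (smooth x)) \<le> norm (1 - ln (mass 1 B (cell 1 x)))"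
    using AE_mass_pos[of 1]
  proof eventually_elim
    fix x assume x: "0 < mass 1 B (cell 1 x)"
    have "ln (exp (- 1) * mass 1 B (cell 1 x)) \<le> ln (smooth x)"
      using smooth_ge_mass[of x] x by (intro ln_mono) auto
    then have "ln (mass 1 B (cell 1 x)) - 1 \<le> ln (smooth x)" using x by (simp add: ln_mult)
    moreover have "ln (smooth x) \<le> 0" using smooth_pos[OF q(1), of x] smooth_le[of x] q(2)
      by (subst ln_le_zero_iff) auto
    ultimately show "norm (ln (smooth x)) \<le> norm (1 - ln (mass 1 B (cell 1 x)))" by simp
  qed
qed simp

text \<open>The midpoint of a cell. A reference density sampled at midpoints is constant on cells,
  so its logarithm has the same integral against the averaged density as against B.\<close>

abbreviation node :: "nat \<Rightarrow> int \<Rightarrow> real" where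
  "node m k \<equiv> real_of_int k / real m"

lemma dist_node: "m \<ge> 1 \<Longrightarrow> \<bar>x - node m (cell m x)\<bar> \<le> 1 / real m"
proof -
  assume m: "m \<ge> 1"
  have "cell m (node m (cell m x)) = cell m x" using m by (simp add: cell_def floor_eq_iff)
  then show ?thesis using cell_eq_imp_dist[OF m, of x "node m (cell m x)"] by simp
qed

lemma smooth_node_le: "m \<ge> 1 \<Longrightarrow> smooth (node m (cell m x)) \<le> exp 1 * smooth x"
proof -
  assume m: "m \<ge> 1"
  have "0 \<le> smooth x" unfolding smooth_def by (intro Bochner_Integration.integral_nonneg) auto
  have "\<bar>node m (cell m x) - x\<bar> \<le> 1 / real m" using dist_node[OF m, of x] by (simp add: abs_minus_commute)
  also have "\<dots> \<le> 1" using m by simp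
  finally have "exp \<bar>node m (cell m x) - x\<bar> * smooth x \<le> exp 1 * smooth x"
    using \<open>0 \<le> smooth x\<close> by (intro mult_right_mono) auto
  then show ?thesis using smooth_shift[of "node m (cell m x)" x] by simp
qed

lemma integrable_smooth_node: "m \<ge> 1 \<Longrightarrow> integrable lborel (\<lambda>x. smooth (node m (cell m x)))"
proof -
  assume m: "m \<ge> 1"
  have "0 \<le> smooth x" for x unfolding smooth_def by (intro Bochner_Integration.integral_nonneg) auto
  then show ?thesis using smooth_node_le[OF m]
    by (intro Bochner_Integration.integrable_bound[OF integrable_mult_right[OF smooth_integrable, of "exp 1"]]) auto
qed

lemma tendsto_smooth_node: "(\<lambda>m. smooth (node m (cell m x))) \<longlonglongrightarrow> smooth x"
proof (rule tendsto_sandwich[where f="\<lambda>m. exp (- (1 / real m)) * smooth x" and h="\<lambda>m. exp (1 / real m) * smooth x"])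
  have *: "(\<lambda>m. 1 / real m) \<longlonglongrightarrow> 0" by (rule lim_1_over_n)
  have pos: "0 \<le> smooth x" for x unfolding smooth_def by (intro Bochner_Integration.integral_nonneg) auto
  have "(\<lambda>m. exp (- (1 / real m)) * smooth x) \<longlonglongrightarrow> exp (- 0) * smooth x"
    by (intro tendsto_intros *)
  then show "(\<lambda>m. exp (- (1 / real m)) * smooth x) \<longlonglongrightarrow> smooth x" by simp
  have "(\<lambda>m. exp (1 / real m) * smooth x) \<longlonglongrightarrow> exp 0 * smooth x"
    by (intro tendsto_intros *)
  then show "(\<lambda>m. exp (1 / real m) * smooth x) \<longlonglongrightarrow> smooth x" by simp
  show "\<forall>\<^sub>F m in sequentially. exp (- (1 / real m)) * smooth x \<le> smooth (node m (cell m x))"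
  proof (rule eventually_sequentiallyI[of 1])
    fix m :: nat assume m: "1 \<le> m"
    have "exp \<bar>x - node m (cell m x)\<bar> * smooth (node m (cell m x)) \<le> exp (1 / real m) * smooth (node m (cell m x))"
      using dist_node[OF m, of x] pos by (intro mult_right_mono) auto
    then have "smooth x \<le> exp (1 / real m) * smooth (node m (cell m x))"
      using smooth_shift[of x "node m (cell m x)"] by simp
    then show "exp (- (1 / real m)) * smooth x \<le> smooth (node m (cell m x))"
      by (simp add: exp_minus field_simps)
  qed
  show "\<forall>\<^sub>F m in sequentially. smooth (node m (cell m x)) \<le> exp (1 / real m) * smooth x"
  proof (rule eventually_sequentiallyI[of 1])
    fix m :: nat assume m: "1 \<le> m"
    have "exp \<bar>node m (cell m x) - x\<bar> * smooth x \<le> exp (1 / real m) * smooth x"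
      using dist_node[OF m, of x] pos by (intro mult_right_mono) (auto simp: abs_minus_commute)
    then show "smooth (node m (cell m x)) \<le> exp (1 / real m) * smooth x"
      using smooth_shift[of "node m (cell m x)" x] by simp
  qed
qed

definition avg :: "nat \<Rightarrow> real \<Rightarrow> real" where
  "avg m x = real m * mass m B (cell m x)"

lemma avg_measurable [measurable]: "avg m \<in> borel_measurable borel"
  unfolding avg_def by measurable

lemma avg_nonneg: "0 \<le> avg m x" by (simp add: avg_def)

lemma avg_tendsto: "AE x in lborel. (\<lambda>m. avg m x) \<longlonglongrightarrow> g x"
  using lebesgue_differentiation_cell[OF g_int]
  by (simp add: avg_def mass_def measure_B)

lemma lborel_cell_integrable:
  fixes f :: "int \<Rightarrow> real"
  assumes "m \<ge> 1"
  shows "integrable lborel (\<lambda>x. f (cell m x)) \<longleftrightarrow> integrable (count_space UNIV) (\<lambda>k. 1 / real m * f k)"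
  by (rule integrable_cell_iff[OF sets_lborel emeasure_lborel_cell[OF assms]]) simp

lemma lborel_cell_integral:
  fixes f :: "int \<Rightarrow> real"
  assumes "m \<ge> 1"
  shows "(\<integral>x. f (cell m x) \<partial>lborel) = (\<integral>k. 1 / real m * f k \<partial>count_space UNIV)"
  by (rule integral_cell[OF sets_lborel emeasure_lborel_cell[OF assms]]) simp

theorem density_quantized_entropy:
  assumes q: "measure B UNIV > 0" "measure B UNIV \<le> 1"
    and eg: "integrable lborel (\<lambda>x. eta (g x))"
    and H1: "integrable (count_space UNIV) (\<lambda>k. eta (mass 1 B k))"
  shows "m \<ge> 1 \<Longrightarrow> integrable (count_space UNIV) (\<lambda>k. eta (mass m B k))"
    and "(\<lambda>m. (\<integral>k. eta (mass m B k) \<partial>count_space UNIV) - measure B UNIV * ln (real m)) \<longlonglongrightarrow> (\<integral>x. eta (g x) \<partial>lborel)"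
proof -
  let ?q = "measure B UNIV"
  let ?r = "\<lambda>m x. smooth (node m (cell m x))"
  note pos = smooth_pos[OF q(1)]
  note ilr = integrable_ln_smooth[OF q H1]
  have diff_ln: "\<bar>ln (?r m x) - ln (smooth x)\<bar> \<le> 1 / real m" if "m \<ge> 1" for m x
    using ln_smooth_lipschitz[OF q(1), of "node m (cell m x)" x] dist_node[OF that, of x]
    by (simp add: abs_minus_commute)
  have ilrm: "integrable B (\<lambda>x. ln (?r m x))" if m: "m \<ge> 1" for m
  proof (rule Bochner_Integration.integrable_bound)
    show "integrable B (\<lambda>x. \<bar>ln (smooth x)\<bar> + 1)" using ilr by auto
    show "AE x in B. norm (ln (?r m x)) \<le> norm (\<bar>ln (smooth x)\<bar> + 1)"
    proof (rule AE_I2)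
      fix x
      have "1 / real m \<le> 1" using m by simp
      then show "norm (ln (?r m x)) \<le> norm (\<bar>ln (smooth x)\<bar> + 1)" using diff_ln[OF m, of x] unfolding real_norm_def by linarith
    qed
  qed simp
  have sum_ln: "integrable (count_space UNIV) (\<lambda>k. mass m B k * ln (smooth (node m k)))" if "m \<ge> 1" for m
    using ilrm[OF that] integrable_mass_iff[where f="\<lambda>k. ln (smooth (node m k))" and m=m] by simp
  have sum_r: "integrable (count_space UNIV) (\<lambda>k. smooth (node m k))" if m: "m \<ge> 1" for m
  proof -
    have "integrable (count_space UNIV) (\<lambda>k. 1 / real m * smooth (node m k))"
      using integrable_smooth_node[OF m] lborel_cell_integrable[OF m, of "\<lambda>k. smooth (node m k)"] by simp
    then have "integrable (count_space UNIV) (\<lambda>k. real m * (1 / real m * smooth (node m k)))"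
      by (rule integrable_mult_right)
    then show ?thesis using m by simp
  qed
  \<comment> \<open>Nonnegative and below the Gibbs bound with the reference values at the
    midpoints, whose sum is finite together with the cross term; this is where finiteness passes
    from step 1 to every resolution.\<close>
  show eta_int: "integrable (count_space UNIV) (\<lambda>k. eta (mass m B k))" if m: "m \<ge> 1" for m
  proof (rule Bochner_Integration.integrable_bound)
    show "integrable (count_space UNIV) (\<lambda>k. smooth (node m k) - mass m B k - mass m B k * ln (smooth (node m k)))"
      using sum_r[OF m] sum_ln[OF m] mass_sums(1)[of m] by auto
    show "AE k in count_space UNIV. norm (eta (mass m B k)) \<le> norm (smooth (node m k) - mass m B k - mass m B k * ln (smooth (node m k)))"
    proof (rule AE_I2)
      fix k
      have "0 \<le> eta (mass m B k)" using mass_le[of m k] q by (intro eta_nonneg) auto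
      moreover have "eta (mass m B k) \<le> smooth (node m k) - mass m B k - mass m B k * ln (smooth (node m k))"
        using pos by (intro eta_le_cross) auto
      ultimately show "norm (eta (mass m B k)) \<le> norm (smooth (node m k) - mass m B k - mass m B k * ln (smooth (node m k)))"
        by simp
    qed
  qed simp
  \<comment> \<open>\<open>S\<close> is the quantity whose limit is sought; by the scaling rule for
    \<open>eta\<close> it is also the integral of \<open>eta (avg m x)\<close>.\<close>
  define S where "S = (\<lambda>m. (\<integral>k. eta (mass m B k) \<partial>count_space UNIV) - ?q * ln (real m))"
  have eta_avg: "1 / real m * eta (real m * mass m B k) = eta (mass m B k) - ln (real m) * mass m B k" if "m \<ge> 1" for m k
  proof -
    have "eta (real m * mass m B k) = real m * eta (mass m B k) + eta (real m) * mass m B k"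
      by (intro eta_mult) auto
    then show ?thesis using that by (simp add: eta_def[of "real m"] diff_divide_distrib)
  qed
  have avg_eta_int: "integrable lborel (\<lambda>x. eta (avg m x))" and avg_eta: "(\<integral>x. eta (avg m x) \<partial>lborel) = S m" if m: "m \<ge> 1" for m
  proof -
    show "integrable lborel (\<lambda>x. eta (avg m x))"
      unfolding avg_def lborel_cell_integrable[OF m, of "\<lambda>k. eta (real m * mass m B k)"] eta_avg[OF m]
      by (intro Bochner_Integration.integrable_diff eta_int[OF m] integrable_mult_right mass_sums)
    show "(\<integral>x. eta (avg m x) \<partial>lborel) = S m"
      unfolding avg_def lborel_cell_integral[OF m, of "\<lambda>k. eta (real m * mass m B k)"] eta_avg[OF m]
      using eta_int[OF m] mass_sums[of m] by (simp add: S_def mult.commute)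
  qed
  have avg_int: "integrable lborel (avg m)" "(\<integral>x. avg m x \<partial>lborel) = ?q" if m: "m \<ge> 1" for m
    using lborel_cell_integrable[OF m, of "\<lambda>k. real m * mass m B k"] lborel_cell_integral[OF m, of "\<lambda>k. real m * mass m B k"]
      mass_sums[of m] m unfolding avg_def [abs_def] by simp_all
  have avg_ln_int: "integrable lborel (\<lambda>x. avg m x * ln (?r m x))"
    "(\<integral>x. avg m x * ln (?r m x) \<partial>lborel) = (\<integral>x. ln (?r m x) \<partial>B)" if m: "m \<ge> 1" for m
    using lborel_cell_integrable[OF m, of "\<lambda>k. real m * mass m B k * ln (smooth (node m k))"]
      lborel_cell_integral[OF m, of "\<lambda>k. real m * mass m B k * ln (smooth (node m k))"]
      integral_mass[where f="\<lambda>k. ln (smooth (node m k))" and m=m]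
      sum_ln[OF m] m unfolding avg_def [abs_def] by simp_all
  \<comment> \<open>\<open>ln (avg m x)\<close> is constant on cells, so its integral against g
    equals its integral against the averaged density, which is \<open>- S m\<close>.\<close>
  have g_ln_avg: "integrable B (\<lambda>x. ln (avg m x))" "(\<integral>x. ln (avg m x) \<partial>B) = - S m" if m: "m \<ge> 1" for m
  proof -
    have *: "mass m B k * ln (real m * mass m B k) = ln (real m) * mass m B k - eta (mass m B k)" for k
      using m by (cases "mass m B k = 0") (auto simp: eta_def ln_mult algebra_simps)
    show "integrable B (\<lambda>x. ln (avg m x))"
      unfolding avg_def integrable_mass_iff[where f="\<lambda>k. ln (real m * mass m B k)" and m=m] *
      by (intro Bochner_Integration.integrable_diff eta_int[OF m] integrable_mult_right mass_sums)
    show "(\<integral>x. ln (avg m x) \<partial>B) = - S m"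
      unfolding avg_def integral_mass[where f="\<lambda>k. ln (real m * mass m B k)" and m=m] *
      using eta_int[OF m] mass_sums[of m] by (simp add: S_def mult.commute)
  qed
  let ?E = "\<integral>x. eta (g x) \<partial>lborel"
  \<comment> \<open>Jensen's inequality, obtained by integrating Gibbs' inequality with reference
    \<open>avg m x\<close>: the first two terms have equal integrals and cancel, the third
    contributes \<open>S m\<close>.\<close>
  have lower: "?E \<le> S m" if m: "m \<ge> 1" for m
  proof -
    have i: "integrable lborel (\<lambda>x. g x * ln (avg m x))" using g_ln_avg(1)[OF m] by (subst (asm) integrable_B_iff) auto
    have "?E \<le> (\<integral>x. avg m x - g x - g x * ln (avg m x) \<partial>lborel)"
    proof (intro integral_mono_AE eg)
      show "integrable lborel (\<lambda>x. avg m x - g x - g x * ln (avg m x))"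
        using avg_int[OF m] g_int i by auto
      \<comment> \<open>Gibbs' inequality asks for a positive reference value; almost everywhere the
        average is positive where g is.\<close>
      have "AE x in lborel. 0 < g x \<longrightarrow> 0 < mass m B (cell m x)"
        using AE_mass_pos[of m] by (simp add: AE_B_iff)
      then show "AE x in lborel. eta (g x) \<le> avg m x - g x - g x * ln (avg m x)"
      proof eventually_elim
        fix x assume x: "0 < g x \<longrightarrow> 0 < mass m B (cell m x)"
        show "eta (g x) \<le> avg m x - g x - g x * ln (avg m x)"
        proof (cases "0 < g x")
          case True
          then have "0 < avg m x" using x m by (simp add: avg_def)
          then show ?thesis using True by (intro eta_le_cross) auto
        next
          case False
          then have "g x = 0" using g_nonneg[of x] by simp
          then show ?thesis using avg_nonneg by simp
        qed
      qed
    qed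
    also have "\<dots> = (\<integral>x. avg m x \<partial>lborel) - (\<integral>x. g x \<partial>lborel) - (\<integral>x. g x * ln (avg m x) \<partial>lborel)"
      using avg_int[OF m] g_int i by simp
    also have "\<dots> = S m"
      using avg_int[OF m] g_ln_avg(2)[OF m] by (subst (asm) integral_B) (auto simp: measure_B_UNIV)
    finally show ?thesis .
  qed
  \<comment> \<open>Relative entropy integrands of the cell averages and of g with respect to the reference density; both
    are nonnegative, so Fatou's lemma applies.\<close>
  let ?psi = "\<lambda>m x. ?r m x - avg m x - avg m x * ln (?r m x) - eta (avg m x)"
  let ?phi = "\<lambda>x. smooth x - g x - g x * ln (smooth x) - eta (g x)"
  \<comment> \<open>\<open>T\<close> and \<open>T0\<close> collect the terms of the integrals of
    \<open>?psi\<close> and \<open>?phi\<close> that do not involve \<open>eta\<close>; the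
    integrals are then \<open>T m - S m\<close> and \<open>T0 - ?E\<close>.\<close>
  define T where "T = (\<lambda>m. (\<integral>x. ?r m x \<partial>lborel) - ?q - (\<integral>x. ln (?r m x) \<partial>B))"
  define T0 where "T0 = (\<integral>x. smooth x \<partial>lborel) - ?q - (\<integral>x. ln (smooth x) \<partial>B)"
  have T: "T \<longlonglongrightarrow> T0" unfolding T_def T0_def
  proof (intro tendsto_diff tendsto_const)
    have "(\<lambda>m. \<integral>x. ?r (Suc m) x \<partial>lborel) \<longlonglongrightarrow> (\<integral>x. smooth x \<partial>lborel)"
    proof (rule integral_dominated_convergence)
      show "integrable lborel (\<lambda>x. exp 1 * smooth x)" using smooth_integrable by auto
      show "AE x in lborel. (\<lambda>m. ?r (Suc m) x) \<longlonglongrightarrow> smooth x"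
        using LIMSEQ_Suc[OF tendsto_smooth_node] by (intro AE_I2) simp
      show "AE x in lborel. norm (?r (Suc m) x) \<le> exp 1 * smooth x" for m
        using smooth_node_le[of "Suc m"] pos by (intro AE_I2) (simp add: abs_of_pos)
    qed auto
    then show "(\<lambda>m. \<integral>x. ?r m x \<partial>lborel) \<longlonglongrightarrow> (\<integral>x. smooth x \<partial>lborel)" by (rule LIMSEQ_imp_Suc)
    have "(\<lambda>m. \<integral>x. ln (?r (Suc m) x) \<partial>B) \<longlonglongrightarrow> (\<integral>x. ln (smooth x) \<partial>B)"
    proof (rule integral_dominated_convergence)
      show "integrable B (\<lambda>x. \<bar>ln (smooth x)\<bar> + 1)" using ilr by auto
      show "AE x in B. (\<lambda>m. ln (?r (Suc m) x)) \<longlonglongrightarrow> ln (smooth x)"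
        using LIMSEQ_Suc[OF tendsto_ln[OF tendsto_smooth_node]] pos by (intro AE_I2) (simp add: less_imp_neq[THEN not_sym])
      show "AE x in B. norm (ln (?r (Suc m) x)) \<le> \<bar>ln (smooth x)\<bar> + 1" for m
      proof (rule AE_I2)
        fix x
        have "1 / real (Suc m) \<le> 1" by simp
        then show "norm (ln (?r (Suc m) x)) \<le> \<bar>ln (smooth x)\<bar> + 1"
          using diff_ln[of "Suc m" x] unfolding real_norm_def by linarith
      qed
    qed auto
    then show "(\<lambda>m. \<integral>x. ln (?r m x) \<partial>B) \<longlonglongrightarrow> (\<integral>x. ln (smooth x) \<partial>B)" by (rule LIMSEQ_imp_Suc)
  qed
  have ig: "integrable lborel (\<lambda>x. g x * ln (smooth x))" using ilr by (subst (asm) integrable_B_iff) auto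
  have psi_int: "integrable lborel (?psi m)" "(\<integral>x. ?psi m x \<partial>lborel) = T m - S m" if m: "m \<ge> 1" for m
    using integrable_smooth_node[OF m] avg_int[OF m] avg_ln_int[OF m] avg_eta_int[OF m] avg_eta[OF m]
    by (auto simp: T_def)
  have phi_int: "integrable lborel ?phi" "(\<integral>x. ?phi x \<partial>lborel) = T0 - ?E"
    using smooth_integrable g_int ig eg integral_B[of "\<lambda>x. ln (smooth x)"] by (auto simp: T0_def measure_B_UNIV)
  have psi_nonneg: "0 \<le> ?psi m x" for m x
    using eta_le_cross[OF avg_nonneg[of m x] pos[of "node m (cell m x)"]] by simp
  have phi_nonneg: "0 \<le> ?phi x" for x
    using eta_le_cross[OF g_nonneg[of x] pos[of x]] by simp
  have lim: "AE x in lborel. (\<lambda>m. ?psi m x) \<longlonglongrightarrow> ?phi x"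
    using avg_tendsto
  proof eventually_elim
    fix x assume x: "(\<lambda>m. avg m x) \<longlonglongrightarrow> g x"
    have "(\<lambda>m. eta (avg m x)) \<longlonglongrightarrow> eta (g x)"
      using x avg_nonneg by (rule eta_tendsto)
    then show "(\<lambda>m. ?psi m x) \<longlonglongrightarrow> ?phi x"
      using pos[of x] by (intro tendsto_intros x tendsto_smooth_node) auto
  qed
  have psi_nn: "(\<integral>\<^sup>+x. ennreal (?psi m x) \<partial>lborel) = ennreal (T m - S m)" if m: "m \<ge> 1" for m
    unfolding psi_int(2)[OF m, symmetric] by (intro nn_integral_eq_integral psi_int(1)[OF m] AE_I2 psi_nonneg)
  have TS: "0 \<le> T m - S m" if m: "m \<ge> 1" for m
    unfolding psi_int(2)[OF m, symmetric] by (intro Bochner_Integration.integral_nonneg psi_nonneg)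
  have fatou: "ennreal (T0 - ?E) \<le> liminf (\<lambda>m. ennreal (T (Suc m) - S (Suc m)))"
  proof -
    have "ennreal (T0 - ?E) = (\<integral>\<^sup>+x. ennreal (?phi x) \<partial>lborel)"
      using phi_int phi_nonneg by (subst nn_integral_eq_integral) auto
    also have "\<dots> = (\<integral>\<^sup>+x. liminf (\<lambda>m. ennreal (?psi (Suc m) x)) \<partial>lborel)"
    proof (rule nn_integral_cong_AE)
      show "AE x in lborel. ennreal (?phi x) = liminf (\<lambda>m. ennreal (?psi (Suc m) x))"
        using lim
      proof eventually_elim
        fix x assume "(\<lambda>m. ?psi m x) \<longlonglongrightarrow> ?phi x"
        then have "(\<lambda>m. ennreal (?psi (Suc m) x)) \<longlonglongrightarrow> ennreal (?phi x)"
          by (intro tendsto_ennrealI LIMSEQ_Suc)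
        then show "ennreal (?phi x) = liminf (\<lambda>m. ennreal (?psi (Suc m) x))"
          by (intro lim_imp_Liminf[symmetric]) auto
      qed
    qed
    also have "\<dots> \<le> liminf (\<lambda>m. \<integral>\<^sup>+x. ennreal (?psi (Suc m) x) \<partial>lborel)"
      by (rule nn_integral_liminf) measurable
    also have "(\<lambda>m. \<integral>\<^sup>+x. ennreal (?psi (Suc m) x) \<partial>lborel) = (\<lambda>m. ennreal (T (Suc m) - S (Suc m)))"
      by (intro ext psi_nn) simp
    finally show ?thesis .
  qed
  have "S \<longlonglongrightarrow> ?E"
  proof (rule LIMSEQ_imp_Suc, rule LIMSEQ_I)
    fix e :: real assume e: "0 < e"
    \<comment> \<open>Fatou gives a lower bound for \<open>T - S\<close>, hence an upper bound for
      \<open>S\<close> once \<open>T\<close> converges. The case distinction is due to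
      \<open>ennreal\<close>, under which negative numbers become 0.\<close>
    have "\<forall>\<^sub>F m in sequentially. T0 - ?E - e/2 < T (Suc m) - S (Suc m)"
    proof (cases "T0 - ?E - e/2 < 0")
      case True
      have "0 \<le> T (Suc m) - S (Suc m)" for m by (rule TS) simp
      then show ?thesis using True by (intro always_eventually allI) (rule less_le_trans)
    next
      case False
      have "ennreal (T0 - ?E - e/2) < ennreal (T0 - ?E)"
        using False e by (intro ennreal_lessI) auto
      then have "\<forall>\<^sub>F m in sequentially. ennreal (T0 - ?E - e/2) < ennreal (T (Suc m) - S (Suc m))"
        using fatou unfolding le_Liminf_iff by auto
      then show ?thesis using False by (auto elim!: eventually_mono simp: ennreal_less_iff)
    qed
    moreover have "\<forall>\<^sub>F m in sequentially. T (Suc m) < T0 + e/2"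
      using order_tendstoD(2)[OF LIMSEQ_Suc[OF T], of "T0 + e/2"] e by simp
    ultimately have "\<forall>\<^sub>F m in sequentially. norm (S (Suc m) - ?E) < e"
    proof eventually_elim
      case (elim m)
      then show ?case using lower[of "Suc m"] by simp
    qed
    then show "\<exists>no. \<forall>m\<ge>no. norm (S (Suc m) - ?E) < e" by (simp add: eventually_sequentially)
  qed
  then show "(\<lambda>m. (\<integral>k. eta (mass m B k) \<partial>count_space UNIV) - ?q * ln (real m)) \<longlonglongrightarrow> ?E"
    by (simp add: S_def)
qed

end

section \<open>Convolutions\<close>

lemma real_distribution_is_finite_borel: "real_distribution M \<Longrightarrow> finite_borel_measure M"
  by (rule real_distribution.finite_borel_measure_M)

lemma real_distribution_convolution:
  assumes "real_distribution M" "real_distribution N"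
  shows "real_distribution (M \<star> N)"
proof -
  interpret M: real_distribution M by fact
  interpret N: real_distribution N by fact
  interpret pair_prob_space M N ..
  show ?thesis unfolding convolution_def by (intro real_distribution_distr) measurable
qed

lemma char_convolution:
  assumes "real_distribution M" "real_distribution N"
  shows "char (M \<star> N) t = char M t * char N t"
proof -
  interpret M: real_distribution M by fact
  interpret N: real_distribution N by fact
  interpret pair_prob_space M N ..
  have i: "integrable (M \<Otimes>\<^sub>M N) (\<lambda>(x, y). iexp (t * x) * iexp (t * y))"
    by (intro integrable_const_bound[where B=1]) (auto simp: norm_mult)
  have "char (M \<star> N) t = (\<integral>z. (case z of (x, y) \<Rightarrow> iexp (t * x) * iexp (t * y)) \<partial>(M \<Otimes>\<^sub>M N))"
    unfolding char_def convolution_def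
    by (subst integral_distr) (auto intro!: Bochner_Integration.integral_cong simp: exp_add distrib_left split_beta')
  also have "\<dots> = (\<integral>x. \<integral>y. iexp (t * x) * iexp (t * y) \<partial>N \<partial>M)"
    using integral_fst'[OF i] by simp
  also have "\<dots> = char M t * char N t" by (simp add: char_def)
  finally show ?thesis .
qed

lemma convolution_eqI_char:
  assumes "real_distribution M" "real_distribution N" "real_distribution L"
    and "\<And>t. char L t = char M t * char N t"
  shows "L = (M \<star> N)"
  using assms by (intro Levy_uniqueness real_distribution_convolution) (auto simp: char_convolution)

lemma real_distribution_return: "real_distribution (return borel (x::real))"
  unfolding real_distribution_def real_distribution_axioms_def
  by (auto intro!: prob_space_return)

lemma char_return: "char (return borel x) t = iexp (t * x)"
  unfolding char_def by (subst integral_return) auto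

primrec convpow :: "real measure \<Rightarrow> nat \<Rightarrow> real measure" where
  "convpow M 0 = return borel 0"
| "convpow M (Suc k) = (M \<star> convpow M k)"

lemma real_distribution_convpow: "real_distribution M \<Longrightarrow> real_distribution (convpow M k)"
  by (induction k) (auto intro: real_distribution_return real_distribution_convolution)

lemma char_convpow: "real_distribution M \<Longrightarrow> char (convpow M k) t = char M t ^ k"
  by (induction k) (auto simp: char_return char_convolution real_distribution_convpow)

text \<open>The sum of a point of cell k and a point of cell j lies in the interval from
  \<open>k + j - 1\<close> to \<open>k + j + 1\<close>, which is covered by three unit
  cells.\<close>

lemma convolution_mass_le:
  assumes M: "real_distribution M" and R: "real_distribution R"
  shows "mass 1 M k * mass 1 R j \<le> mass 1 (M \<star> R) (k + j - 1) + mass 1 (M \<star> R) (k + j) + mass 1 (M \<star> R) (k + j + 1)"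
proof -
  interpret M: real_distribution M by fact
  interpret R: real_distribution R by fact
  interpret C: real_distribution "M \<star> R" using M R by (rule real_distribution_convolution)
  interpret pair_prob_space M R ..
  let ?c = "\<lambda>k. cell 1 -` {k}"
  let ?U = "?c (k + j - 1) \<union> ?c (k + j) \<union> ?c (k + j + 1)"
  have Us: "?U \<in> sets borel" by measurable
  have "mass 1 M k * mass 1 R j = measure (M \<Otimes>\<^sub>M R) (?c k \<times> ?c j)"
    unfolding mass_def measure_def by (subst R.emeasure_pair_measure_Times) (auto simp: enn2real_mult)
  also have "\<dots> \<le> measure (M \<Otimes>\<^sub>M R) ((\<lambda>(x, y). x + y) -` ?U \<inter> space (M \<Otimes>\<^sub>M R))"
  proof (rule finite_measure_mono)
    show "?c k \<times> ?c j \<subseteq> (\<lambda>(x, y). x + y) -` ?U \<inter> space (M \<Otimes>\<^sub>M R)"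
      unfolding cell_vimage[OF order_refl] by (auto simp: space_pair_measure cell_vimage)
    show "(\<lambda>(x, y). x + y) -` ?U \<inter> space (M \<Otimes>\<^sub>M R) \<in> sets (M \<Otimes>\<^sub>M R)"
      using Us by (intro measurable_sets[where A=borel]) measurable
  qed
  also have "\<dots> = measure (M \<star> R) ?U"
    unfolding convolution_def using Us by (subst measure_distr) auto
  also have "\<dots> \<le> measure (M \<star> R) (?c (k + j - 1) \<union> ?c (k + j)) + measure (M \<star> R) (?c (k + j + 1))"
    by (rule measure_Un_le) auto
  also have "measure (M \<star> R) (?c (k + j - 1) \<union> ?c (k + j)) \<le> measure (M \<star> R) (?c (k + j - 1)) + measure (M \<star> R) (?c (k + j))"
    by (rule measure_Un_le) auto
  finally show ?thesis unfolding mass_def by simp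
qed

text \<open>One cell j charged by R is fixed. Up to the factor \<open>1 / mass 1 R j\<close>, each
  cell mass of M is below a sum of three neighbouring cell masses of the convolution, and
  \<open>abs_eta_dominated\<close> transfers the summability.\<close>

lemma quantized_entropy_factor_finite:
  assumes M: "real_distribution M" and R: "real_distribution R"
    and fin: "integrable (count_space UNIV) (\<lambda>k. eta (mass 1 (M \<star> R) k))"
  shows "integrable (count_space UNIV) (\<lambda>k. eta (mass 1 M k))"
proof -
  interpret M: real_distribution M by fact
  interpret R: real_distribution R by fact
  interpret C: real_distribution "M \<star> R" using M R by (rule real_distribution_convolution)
  obtain j where j: "mass 1 R j > 0"
  proof (rule ccontr)
    assume "\<not> thesis"
    then have "mass 1 R j = 0" for j using that[of j] mass_nonneg[of 1 R j] by argo
    then have "mass 1 R = (\<lambda>_. 0)" by auto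
    then show False using R.mass_sums(2)[of 1] R.prob_space by simp
  qed
  have j1: "mass 1 R j \<le> 1" unfolding mass_def by simp
  define c where "c = 1 / mass 1 R j"
  have c: "c \<ge> 1" using j j1 by (simp add: c_def)
  let ?q = "mass 1 (M \<star> R)"
  define u where "u k = ?q (k + j - 1) + ?q (k + j) + ?q (k + j + 1)" for k
  have u0: "0 \<le> u k" for k by (simp add: u_def)
  have shift: "integrable (count_space UNIV) (\<lambda>k. f (k + i))" if "integrable (count_space UNIV) f" for f :: "int \<Rightarrow> real" and i
    using integrable_bij_count_space[of "\<lambda>k. k + i" UNIV UNIV f] that
    by (simp add: bij_plus_right)
  have iq: "integrable (count_space UNIV) ?q" by (rule C.mass_sums)
  have iu: "integrable (count_space UNIV) u"
    unfolding u_def using shift[OF iq, of "j - 1"] shift[OF iq, of j] shift[OF iq, of "j+1"]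
    by (auto simp: algebra_simps)
  have q1: "0 \<le> eta (?q k)" for k using C.mass_le[of 1 k] C.prob_space by (intro eta_nonneg) auto
  have eta_u_le: "eta (u k) \<le> eta (?q (k + j - 1)) + eta (?q (k + j)) + eta (?q (k + j + 1))" for k
    using eta_add_defect(1)[of "?q (k + j - 1) + ?q (k + j)" "?q (k + j + 1)"]
      eta_add_defect(1)[of "?q (k + j - 1)" "?q (k + j)"] by (simp add: u_def)
  \<comment> \<open>The three cells are disjoint, so their total mass is at most 1 and
    \<open>eta (u k)\<close> is nonnegative; with subadditivity of \<open>eta\<close> this bounds
    its absolute value.\<close>
  have u1: "u k \<le> 1" for k
  proof -
    have "(\<Sum>i\<in>{k+j-1, k+j, k+j+1}. ?q i) = measure (M \<star> R) (\<Union>i\<in>{k+j-1, k+j, k+j+1}. cell 1 -` {i})"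
      unfolding mass_def by (intro C.finite_measure_finite_Union[symmetric]) (auto simp: disjoint_family_on_def)
    also have "\<dots> \<le> 1" by simp
    finally show ?thesis by (simp add: u_def algebra_simps)
  qed
  have eta_u: "\<bar>eta (u k)\<bar> \<le> eta (?q (k + j - 1)) + eta (?q (k + j)) + eta (?q (k + j + 1))" for k
    using eta_u_le[of k] eta_nonneg[OF u0 u1, of k] by simp
  have ieu: "integrable (count_space UNIV) (\<lambda>k. eta (?q (k + j - 1)) + eta (?q (k + j)) + eta (?q (k + j + 1)))"
    using shift[OF fin, of "j - 1"] shift[OF fin, of j] shift[OF fin, of "j+1"]
    by (auto simp: algebra_simps)
  show ?thesis
  proof (rule Bochner_Integration.integrable_bound)
    show "integrable (count_space UNIV) (\<lambda>k. (1 + c * ln c) * u k + c * (eta (?q (k + j - 1)) + eta (?q (k + j)) + eta (?q (k + j + 1))))"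
      by (rule Bochner_Integration.integrable_add[OF integrable_mult_right[OF iu] integrable_mult_right[OF ieu]])
    show "AE k in count_space UNIV. norm (eta (mass 1 M k)) \<le> norm ((1 + c * ln c) * u k + c * (eta (?q (k + j - 1)) + eta (?q (k + j)) + eta (?q (k + j + 1))))"
    proof (rule AE_I2)
      fix k
      have "mass 1 M k \<le> c * u k"
        using convolution_mass_le[OF M R, of k j] j by (simp add: c_def u_def field_simps)
      then have "\<bar>eta (mass 1 M k)\<bar> \<le> (1 + c * ln c) * u k + c * \<bar>eta (u k)\<bar>"
        using c u0 by (intro abs_eta_dominated) auto
      also have "\<dots> \<le> (1 + c * ln c) * u k + c * (eta (?q (k + j - 1)) + eta (?q (k + j)) + eta (?q (k + j + 1)))"
        using eta_u[of k] c by (intro add_left_mono mult_left_mono) auto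
      finally show "norm (eta (mass 1 M k)) \<le> norm ((1 + c * ln c) * u k + c * (eta (?q (k + j - 1)) + eta (?q (k + j)) + eta (?q (k + j + 1))))"
        by simp
    qed
  qed simp
qed

text \<open>For almost every x the density of A is the mean of \<open>g (x - y)\<close> under R.
  Concavity of \<open>eta\<close> gives the inequality pointwise, and integration in x removes the
  translation by y.\<close>

lemma convolution_density_entropy_le:
  assumes f: "density_measure f A" and g: "density_measure g B" and R: "real_distribution R"
    and A: "A = (B \<star> R)"
    and ef: "integrable lborel (\<lambda>x. eta (f x))" and eg: "integrable lborel (\<lambda>x. eta (g x))"
  shows "(\<integral>x. eta (g x) \<partial>lborel) \<le> (\<integral>x. eta (f x) \<partial>lborel)"
proof -
  interpret f: density_measure f A by fact
  interpret g: density_measure g B by fact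
  interpret R: real_distribution R by fact
  interpret P: pair_sigma_finite lborel R ..
  have fin: "finite_measure B" "finite_measure R" by unfold_locales
  define F where "F x = (\<integral>\<^sup>+y. ennreal (g (x - y)) \<partial>R)" for x
  have Fm[measurable]: "F \<in> borel_measurable borel" unfolding F_def by measurable
  have "density lborel (\<lambda>x. ennreal (f x)) = density lborel F"
  proof (rule measure_eqI)
    fix S assume "S \<in> sets (density lborel (\<lambda>x. ennreal (f x)))"
    then have [measurable]: "S \<in> sets borel" by simp
    have "emeasure A S = (\<integral>\<^sup>+x. \<integral>\<^sup>+y. indicator S (x + y) \<partial>B \<partial>R)"
      unfolding A using fin by (subst convolution_commutative) (auto intro!: convolution_emeasure')
    also have "\<dots> = (\<integral>\<^sup>+x. \<integral>\<^sup>+y. ennreal (g y) * indicator S (x + y) \<partial>lborel \<partial>R)"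
      unfolding g.B_def by (intro nn_integral_cong) (subst nn_integral_density, auto)
    also have "\<dots> = (\<integral>\<^sup>+x. \<integral>\<^sup>+y. ennreal (g (y - x)) * indicator S y \<partial>lborel \<partial>R)"
    proof (rule nn_integral_cong)
      fix x
      show "(\<integral>\<^sup>+y. ennreal (g y) * indicator S (x + y) \<partial>lborel) = (\<integral>\<^sup>+y. ennreal (g (y - x)) * indicator S y \<partial>lborel)"
        by (subst nn_integral_real_affine[of _ 1 "-x"]) (auto simp: algebra_simps)
    qed
    also have "\<dots> = (\<integral>\<^sup>+y. \<integral>\<^sup>+x. ennreal (g (y - x)) * indicator S y \<partial>R \<partial>lborel)"
      by (rule P.Fubini') measurable
    also have "\<dots> = (\<integral>\<^sup>+y. F y * indicator S y \<partial>lborel)"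
      unfolding F_def by (intro nn_integral_cong nn_integral_multc) measurable
    also have "\<dots> = emeasure (density lborel F) S" by (simp add: emeasure_density)
    finally show "emeasure (density lborel (\<lambda>x. ennreal (f x))) S = emeasure (density lborel F) S"
      by (simp add: f.B_def)
  qed simp
  then have fF: "AE x in lborel. ennreal (f x) = F x"
    by (intro sigma_finite_measure.density_unique[OF lborel.sigma_finite_measure_axioms]) auto
  have ip: "integrable (lborel \<Otimes>\<^sub>M R) (\<lambda>(x, y). eta (g (x - y)))"
  proof (rule integrableI_bounded)
    have "(\<integral>\<^sup>+z. ennreal (norm (case z of (x, y) \<Rightarrow> eta (g (x - y)))) \<partial>(lborel \<Otimes>\<^sub>M R))
       = (\<integral>\<^sup>+x. \<integral>\<^sup>+y. ennreal \<bar>eta (g (x - y))\<bar> \<partial>R \<partial>lborel)"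
      by (subst R.nn_integral_fst[symmetric]) auto
    also have "\<dots> = (\<integral>\<^sup>+y. \<integral>\<^sup>+x. ennreal \<bar>eta (g (x - y))\<bar> \<partial>lborel \<partial>R)"
      by (rule P.Fubini'[symmetric]) measurable
    also have "\<dots> = (\<integral>\<^sup>+y. \<integral>\<^sup>+x. ennreal \<bar>eta (g x)\<bar> \<partial>lborel \<partial>R)"
    proof (rule nn_integral_cong)
      fix y show "(\<integral>\<^sup>+x. ennreal \<bar>eta (g (x - y))\<bar> \<partial>lborel) = (\<integral>\<^sup>+x. ennreal \<bar>eta (g x)\<bar> \<partial>lborel)"
        by (subst nn_integral_real_affine[of _ 1 y]) auto
    qed
    also have "\<dots> < \<infinity>" using eg R.emeasure_space_1 by (simp add: integrable_iff_bounded)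
    finally show "(\<integral>\<^sup>+z. ennreal (norm (case z of (x, y) \<Rightarrow> eta (g (x - y)))) \<partial>(lborel \<Otimes>\<^sub>M R)) < \<infinity>" .
  qed measurable
  have val: "(\<integral>x. \<integral>y. eta (g (x - y)) \<partial>R \<partial>lborel) = (\<integral>x. eta (g x) \<partial>lborel)"
  proof -
    have "(\<integral>x. \<integral>y. eta (g (x - y)) \<partial>R \<partial>lborel) = (\<integral>y. \<integral>x. eta (g (x - y)) \<partial>lborel \<partial>R)"
      using P.Fubini_integral[OF ip] by simp
    also have "\<dots> = (\<integral>y. \<integral>x. eta (g x) \<partial>lborel \<partial>R)"
    proof (rule Bochner_Integration.integral_cong[OF refl])
      fix y show "(\<integral>x. eta (g (x - y)) \<partial>lborel) = (\<integral>x. eta (g x) \<partial>lborel)"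
        by (subst lborel_integral_real_affine[of 1 _ y]) auto
    qed
    finally show ?thesis using R.prob_space by simp
  qed
  have iin: "integrable lborel (\<lambda>x. \<integral>y. eta (g (x - y)) \<partial>R)"
    using P.integrable_fst'[OF ip] by simp
  have ae: "AE x in lborel. integrable R (\<lambda>y. eta (g (x - y)))"
    using P.AE_integrable_fst'[OF ip] by simp
  have "(\<integral>x. eta (g x) \<partial>lborel) = (\<integral>x. \<integral>y. eta (g (x - y)) \<partial>R \<partial>lborel)" by (simp add: val)
  also have "\<dots> \<le> (\<integral>x. eta (f x) \<partial>lborel)"
  proof (rule integral_mono_AE[OF iin ef])
    show "AE x in lborel. (\<integral>y. eta (g (x - y)) \<partial>R) \<le> eta (f x)"
      using fF ae
    proof eventually_elim
      fix x assume fx: "ennreal (f x) = F x" and ix: "integrable R (\<lambda>y. eta (g (x - y)))"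
      have gi: "integrable R (\<lambda>y. g (x - y))"
        by (rule integrableI_nonneg) (use fx g.g_nonneg in \<open>auto simp: F_def[symmetric] fx[symmetric]\<close>)
      have gv: "(\<integral>y. g (x - y) \<partial>R) = f x"
      proof -
        have "ennreal (\<integral>y. g (x - y) \<partial>R) = F x" unfolding F_def
          using gi g.g_nonneg by (intro nn_integral_eq_integral[symmetric]) auto
        then show ?thesis using fx f.g_nonneg g.g_nonneg
          by (metis Bochner_Integration.integral_nonneg ennreal_inj)
      qed
      \<comment> \<open>When the mean vanishes it cannot serve as reference value in Gibbs'
        inequality, but then \<open>g (x - y)\<close> vanishes for almost every y.\<close>
      show "(\<integral>y. eta (g (x - y)) \<partial>R) \<le> eta (f x)"
      proof (cases "f x = 0")
        case True
        then have "AE y in R. g (x - y) = 0"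
          using gv gi g.g_nonneg by (subst integral_nonneg_eq_0_iff_AE[symmetric]) auto
        then have "(\<integral>y. eta (g (x - y)) \<partial>R) = (\<integral>y. 0 \<partial>R)"
          by (intro integral_cong_AE) (auto elim!: eventually_mono)
        then show ?thesis using True by simp
      next
        case False
        then have pos: "0 < f x" using f.g_nonneg[of x] by simp
        have "(\<integral>y. eta (g (x - y)) \<partial>R) \<le> (\<integral>y. f x - g (x - y) - g (x - y) * ln (f x) \<partial>R)"
          using ix gi pos g.g_nonneg by (intro integral_mono eta_le_cross) auto
        also have "\<dots> = f x - f x - f x * ln (f x)"
          using gi gv R.prob_space by simp
        finally show ?thesis by (simp add: eta_def)
      qed
    qed
  qed
  finally show ?thesis .
qed

text \<open>Diagonal choice: for each n the threshold is taken so large that the error is at most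
  \<open>1 / (n + 1)\<close> for all finer resolutions. The start N leaves out the indices n at
  which zeta has been altered.\<close>

lemma choose_resolution:
  fixes F :: "nat \<Rightarrow> nat \<Rightarrow> real"
  assumes lim: "\<And>n. n \<ge> N \<Longrightarrow> (\<lambda>m. F n m) \<longlonglongrightarrow> 0"
    and Q: "\<And>n m. n \<ge> N \<Longrightarrow> m \<ge> 1 \<Longrightarrow> Q n m"
  shows "\<exists>mn :: nat \<Rightarrow> nat. \<forall>\<epsilon>>0. \<forall>\<^sub>F n in sequentially. \<forall>m\<ge>mn n. Q n m \<and> \<bar>F n m\<bar> \<le> \<epsilon>"
proof -
  have "\<forall>n. \<exists>M. n \<ge> N \<longrightarrow> (\<forall>m\<ge>M. Q n m \<and> \<bar>F n m\<bar> \<le> 1 / real (Suc n))"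
  proof (intro allI, goal_cases)
    case (1 n)
    show ?case
    proof (cases "n \<ge> N")
      case True
      from lim[OF True] obtain M where M: "\<forall>m\<ge>M. norm (F n m - 0) < 1 / real (Suc n)"
        by (meson LIMSEQ_D of_nat_0_less_iff zero_less_Suc zero_less_divide_1_iff)
      then show ?thesis using Q[OF True] by (intro exI[of _ "max 1 M"]) (auto simp: less_imp_le)
    qed simp
  qed
  then obtain mn where mn: "\<And>n m. n \<ge> N \<Longrightarrow> m \<ge> mn n \<Longrightarrow> Q n m \<and> \<bar>F n m\<bar> \<le> 1 / real (Suc n)" by metis
  show ?thesis
  proof (intro exI[of _ mn] allI impI)
    fix e :: real assume e: "0 < e"
    have "(\<lambda>n. 1 / real (Suc n)) \<longlonglongrightarrow> 0" using LIMSEQ_inverse_real_of_nat by (simp add: inverse_eq_divide)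
    then have "\<forall>\<^sub>F n in sequentially. 1 / real (Suc n) < e" using e by (rule order_tendstoD)
    moreover have "\<forall>\<^sub>F n in sequentially. N \<le> n" by (rule eventually_ge_at_top)
    ultimately show "\<forall>\<^sub>F n in sequentially. \<forall>m\<ge>mn n. Q n m \<and> \<bar>F n m\<bar> \<le> e"
    proof eventually_elim
      case (elim n)
      then show ?case using mn[of n] by (meson less_imp_le order_trans)
    qed
  qed
qed

section \<open>Continuous laws\<close>

text \<open>Passing to real values by \<open>enn2real\<close> loses nothing, since the Radon-Nikodym
  derivative of a finite measure is finite almost everywhere.\<close>

lemma density_measure_dens:
  assumes "finite_borel_measure M" "absolutely_continuous lborel M"
  shows "density_measure (dens M) M"
proof
  interpret M: finite_borel_measure M by fact
  have ac: "absolutely_continuous lborel M" "sets M = sets lborel" using assms(2) M.M_is_borel by auto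
  show meas: "dens M \<in> borel_measurable borel" unfolding dens_def by measurable
  show nonneg: "0 \<le> dens M x" for x by (simp add: dens_def)
  have "AE x in lborel. RN_deriv lborel M x \<noteq> \<infinity>"
    using ac by (intro sigma_finite_measure.RN_deriv_finite lborel.sigma_finite_measure_axioms M.sigma_finite_measure_axioms)
  then have ae: "AE x in lborel. RN_deriv lborel M x = ennreal (dens M x)"
    by eventually_elim (simp add: dens_def less_top)
  have "M = density lborel (RN_deriv lborel M)"
    using ac by (intro sigma_finite_measure.density_RN_deriv[symmetric] lborel.sigma_finite_measure_axioms)
  also have "\<dots> = density lborel (\<lambda>x. ennreal (dens M x))"
    using ae meas by (intro density_cong) auto
  finally show M: "M = density lborel (\<lambda>x. ennreal (dens M x))" .
  show "integrable lborel (dens M)"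
  proof (rule integrableI_nonneg)
    have "(\<integral>\<^sup>+x. ennreal (dens M x) \<partial>lborel) = emeasure (density lborel (\<lambda>x. ennreal (dens M x))) UNIV"
      using meas by (subst emeasure_density) auto
    also have "\<dots> < \<infinity>" unfolding M[symmetric] by (simp add: M.emeasure_eq_measure)
    finally show "(\<integral>\<^sup>+x. ennreal (dens M x) \<partial>lborel) < \<infinity>" .
  qed (use meas nonneg in auto)
qed

lemma dentropy_wd_eta:
  assumes "finite_borel_measure M" "dentropy_wd M"
  shows "integrable lborel (\<lambda>x. eta (dens M x))" "diff_entropy M = (\<integral>x. eta (dens M x) \<partial>lborel)"
proof -
  interpret density_measure "dens M" M using assms by (intro density_measure_dens) (auto simp: dentropy_wd_def)
  have "integrable lborel (\<lambda>x. dens M x * \<bar>ln (dens M x)\<bar>)" using assms by (simp add: dentropy_wd_def)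
  then show "integrable lborel (\<lambda>x. eta (dens M x))"
    by (rule Bochner_Integration.integrable_bound) (auto simp: eta_def abs_mult)
  show "diff_entropy M = (\<integral>x. eta (dens M x) \<partial>lborel)"
    unfolding diff_entropy_def eta_def by simp
qed

text \<open>Only the relation between the characteristic functions is recorded, so that infinite
  Levy measures and a Gaussian component are covered as well.\<close>

locale divisible_family =
  fixes P :: "nat \<Rightarrow> real measure" and \<psi> :: "real \<Rightarrow> complex"
  assumes P_dist: "\<And>n. n \<ge> 1 \<Longrightarrow> real_distribution (P n)"
    and P_char: "\<And>n t. n \<ge> 1 \<Longrightarrow> char (P n) t = exp (\<psi> t / of_nat n)"
begin

lemma P_factor:
  assumes n: "n \<ge> 1"
  shows "\<exists>R. real_distribution R \<and> P 1 = (P n \<star> R)"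
proof (intro exI conjI)
  show "real_distribution (convpow (P n) (n - 1))"
    by (intro real_distribution_convpow P_dist n)
  show "P 1 = (P n \<star> convpow (P n) (n - 1))"
  proof (rule convolution_eqI_char)
    fix t
    have "char (P n) t * char (convpow (P n) (n - 1)) t = char (P n) t ^ Suc (n - 1)"
      unfolding char_convpow[OF P_dist[OF n]] by simp
    also have "\<dots> = exp (\<psi> t / of_nat n) ^ n"
      using n by (simp add: P_char)
    also have "\<dots> = exp (of_nat n * (\<psi> t / of_nat n))" by (rule exp_of_nat_mult[symmetric])
    also have "\<dots> = char (P 1) t" using n by (simp add: P_char)
    finally show "char (P 1) t = char (P n) t * char (convpow (P n) (n - 1)) t" by simp
  qed (auto intro!: real_distribution_convpow P_dist n)
qed

lemma quantized_entropy_finite: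
  assumes n: "n \<ge> 1" and fin: "Hq 1 (P 1) < \<infinity>"
  shows "integrable (count_space UNIV) (\<lambda>k. eta (mass 1 (P n) k))"
proof -
  interpret P1: real_distribution "P 1" by (intro P_dist) simp
  obtain R where R: "real_distribution R" "P 1 = (P n \<star> R)" using P_factor[OF n] by auto
  have "integrable (count_space UNIV) (\<lambda>k. eta (mass 1 (P 1) k))"
    using fin P1.Hq_finite_iff[of 1] P1.prob_space unfolding P1.space_eq_univ by (metis order_refl)
  then show ?thesis using R(1) unfolding R(2)
    by (intro quantized_entropy_factor_finite[OF P_dist[OF n] R(1)])
qed

lemma P_consecutive: "n \<ge> 1 \<Longrightarrow> P n = (P (Suc n) \<star> P (n * Suc n))"
proof (rule convolution_eqI_char)
  fix t assume n: "n \<ge> 1"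
  have "(1::complex) / of_nat n = 1 / of_nat (Suc n) + 1 / of_nat (n * Suc n)"
  proof -
    have "of_nat n \<noteq> (0::complex)" "1 + of_nat n \<noteq> (0::complex)"
      using n of_nat_neq_0[of n, where ?'a=complex] by auto
    then have "1 / of_nat n = 1 / (1 + of_nat n) + 1 / (of_nat n * (1 + of_nat n :: complex))"
      by (simp add: divide_simps)
    then show ?thesis by (simp only: of_nat_mult of_nat_Suc)
  qed
  then have "\<psi> t * (1 / of_nat n) = \<psi> t * (1 / of_nat (Suc n) + 1 / of_nat (n * Suc n))" by simp
  then have "\<psi> t / of_nat n = \<psi> t / of_nat (Suc n) + \<psi> t / of_nat (n * Suc n)"
    by (simp add: distrib_left del: of_nat_Suc of_nat_mult)
  then show "char (P n) t = char (P (Suc n)) t * char (P (n * Suc n)) t"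
    using n by (simp add: P_char exp_add del: of_nat_Suc of_nat_mult mult_Suc_right)
qed (auto intro!: P_dist)

theorem continuous_case:
  assumes fin: "Hq 1 (P 1) < \<infinity>" and wd: "\<forall>n\<ge>1. dentropy_wd (P n)"
  shows "(\<exists>mn :: nat \<Rightarrow> nat.
            (\<forall>\<epsilon>>0. \<forall>\<^sub>F n in sequentially. \<forall>m\<ge>mn n.
               Hq m (P n) < \<infinity> \<and>
               \<bar>real n * enn2real (Hq m (P n)) / real n - ln (real m)
                  - diff_entropy (P n)\<bar> \<le> \<epsilon>))
         \<and> (\<forall>n\<ge>1. diff_entropy (P (Suc n)) \<le> diff_entropy (P n))"
proof
  have key: "Hq m (P n) < \<infinity>" "(\<lambda>m. real n * enn2real (Hq m (P n)) / real n - ln (real m) - diff_entropy (P n)) \<longlonglongrightarrow> 0"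
    if n: "n \<ge> 1" and m: "m \<ge> 1" for n m
  proof -
    interpret Pn: real_distribution "P n" by (intro P_dist n)
    interpret D: density_measure "dens (P n)" "P n"
      using wd n by (intro density_measure_dens Pn.finite_borel_measure_M) (auto simp: dentropy_wd_def)
    note eta = dentropy_wd_eta[OF Pn.finite_borel_measure_M, of, OF wd[rule_format, OF n]]
    have one: "measure (P n) UNIV = 1" using Pn.prob_space by simp
    note C = D.density_quantized_entropy[OF _ _ eta(1) quantized_entropy_finite[OF n fin], unfolded one, simplified]
    show "Hq m (P n) < \<infinity>" using C(1) m Pn.Hq_finite_iff[OF m] one by simp
    have "(\<lambda>m. (\<integral>k. eta (mass m (P n) k) \<partial>count_space UNIV) - ln (real m) - diff_entropy (P n)) \<longlonglongrightarrow> diff_entropy (P n) - diff_entropy (P n)"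
      unfolding eta(2) by (intro tendsto_intros C(2))
    moreover have "\<forall>\<^sub>F m in sequentially. (\<integral>k. eta (mass m (P n) k) \<partial>count_space UNIV) - ln (real m) - diff_entropy (P n) = real n * enn2real (Hq m (P n)) / real n - ln (real m) - diff_entropy (P n)"
      by (rule eventually_sequentiallyI[of 1]) (use n one in \<open>simp add: Pn.enn2real_Hq\<close>)
    ultimately show "(\<lambda>m. real n * enn2real (Hq m (P n)) / real n - ln (real m) - diff_entropy (P n)) \<longlonglongrightarrow> 0"
      by (simp add: tendsto_cong)
  qed
  show "\<exists>mn :: nat \<Rightarrow> nat. (\<forall>\<epsilon>>0. \<forall>\<^sub>F n in sequentially. \<forall>m\<ge>mn n.
               Hq m (P n) < \<infinity> \<and> \<bar>real n * enn2real (Hq m (P n)) / real n - ln (real m) - diff_entropy (P n)\<bar> \<le> \<epsilon>)"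
    by (rule choose_resolution[where N=1]) (rule key(2)[OF _ order_refl] key(1), assumption+)+
  show "\<forall>n\<ge>1. diff_entropy (P (Suc n)) \<le> diff_entropy (P n)"
  proof (intro allI impI)
    fix n :: nat assume n: "1 \<le> n"
    have f: "finite_borel_measure (P k)" if "k \<ge> 1" for k
      using P_dist[OF that] by (rule real_distribution_is_finite_borel)
    have d: "density_measure (dens (P k)) (P k)" if "k \<ge> 1" for k
      using wd that by (intro density_measure_dens f) (auto simp: dentropy_wd_def)
    note e = dentropy_wd_eta[OF f wd[rule_format]]
    have "(\<integral>x. eta (dens (P (Suc n)) x) \<partial>lborel) \<le> (\<integral>x. eta (dens (P n) x) \<partial>lborel)"
      using n by (intro convolution_density_entropy_le[OF d d P_dist P_consecutive] e) auto
    then show "diff_entropy (P (Suc n)) \<le> diff_entropy (P n)"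
      using n by (simp add: e)
  qed
qed

end

section \<open>Compound Poisson laws\<close>

text \<open>The law of a sum of a Poisson number of independent jumps. Rate 0 is set apart because
  the Poisson law is used with positive parameter; it occurs when the Levy measure has no
  atoms.\<close>

definition cpois :: "real \<Rightarrow> real measure \<Rightarrow> real measure" where
  "cpois r A = (if r = 0 then return borel 0 else measure_pmf (poisson_pmf r) \<bind> convpow A)"

lemma measurable_convpow:
  assumes "real_distribution A"
  shows "convpow A \<in> measurable (measure_pmf p) (subprob_algebra borel)"
proof -
  have "convpow A k \<in> space (subprob_algebra borel)" for k
  proof -
    interpret R: real_distribution "convpow A k" using assms by (rule real_distribution_convpow)
    show ?thesis by (simp add: space_subprob_algebra prob_space_imp_subprob_space R.prob_space_axioms)
  qed
  then show ?thesis by simp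
qed

lemma emeasure_cpois:
  assumes A: "real_distribution A" and r: "0 \<le> r" and S: "S \<in> sets borel"
  shows "emeasure (cpois r A) S = (\<Sum>k. ennreal (r ^ k / fact k * exp (- r)) * emeasure (convpow A k) S)"
proof (cases "r = 0")
  case True
  \<comment> \<open>With \<open>0 ^ 0 = 1\<close> the series at rate 0 reduces to its term
    \<open>k = 0\<close>.\<close>
  have "(\<Sum>k. ennreal (0 ^ k / fact k * exp (- 0)) * emeasure (convpow A k) S)
      = (\<Sum>k\<in>{0}. ennreal (0 ^ k / fact k * exp (- 0)) * emeasure (convpow A k) S)"
    by (rule suminf_finite) auto
  then show ?thesis using True by (simp add: cpois_def)
next
  case False
  then have r: "0 < r" using r by simp
  have "emeasure (cpois r A) S = (\<integral>\<^sup>+k. emeasure (convpow A k) S \<partial>measure_pmf (poisson_pmf r))"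
    unfolding cpois_def using False S by (simp add: emeasure_bind[OF _ measurable_convpow[OF A]])
  also have "\<dots> = (\<Sum>k. ennreal (r ^ k / fact k * exp (- r)) * emeasure (convpow A k) S)"
    using r by (simp add: nn_integral_measure_pmf nn_integral_count_space_nat)
  finally show ?thesis .
qed

lemma sets_cpois: "real_distribution A \<Longrightarrow> sets (cpois r A) = sets borel"
  by (cases "r = 0") (simp_all add: cpois_def sets_bind real_distribution.events_eq_borel real_distribution_convpow)

lemma real_distribution_cpois:
  assumes A: "real_distribution A" and r: "0 \<le> r"
  shows "real_distribution (cpois r A)"
  unfolding real_distribution_def real_distribution_axioms_def
proof
  show "sets (cpois r A) = sets borel" using A by (rule sets_cpois)
  have sp: "space (cpois r A) = UNIV" using sets_cpois[OF A, of r] sets_eq_imp_space_eq by fastforce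
  show "prob_space (cpois r A)"
  proof
    have one: "emeasure (convpow A k) UNIV = 1" for k
      using real_distribution_convpow[OF A, of k] prob_space.emeasure_space_1 real_distribution.space_eq_univ
      by (metis real_distribution_def)
    show "emeasure (cpois r A) (space (cpois r A)) = 1"
    proof (cases "r = 0")
      case True then show ?thesis unfolding sp by (simp add: cpois_def)
    next
      case False
      then show ?thesis unfolding sp unfolding cpois_def
        by (simp add: emeasure_bind[OF _ measurable_convpow[OF A]] one measure_pmf.emeasure_space_1[simplified])
    qed
  qed
qed

lemma char_cpois:
  assumes A: "real_distribution A" and r: "0 \<le> r"
  shows "char (cpois r A) t = exp (complex_of_real r * (char A t - 1))"
proof (cases "r = 0")
  case True then show ?thesis by (simp add: cpois_def char_return)
next
  case False
  then have rp: "0 < r" using r by simp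
  let ?p = "measure_pmf (poisson_pmf r)"
  interpret C: real_distribution "cpois r A" using A r by (rule real_distribution_cpois)
  interpret A: real_distribution A by fact
  have cv: "real_distribution (convpow A k)" for k using A by (rule real_distribution_convpow)
  have int: "integrable (convpow A k) (\<lambda>x. iexp (t * x))" for k
  proof -
    interpret R: real_distribution "convpow A k" by (rule cv)
    show ?thesis using R.integrable_iexp[of "\<lambda>x. complex_of_real (t * x)"] by simp
  qed
  have intC: "integrable (cpois r A) (\<lambda>x. iexp (t * x))"
    using C.integrable_iexp[of "\<lambda>x. complex_of_real (t * x)"] by simp
  have cb: "norm (char A t) \<le> 1" by (rule A.cmod_char_le_1)
  have intp: "integrable ?p (\<lambda>k. char A t ^ k)"
    by (rule measure_pmf.integrable_const_bound[where B=1]) (use cb in \<open>auto simp: norm_power power_le_one\<close>)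
  have bnd: "AE k in ?p. emeasure (convpow A k) (space (convpow A k)) \<le> ennreal 1"
    using cv by (intro AE_I2) (simp add: prob_space.emeasure_space_1 real_distribution_def)
  have b: "(\<integral>x. f x \<partial>cpois r A) = (\<integral>k. \<integral>x. f x \<partial>convpow A k \<partial>?p)"
    if "f \<in> borel_measurable borel" "\<And>x. \<bar>f x\<bar> \<le> 1" for f :: "real \<Rightarrow> real"
    unfolding cpois_def using False that
    by (simp, intro integral_bind[where B=1 and B'=1 and K=borel] measurable_convpow[OF A] bnd)
       (auto intro: measure_pmf.finite_measure_axioms)
  have "char (cpois r A) t = (\<integral>k. char A t ^ k \<partial>?p)"
  \<comment> \<open>The integral over the mixture is exchanged with the Poisson average in
    \<open>b\<close> for bounded real functions, hence the separate treatment of real and imaginary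
    parts.\<close>
  proof (rule complex_eqI)
    have "Re (char (cpois r A) t) = (\<integral>x. Re (iexp (t * x)) \<partial>cpois r A)"
      unfolding char_def using intC by (subst integral_Re) auto
    also have "\<dots> = (\<integral>k. \<integral>x. Re (iexp (t * x)) \<partial>convpow A k \<partial>?p)"
    proof (rule b)
      show "\<bar>Re (iexp (t * x))\<bar> \<le> 1" for x
        using abs_Re_le_cmod[of "iexp (t * x)"] unfolding norm_exp_i_times .
    qed measurable
    also have "\<dots> = (\<integral>k. Re (char A t ^ k) \<partial>?p)"
      unfolding char_convpow[OF A, symmetric] unfolding char_def using int by (simp del: Re_exp)
    also have "\<dots> = Re (\<integral>k. char A t ^ k \<partial>?p)" using intp by simp
    finally show "Re (char (cpois r A) t) = Re (\<integral>k. char A t ^ k \<partial>?p)" .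
    have "Im (char (cpois r A) t) = (\<integral>x. Im (iexp (t * x)) \<partial>cpois r A)"
      unfolding char_def using intC by (subst integral_Im) auto
    also have "\<dots> = (\<integral>k. \<integral>x. Im (iexp (t * x)) \<partial>convpow A k \<partial>?p)"
    proof (rule b)
      show "\<bar>Im (iexp (t * x))\<bar> \<le> 1" for x
        using abs_Im_le_cmod[of "iexp (t * x)"] unfolding norm_exp_i_times .
    qed measurable
    also have "\<dots> = (\<integral>k. Im (char A t ^ k) \<partial>?p)"
      unfolding char_convpow[OF A, symmetric] unfolding char_def using int by (simp del: Im_exp)
    also have "\<dots> = Im (\<integral>k. char A t ^ k \<partial>?p)" using intp by simp
    finally show "Im (char (cpois r A) t) = Im (\<integral>k. char A t ^ k \<partial>?p)" .
  qed
  also have "\<dots> = (\<integral>k. pmf (poisson_pmf r) k *\<^sub>R char A t ^ k \<partial>count_space UNIV)"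
    unfolding measure_pmf_eq_density by (subst integral_density) auto
  also have "\<dots> = exp (complex_of_real r * (char A t - 1))"
  proof (rule sums_unique2)
    have "integrable (count_space UNIV) (\<lambda>k. pmf (poisson_pmf r) k *\<^sub>R char A t ^ k)"
      using intp unfolding measure_pmf_eq_density by (subst (asm) integrable_density) auto
    then show "(\<lambda>k. pmf (poisson_pmf r) k *\<^sub>R char A t ^ k) sums (\<integral>k. pmf (poisson_pmf r) k *\<^sub>R char A t ^ k \<partial>count_space UNIV)"
      by (rule sums_integral_count_space_nat)
    have "(\<lambda>k. exp (- r) *\<^sub>R ((of_real r * char A t) ^ k /\<^sub>R fact k)) sums (exp (- r) *\<^sub>R exp (of_real r * char A t))"
      by (intro sums_scaleR_right exp_converges)
    moreover have "exp (- r) *\<^sub>R exp (of_real r * char A t) = exp (complex_of_real r * (char A t - 1))"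
      by (simp add: scaleR_conv_of_real exp_of_real[symmetric] exp_add[symmetric] algebra_simps del: exp_of_real)
    moreover have "exp (- r) *\<^sub>R ((of_real r * char A t) ^ k /\<^sub>R fact k) = pmf (poisson_pmf r) k *\<^sub>R char A t ^ k" for k
      using rp by (simp add: scaleR_conv_of_real power_mult_distrib field_simps)
    ultimately show "(\<lambda>k. pmf (poisson_pmf r) k *\<^sub>R char A t ^ k) sums exp (complex_of_real r * (char A t - 1))"
      by simp
  qed
  finally show ?thesis .
qed

lemma convpow_1: "real_distribution A \<Longrightarrow> convpow A (Suc 0) = A"
  by (rule Levy_uniqueness[OF real_distribution_convpow]) (auto simp: char_convpow simp del: convpow.simps)

lemma cpois_ge_zero_term:
  assumes A: "real_distribution A" and r: "0 \<le> r"
  shows "exp (- r) \<le> measure (cpois r A) {0}"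
proof -
  interpret C: real_distribution "cpois r A" using A r by (rule real_distribution_cpois)
  let ?f = "\<lambda>k. ennreal (r ^ k / fact k * exp (- r)) * emeasure (convpow A k) {0}"
  have "ennreal (exp (- r)) = sum ?f {0}" by simp
  also have "\<dots> \<le> (\<Sum>k. ?f k)" by (rule sum_le_suminf) auto
  also have "\<dots> = ennreal (measure (cpois r A) {0})"
    using emeasure_cpois[OF A r, of "{0}"] by (simp add: C.emeasure_eq_measure)
  finally show ?thesis by simp
qed

text \<open>The term with exactly one jump. It bounds the mass away from the zero-jump point from
  below, and for positive r it shows that a null set of the compound law is null for the jump
  law.\<close>

lemma cpois_ge_one_term:
  assumes A: "real_distribution A" and r: "0 \<le> r" and S: "S \<in> sets borel"
  shows "r * exp (- r) * measure A S \<le> measure (cpois r A) S"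
proof -
  interpret A: real_distribution A by fact
  interpret C: real_distribution "cpois r A" using A r by (rule real_distribution_cpois)
  let ?f = "\<lambda>k. ennreal (r ^ k / fact k * exp (- r)) * emeasure (convpow A k) S"
  have "ennreal (r * exp (- r) * measure A S) = sum ?f {Suc 0}"
    using r by (simp add: convpow_1[OF A] A.emeasure_eq_measure ennreal_mult del: convpow.simps)
  also have "\<dots> \<le> (\<Sum>k. ?f k)" by (rule sum_le_suminf) auto
  also have "\<dots> = ennreal (measure (cpois r A) S)"
    using emeasure_cpois[OF A r S] by (simp add: C.emeasure_eq_measure)
  finally show ?thesis by simp
qed

text \<open>As 0 is not in S, the term without jumps vanishes; for \<open>k \<ge> 1\<close> one has
  \<open>s ^ k \<le> s\<close>. The factor \<open>exp r\<close> cancels \<open>exp (- r)\<close> in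
  the target series, while \<open>exp (- (s * r))\<close> is bounded by 1.\<close>

lemma cpois_scale_le:
  assumes A: "real_distribution A" and r: "0 \<le> r" and s: "0 \<le> s" "s \<le> 1"
    and S: "S \<in> sets borel" "0 \<notin> S"
  shows "measure (cpois (s * r) A) S \<le> s * exp r * measure (cpois r A) S"
proof -
  have sr: "0 \<le> s * r" using r s by simp
  interpret C: real_distribution "cpois r A" using A r by (rule real_distribution_cpois)
  interpret C': real_distribution "cpois (s * r) A" using A sr by (rule real_distribution_cpois)
  have "emeasure (cpois (s * r) A) S = (\<Sum>k. ennreal ((s * r) ^ k / fact k * exp (- (s * r))) * emeasure (convpow A k) S)"
    by (rule emeasure_cpois[OF A sr S(1)])
  also have "\<dots> \<le> (\<Sum>k. ennreal (s * exp r) * (ennreal (r ^ k / fact k * exp (- r)) * emeasure (convpow A k) S))"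
  proof (intro suminf_le)
    fix k
    show "ennreal ((s * r) ^ k / fact k * exp (- (s * r))) * emeasure (convpow A k) S
        \<le> ennreal (s * exp r) * (ennreal (r ^ k / fact k * exp (- r)) * emeasure (convpow A k) S)"
    proof (cases k)
      case 0 then show ?thesis using S by simp
    next
      case (Suc j)
      have "s ^ k \<le> s" unfolding Suc using s by (simp add: mult_left_le power_le_one)
      then have "s ^ k * (r ^ k / fact k) \<le> s * (r ^ k / fact k)" using r by (intro mult_right_mono) auto
      then have "(s * r) ^ k / fact k \<le> s * (r ^ k / fact k)" by (simp add: power_mult_distrib)
      then have "(s * r) ^ k / fact k * exp (- (s * r)) \<le> s * (r ^ k / fact k) * 1"
        using sr r s by (intro mult_mono) auto
      also have "\<dots> = (s * exp r) * (r ^ k / fact k * exp (- r))" by (simp add: exp_minus)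
      finally have "ennreal ((s * r) ^ k / fact k * exp (- (s * r))) \<le> ennreal ((s * exp r) * (r ^ k / fact k * exp (- r)))"
        by (rule ennreal_leI)
      also have "\<dots> = ennreal (s * exp r) * ennreal (r ^ k / fact k * exp (- r))"
        using s r by (intro ennreal_mult) auto
      finally show ?thesis by (metis mult.assoc mult_right_mono zero_le)
    qed
  qed auto
  also have "\<dots> = ennreal (s * exp r) * emeasure (cpois r A) S"
    by (simp add: emeasure_cpois[OF A r S(1)])
  finally show ?thesis
    using s r by (simp add: C.emeasure_eq_measure C'.emeasure_eq_measure ennreal_mult[symmetric])
qed

lemma emeasure_convolution_translate:
  assumes M: "real_distribution M" and N: "real_distribution N" and S: "S \<in> sets borel"
  shows "emeasure (M \<star> N) S = (\<integral>\<^sup>+x. emeasure N {a. a + x \<in> S} \<partial>M)"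
proof -
  interpret M: real_distribution M by fact
  interpret N: real_distribution N by fact
  show ?thesis by (rule convolution_emeasure[OF S]) (auto intro: M.finite_measure_axioms N.finite_measure_axioms)
qed

lemma null_sets_lborel_translate:
  fixes S :: "real set"
  assumes "S \<in> null_sets lborel"
  shows "{a. a + x \<in> S} \<in> null_sets lborel"
proof -
  have [measurable]: "S \<in> sets borel" using assms by auto
  have "AE a in lborel. a \<notin> S" using assms by (rule AE_not_in)
  then have "AE a in lborel. x + 1 * a \<notin> S" by (intro AE_borel_affine) auto
  then have "{a. \<not> x + 1 * a \<notin> S} \<in> null_sets lborel"
    by (subst (asm) AE_iff_null) auto
  then show ?thesis by (simp add: add.commute)
qed

lemma absolutely_continuous_convolution:
  assumes M: "real_distribution M" and N: "real_distribution N" and ac: "absolutely_continuous lborel N"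
  shows "absolutely_continuous lborel (M \<star> N)"
  unfolding absolutely_continuous_def
proof
  fix S :: "real set" assume S: "S \<in> null_sets lborel"
  have "emeasure N {a. a + x \<in> S} = 0" for x
    using null_sets_lborel_translate[OF S, of x] ac by (auto simp: absolutely_continuous_def)
  then have "emeasure (M \<star> N) S = 0"
    using S by (subst emeasure_convolution_translate[OF M N]) auto
  then show "S \<in> null_sets (M \<star> N)" using S by (auto intro!: null_setsI)
qed

text \<open>All convolution powers with at least one factor are absolutely continuous, so on a
  Lebesgue null set only the zero-jump term, a point mass at 0, survives.\<close>

lemma cpois_null_set:
  assumes A: "real_distribution A" and r: "0 \<le> r" and ac: "absolutely_continuous lborel A"
    and S: "S \<in> null_sets lborel"
  shows "emeasure (cpois r A) S = ennreal (exp (- r)) * indicator S 0"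
proof -
  have Sb: "S \<in> sets borel" using S by auto
  have z: "emeasure (convpow A k) S = 0" if k: "k \<noteq> 0" for k
  proof -
    obtain j where k: "k = Suc j" using k by (cases k) auto
    interpret A: real_distribution A by fact
    interpret R: real_distribution "convpow A j" using A by (rule real_distribution_convpow)
    have "convpow A k = (convpow A j \<star> A)" unfolding k convpow.simps
      by (rule convolution_commutative) (auto intro: A.finite_measure_axioms R.finite_measure_axioms)
    then have "absolutely_continuous lborel (convpow A k)"
      using absolutely_continuous_convolution[OF real_distribution_convpow[OF A] A ac] by simp
    then show ?thesis using S by (auto simp: absolutely_continuous_def)
  qed
  have "emeasure (cpois r A) S = (\<Sum>k\<in>{0}. ennreal (r ^ k / fact k * exp (- r)) * emeasure (convpow A k) S)"
    unfolding emeasure_cpois[OF A r Sb] using z by (intro suminf_finite) auto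
  then show ?thesis using Sb by simp
qed

lemma countable_support_convolution:
  assumes M: "real_distribution M" and N: "real_distribution N"
    and S: "countable S" "measure M S = 1" and T: "countable T" "measure N T = 1"
  shows "\<exists>U. countable U \<and> measure (M \<star> N) U = 1"
proof (intro exI conjI)
  interpret M: real_distribution M by fact
  interpret N: real_distribution N by fact
  interpret C: real_distribution "M \<star> N" using M N by (rule real_distribution_convolution)
  let ?U = "(\<lambda>(x, y). x + y) ` (S \<times> T)"
  show c: "countable ?U" using S(1) T(1) by auto
  have Us: "?U \<in> sets borel" using c by (rule countable_in_borel)
  have Ss[measurable]: "S \<in> sets borel" using S(1) by (rule countable_in_borel)
  have Ts: "T \<in> sets borel" using T(1) by (rule countable_in_borel)
  have "AE x in M. x \<in> S" using S(2) by (subst M.AE_in_set_eq_1) auto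
  then have "AE x in M. emeasure N {a. a + x \<in> ?U} = 1"
  proof eventually_elim
    fix x assume x: "x \<in> S"
    have m: "{a. a + x \<in> ?U} \<in> sets borel"
      using Us by measurable
    have "emeasure N T \<le> emeasure N {a. a + x \<in> ?U}"
    proof (rule emeasure_mono)
      show "T \<subseteq> {a. a + x \<in> ?U}"
      proof
        fix a assume "a \<in> T"
        then have "a + x \<in> ?U" using x by (intro image_eqI[where x="(x, a)"]) auto
        then show "a \<in> {a. a + x \<in> ?U}" by simp
      qed
    qed (use m in simp)
    then have "1 \<le> N.prob {a. a + x \<in> ?U}" using T(2) by (simp add: N.emeasure_eq_measure)
    then have "N.prob {a. a + x \<in> ?U} = 1" using N.prob_le_1 by (intro antisym)
    then show "emeasure N {a. a + x \<in> ?U} = 1" by (simp add: N.emeasure_eq_measure)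
  qed
  then have "(\<integral>\<^sup>+x. emeasure N {a. a + x \<in> ?U} \<partial>M) = (\<integral>\<^sup>+x. 1 \<partial>M)"
    by (rule nn_integral_cong_AE)
  then have "emeasure (M \<star> N) ?U = 1"
    unfolding emeasure_convolution_translate[OF M N Us] using M.emeasure_space_1 by simp
  then show "measure (M \<star> N) ?U = 1" by (simp add: measure_def)
qed

lemma countable_support_cpois:
  assumes A: "real_distribution A" and r: "0 \<le> r" and S: "countable S" "measure A S = 1"
  shows "\<exists>U. countable U \<and> measure (cpois r A) U = 1"
proof -
  interpret C: real_distribution "cpois r A" using A r by (rule real_distribution_cpois)
  have "\<exists>U. countable U \<and> measure (convpow A k) U = 1" for k
  proof (induction k)
    case 0 show ?case by (intro exI[of _ "{0}"]) (simp add: measure_return)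
  next
    case (Suc k)
    then obtain U where "countable U" "measure (convpow A k) U = 1" by auto
    then show ?case using countable_support_convolution[OF A real_distribution_convpow[OF A] S] by simp
  qed
  then obtain U where U: "\<And>k. countable (U k)" "\<And>k. measure (convpow A k) (U k) = 1" by metis
  let ?V = "\<Union>k. U k"
  have V: "countable ?V" using U(1) by auto
  have one: "emeasure (convpow A k) ?V = emeasure (convpow A k) UNIV" for k
  proof -
    interpret R: real_distribution "convpow A k" using A by (rule real_distribution_convpow)
    have "1 \<le> measure (convpow A k) ?V"
      unfolding U(2)[of k, symmetric] by (rule R.finite_measure_mono) (auto intro!: countable_in_borel[OF V])
    then have "measure (convpow A k) ?V = 1" using R.prob_le_1 by (intro antisym)
    then show ?thesis using R.emeasure_space_1 by (simp add: R.emeasure_eq_measure)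
  qed
  have "emeasure (cpois r A) ?V = emeasure (cpois r A) UNIV"
    unfolding emeasure_cpois[OF A r countable_in_borel[OF V]] by (subst emeasure_cpois[OF A r]) (auto simp: one)
  then have "measure (cpois r A) ?V = 1" using C.prob_space by (simp add: measure_def)
  then show ?thesis using V by blast
qed

section \<open>Discrete laws\<close>

lemma (in finite_borel_measure) atom_masses_summable:
  "integrable (count_space UNIV) (\<lambda>x. measure M {x})"
  "(\<integral>x. measure M {x} \<partial>count_space UNIV) \<le> measure M UNIV"
proof -
  let ?S = "{x. measure M {x} > 0}"
  have S: "countable ?S" using countable_support by (simp add: zero_less_measure_iff)
  have "(\<integral>\<^sup>+x. ennreal (measure M {x}) \<partial>count_space UNIV) = (\<integral>\<^sup>+x. ennreal (measure M {x}) * indicator ?S x \<partial>count_space UNIV)"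
    by (intro nn_integral_cong) (auto simp: indicator_def zero_less_measure_iff measure_le_0_iff)
  also have "\<dots> = (\<integral>\<^sup>+x. emeasure M {x} \<partial>count_space ?S)"
    by (subst nn_integral_count_space_indicator) (auto simp: emeasure_eq_measure)
  also have "\<dots> = emeasure M ?S"
    using S by (intro emeasure_countable_singleton[symmetric]) (auto simp: M_is_borel)
  also have "\<dots> \<le> ennreal (measure M UNIV)" using bounded_measure[of ?S] by (simp add: emeasure_eq_measure)
  finally have *: "(\<integral>\<^sup>+x. ennreal (measure M {x}) \<partial>count_space UNIV) \<le> ennreal (measure M UNIV)" .
  show i: "integrable (count_space UNIV) (\<lambda>x. measure M {x})"
    using * by (intro integrableI_nonneg) (auto intro: le_less_trans)
  show "(\<integral>x. measure M {x} \<partial>count_space UNIV) \<le> measure M UNIV"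
    using * by (subst (asm) nn_integral_eq_integral[OF i]) (auto simp: Bochner_Integration.integral_nonneg)
qed

lemma (in finite_borel_measure) discrete_sum_atoms:
  assumes "countable S" "emeasure M (UNIV - S) = 0"
  shows "(\<integral>x. measure M {x} \<partial>count_space UNIV) = measure M UNIV"
  using discrete_integral(2)[OF assms, of "\<lambda>_. 1"] by simp

lemma count_space_translate:
  fixes f :: "real \<Rightarrow> real"
  shows "integrable (count_space UNIV) (\<lambda>x. f (x + c)) \<longleftrightarrow> integrable (count_space UNIV) f"
    and "(\<integral>x. f (x + c) \<partial>count_space UNIV) = (\<integral>x. f x \<partial>count_space UNIV)"
proof -
  have b: "bij_betw (\<lambda>x. x + c) UNIV UNIV" by (simp add: bij_plus_right)
  show "integrable (count_space UNIV) (\<lambda>x. f (x + c)) \<longleftrightarrow> integrable (count_space UNIV) f"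
    using integrable_bij_count_space[OF b, of f] by simp
  show "(\<integral>x. f (x + c) \<partial>count_space UNIV) = (\<integral>x. f x \<partial>count_space UNIV)"
    using integral_bij_count_space[OF b, of f] by simp
qed

text \<open>Finitely many values of z are modified, because the bounds without additive constants are only
  asymptotically true.\<close>

lemma logarithmic_sandwich:
  fixes z :: "nat \<Rightarrow> real"
  assumes a: "0 < a" and low: "\<And>n. n \<ge> N \<Longrightarrow> a * ln (real n) - b \<le> z n"
    and up: "\<And>n. n \<ge> N \<Longrightarrow> z n \<le> a' * ln (real n) + b'"
  shows "\<exists>\<zeta> c1 c2 N'. 0 < c1 \<and> c1 \<le> c2 \<and> N \<le> N' \<and> (\<forall>n\<ge>N'. \<zeta> n = z n) \<and>
     (\<forall>n\<ge>1. c1 * ln (real n) \<le> \<zeta> n \<and> \<zeta> n \<le> c2 * ln (real n))"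
proof -
  \<comment> \<open>Half the slope absorbs \<open>b\<close> as soon as
    \<open>ln n \<ge> 2 * b / a\<close>, slope \<open>a' + 1\<close> absorbs \<open>b'\<close> as
    soon as \<open>ln n \<ge> b'\<close>; the maximum enforces \<open>c1 \<le> c2\<close>.\<close>
  define c1 c2 where "c1 = a / 2" and "c2 = max (a/2) (a' + 1)"
  have lim: "filterlim (\<lambda>n. ln (real n)) at_top sequentially"
    by (rule filterlim_compose[OF ln_at_top filterlim_real_sequentially])
  have "\<forall>\<^sub>F n in sequentially. max (2 * b / a) b' \<le> ln (real n)"
    using lim unfolding filterlim_at_top by blast
  then obtain N0 where N0: "\<And>n. n \<ge> N0 \<Longrightarrow> max (2 * b / a) b' \<le> ln (real n)"
    by (auto simp: eventually_sequentially)
  define N' where "N' = max (max N N0) 1"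
  define \<zeta> where "\<zeta> n = (if n \<ge> N' then z n else c1 * ln (real n))" for n
  have "c1 * ln (real n) \<le> \<zeta> n \<and> \<zeta> n \<le> c2 * ln (real n)" if n: "n \<ge> 1" for n
  proof (cases "n \<ge> N'")
    case True
    then have nN: "n \<ge> N" "n \<ge> N0" by (auto simp: N'_def)
    have "2 * b / a \<le> ln (real n)" "b' \<le> ln (real n)" using N0[OF nN(2)] by auto
    then have "b \<le> a / 2 * ln (real n)" using a by (simp add: field_simps)
    then have 1: "c1 * ln (real n) \<le> z n" using low[OF nN(1)] by (simp add: c1_def)
    have "z n \<le> (a' + 1) * ln (real n)" using up[OF nN(1)] \<open>b' \<le> ln (real n)\<close> by (simp add: algebra_simps)
    also have "\<dots> \<le> c2 * ln (real n)" using n by (intro mult_right_mono) (auto simp: c2_def)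
    finally show ?thesis using 1 True by (simp add: \<zeta>_def)
  next
    case False
    have "c1 * ln (real n) \<le> c2 * ln (real n)" using n by (intro mult_right_mono) (auto simp: c1_def c2_def)
    then show ?thesis using False by (simp add: \<zeta>_def)
  qed
  moreover have "0 < c1" "c1 \<le> c2" using a by (auto simp: c1_def c2_def)
  moreover have "N \<le> N'" "\<forall>n\<ge>N'. \<zeta> n = z n" by (auto simp: N'_def \<zeta>_def)
  ultimately show ?thesis by blast
qed

text \<open>\<open>A_zero\<close> fixes the representation: almost every jump is nonzero, so the
  event of exactly one jump contributes entirely to the mass off \<open>d/n\<close>.\<close>

locale cp_family =
  fixes P :: "nat \<Rightarrow> real measure" and r d :: real and A :: "real measure"
  assumes r_pos: "0 < r" and A_dist: "real_distribution A" and A_zero: "measure A {0} = 0"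
    and P_eq: "\<And>n. n \<ge> 1 \<Longrightarrow> P n = (return borel (d / real n) \<star> cpois (r / real n) A)"
begin

lemma P_dist: "n \<ge> 1 \<Longrightarrow> real_distribution (P n)"
  using r_pos by (simp add: P_eq real_distribution_convolution real_distribution_return real_distribution_cpois A_dist)

lemma measure_P:
  assumes n: "n \<ge> 1" and S: "S \<in> sets borel"
  shows "measure (P n) S = measure (cpois (r / real n) A) {x. x + d / real n \<in> S}"
proof -
  interpret C: real_distribution "cpois (r / real n) A" using A_dist r_pos by (intro real_distribution_cpois) auto
  have "emeasure (P n) S = emeasure (cpois (r / real n) A) {a. a + d / real n \<in> S}"
    unfolding P_eq[OF n] emeasure_convolution_translate[OF real_distribution_return C.real_distribution_axioms S]
  proof (subst nn_integral_return)
    have "(\<lambda>x. emeasure (cpois (r / real n) A) {a. a + x \<in> S}) = (\<lambda>x. \<integral>\<^sup>+a. indicator S (a + x) \<partial>cpois (r / real n) A)"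
    proof
      fix x
      have [measurable]: "{a. a + x \<in> S} \<in> sets borel" using S by measurable
      have "emeasure (cpois (r / real n) A) {a. a + x \<in> S} = (\<integral>\<^sup>+a. indicator {a. a + x \<in> S} a \<partial>cpois (r / real n) A)"
        by simp
      also have "\<dots> = (\<integral>\<^sup>+a. indicator S (a + x) \<partial>cpois (r / real n) A)"
        by (intro nn_integral_cong) (auto simp: indicator_def)
      finally show "emeasure (cpois (r / real n) A) {a. a + x \<in> S} = (\<integral>\<^sup>+a. indicator S (a + x) \<partial>cpois (r / real n) A)" .
    qed
    then show "(\<lambda>x. emeasure (cpois (r / real n) A) {a. a + x \<in> S}) \<in> borel_measurable borel"
      using S by simp
  qed auto
  then show ?thesis by (simp add: measure_def)
qed

text \<open>The displacement from the zero-jump point \<open>d/n\<close> of \<open>P n\<close> to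
  the zero-jump point \<open>d\<close> of \<open>P 1\<close>; translation by it makes the two laws
  comparable.\<close>

definition shift :: "nat \<Rightarrow> real" where
  "shift n = d - d / real n"

lemma P_le_shifted:
  assumes n: "n \<ge> 1" and S: "S \<in> sets borel" "d / real n \<notin> S"
  shows "real n * measure (P n) S \<le> exp r * measure (P 1) {x. x - shift n \<in> S}"
proof -
  let ?S = "{x. x + d / real n \<in> S}"
  have Sm: "?S \<in> sets borel" "{x. x - shift n \<in> S} \<in> sets borel" using S(1) by measurable
  have "measure (P n) S = measure (cpois (1 / real n * r) A) ?S" using measure_P[OF n S(1)] by simp
  also have "\<dots> \<le> 1 / real n * exp r * measure (cpois r A) ?S"
    using n r_pos S Sm by (intro cpois_scale_le A_dist) auto
  also have "measure (cpois r A) ?S = measure (P 1) {x. x - shift n \<in> S}"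
    by (subst measure_P) (use Sm in \<open>auto simp: shift_def algebra_simps\<close>)
  finally show ?thesis using n by (simp add: field_simps)
qed

lemma P_center_ge: "n \<ge> 1 \<Longrightarrow> exp (- (r / real n)) \<le> measure (P n) {d / real n}"
  using cpois_ge_zero_term[OF A_dist, of "r / real n"] r_pos by (simp add: measure_P)

lemma P_off_center_ge:
  assumes n: "n \<ge> 1"
  shows "r / real n * exp (- (r / real n)) \<le> 1 - measure (P n) {d / real n}"
proof -
  interpret A: real_distribution A by (rule A_dist)
  interpret Pn: real_distribution "P n" using n by (rule P_dist)
  have "measure A (UNIV - {0}) = 1" using A.prob_compl[of "{0}"] A_zero by simp
  then have "r / real n * exp (- (r / real n)) \<le> measure (cpois (r / real n) A) (UNIV - {0})"
    using cpois_ge_one_term[OF A_dist, of "r / real n" "UNIV - {0}"] r_pos by simp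
  also have "\<dots> = measure (P n) (UNIV - {d / real n})"
    using n by (subst measure_P) (auto intro!: arg_cong[where f="measure _"])
  also have "\<dots> = 1 - measure (P n) {d / real n}" using Pn.prob_compl[of "{d / real n}"] by simp
  finally show ?thesis .
qed

lemma jump_law_le:
  assumes S: "S \<in> sets borel"
  shows "r * exp (- r) * measure A {x. x + d \<in> S} \<le> measure (P 1) S"
proof -
  have "{x. x + d \<in> S} \<in> sets borel" using S by measurable
  then show ?thesis using cpois_ge_one_term[OF A_dist, of r "{x. x + d \<in> S}"] r_pos S by (simp add: measure_P)
qed

abbreviation atom_entropy :: "nat \<Rightarrow> real" where
  "atom_entropy n \<equiv> (\<integral>x. eta (measure (P n) {x}) \<partial>count_space UNIV)"

text \<open>The atom at \<open>d/n\<close> contributes at most r, since its mass is at least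
  \<open>exp (- (r/n))\<close> and \<open>eta p \<le> 1 - p\<close>. The mass p of any other point
  satisfies \<open>n * p \<le> exp r\<close> times a point mass of the translated
  \<open>P 1\<close>; rescaling by n produces the \<open>ln n\<close> term, and
  \<open>abs_eta_dominated\<close>, with \<open>ln C = r\<close>, the constants.\<close>

lemma atom_entropy_bound:
  assumes fin: "integrable (count_space UNIV) (\<lambda>x. eta (measure (P 1) {x}))" and n: "n \<ge> 1"
  shows "integrable (count_space UNIV) (\<lambda>x. eta (measure (P n) {x}))"
    and "real n * atom_entropy n \<le> exp r * ln (real n) + (r + (1 + exp r * r) + exp r * atom_entropy 1)"
    and "0 \<le> atom_entropy n"
proof -
  interpret P1: real_distribution "P 1" by (rule P_dist) simp
  interpret Pn: real_distribution "P n" using n by (rule P_dist)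
  define C where "C = exp r"
  have C: "1 \<le> C" "ln C = r" using r_pos by (auto simp: C_def)
  let ?k = "\<lambda>x. measure (P 1) {x + shift n}"
  let ?U = "\<lambda>x. r * indicator {d / real n} x + ((1 + C * r) * ?k x + C * eta (?k x) + C * ln (real n) * ?k x)"
  have eta0: "0 \<le> eta (measure (P n) {x})" "0 \<le> eta (?k x)" for x
    using eta_nonneg[OF measure_nonneg Pn.prob_le_1] eta_nonneg[OF measure_nonneg P1.prob_le_1] by auto
  have lnn: "0 \<le> ln (real n)" using n by simp
  have bound: "real n * eta (measure (P n) {x}) \<le> ?U x" for x
  proof (cases "x = d / real n")
    case True
    have "real n * eta (measure (P n) {x}) \<le> real n * (1 - measure (P n) {x})"
      by (intro mult_left_mono eta_le) auto
    also have "\<dots> \<le> real n * (1 - exp (- (r / real n)))"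
      using P_center_ge[OF n] True by (intro mult_left_mono) auto
    also have "\<dots> \<le> real n * (r / real n)"
      using exp_ge_add_one_self[of "- (r / real n)"] by (intro mult_left_mono) auto
    also have "\<dots> = r" using n by simp
    finally have "real n * eta (measure (P n) {x}) \<le> r" .
    moreover have "0 \<le> (1 + C * r) * ?k x + C * eta (?k x) + C * ln (real n) * ?k x"
      using C r_pos lnn eta0 by (intro add_nonneg_nonneg mult_nonneg_nonneg) auto
    ultimately show ?thesis using True by simp
  next
    case False
    let ?f = "real n * measure (P n) {x}"
    have "{y. y - shift n \<in> {x}} = {x + shift n}" by auto
    then have f: "?f \<le> C * ?k x" using P_le_shifted[OF n, of "{x}"] False by (simp add: C_def)
    have "eta ?f = real n * eta (measure (P n) {x}) + eta (real n) * measure (P n) {x}"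
      by (rule eta_mult) auto
    then have "real n * eta (measure (P n) {x}) = eta ?f + ln (real n) * ?f"
      by (simp add: eta_def[of "real n"])
    also have "eta ?f \<le> (1 + C * ln C) * ?k x + C * \<bar>eta (?k x)\<bar>"
      using abs_eta_dominated[OF _ f] C by simp
    also have "ln (real n) * ?f \<le> ln (real n) * (C * ?k x)" using lnn f by (rule mult_left_mono[rotated])
    finally show ?thesis using False eta0(2)[of x] by (simp add: C algebra_simps)
  qed
  have ik: "integrable (count_space UNIV) ?k" "(\<integral>x. ?k x \<partial>count_space UNIV) \<le> 1"
    using count_space_translate[of "\<lambda>x. measure (P 1) {x}" "shift n"] P1.atom_masses_summable P1.prob_space
    unfolding P1.space_eq_univ by simp_all
  have ie: "integrable (count_space UNIV) (\<lambda>x. eta (?k x))" "(\<integral>x. eta (?k x) \<partial>count_space UNIV) = atom_entropy 1"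
    using count_space_translate[of "\<lambda>x. eta (measure (P 1) {x})" "shift n"] fin by simp_all
  have ii: "integrable (count_space UNIV) (indicator {d / real n} :: real \<Rightarrow> real)"
    "(\<integral>x. indicator {d / real n} x \<partial>count_space UNIV) = (1::real)"
    by (auto intro!: integrable_real_indicator)
  have iU: "integrable (count_space UNIV) ?U"
    by (intro Bochner_Integration.integrable_add integrable_mult_right ik ie ii)
  have "integrable (count_space UNIV) (\<lambda>x. real n * eta (measure (P n) {x}))"
    by (rule Bochner_Integration.integrable_bound[OF iU])
       (use bound eta0 in \<open>auto simp: abs_mult intro!: order_trans[OF _ abs_ge_self]\<close>)
  then show i: "integrable (count_space UNIV) (\<lambda>x. eta (measure (P n) {x}))"
    using n by simp
  have "real n * atom_entropy n = (\<integral>x. real n * eta (measure (P n) {x}) \<partial>count_space UNIV)" by simp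
  also have "\<dots> \<le> (\<integral>x. ?U x \<partial>count_space UNIV)"
    using i iU bound by (intro integral_mono) auto
  also have "\<dots> = r * 1 + ((1 + C * r) * (\<integral>x. ?k x \<partial>count_space UNIV) + C * atom_entropy 1 + C * ln (real n) * (\<integral>x. ?k x \<partial>count_space UNIV))"
    using ik(1) ie ii by (simp only: Bochner_Integration.integral_add integrable_mult_right Bochner_Integration.integrable_add
        integral_mult_right_zero)
  also have "\<dots> \<le> r * 1 + ((1 + C * r) * 1 + C * atom_entropy 1 + C * ln (real n) * 1)"
    using ik(2) C r_pos lnn by (intro add_mono mult_left_mono order_refl) auto
  finally show "real n * atom_entropy n \<le> exp r * ln (real n) + (r + (1 + exp r * r) + exp r * atom_entropy 1)"
    by (simp add: C_def)
  show "0 \<le> atom_entropy n" using eta0 by (intro Bochner_Integration.integral_nonneg) auto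
qed

lemma P_discrete:
  assumes D: "countable D" "emeasure (P 1) (UNIV - D) = 0" and n: "n \<ge> 1"
  shows "\<exists>S. countable S \<and> emeasure (P n) (UNIV - S) = 0"
proof (intro exI conjI)
  interpret P1: real_distribution "P 1" by (rule P_dist) simp
  interpret Pn: real_distribution "P n" using n by (rule P_dist)
  \<comment> \<open>Off the zero-jump point the domination by the translated \<open>P 1\<close>
    leaves mass only on the translated atoms.\<close>
  let ?S = "insert (d / real n) ((\<lambda>x. x - shift n) ` D)"
  show c: "countable ?S" using D(1) by auto
  have m: "UNIV - ?S \<in> sets borel" using countable_in_borel[OF c] by auto
  have "real n * measure (P n) (UNIV - ?S) \<le> exp r * measure (P 1) {x. x - shift n \<in> UNIV - ?S}"
    by (rule P_le_shifted[OF n m]) auto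
  also have "measure (P 1) {x. x - shift n \<in> UNIV - ?S} \<le> measure (P 1) (UNIV - D)"
  proof (rule P1.finite_measure_mono)
    show "UNIV - D \<in> sets (P 1)" unfolding P1.events_eq_borel using countable_in_borel[OF D(1)] by auto
  qed auto
  also have "\<dots> = 0" using D(2) by (simp add: measure_def)
  finally have "measure (P n) (UNIV - ?S) \<le> 0" using n by (simp add: mult_le_0_iff)
  then show "emeasure (P n) (UNIV - ?S) = 0" by (simp add: Pn.emeasure_eq_measure measure_le_0_iff)
qed

text \<open>Each atom other than \<open>d/n\<close> is at most their total mass \<delta>, so these
  atoms alone have entropy at least \<open>\<delta> * (- ln \<delta>)\<close>. The mass \<delta>
  lies between \<open>r * exp (- r) / n\<close> and \<open>r / n\<close>; the condition
  \<open>r \<le> n\<close> makes \<open>ln n - ln r\<close> nonnegative, so that the bounds may be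
  multiplied.\<close>

lemma atom_entropy_ge:
  assumes S: "countable S" "emeasure (P n) (UNIV - S) = 0" and n: "n \<ge> 1" "r \<le> real n"
    and i: "integrable (count_space UNIV) (\<lambda>x. eta (measure (P n) {x}))"
  shows "r * exp (- r) * ln (real n) - r * exp (- r) * ln r \<le> real n * atom_entropy n"
proof -
  interpret Pn: real_distribution "P n" using n(1) by (rule P_dist)
  let ?c = "d / real n"
  let ?\<delta> = "1 - measure (P n) {?c}"
  have "r / real n * exp (- r) \<le> r / real n * exp (- (r / real n))"
    using r_pos n by (intro mult_left_mono) (auto simp: divide_le_eq mult_left_le)
  then have lo: "r / real n * exp (- r) \<le> ?\<delta>" using P_off_center_ge[OF n(1)] by linarith
  then have pos: "0 < ?\<delta>" using r_pos n by (smt (verit) divide_pos_pos exp_gt_zero mult_pos_pos of_nat_0_less_iff)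
  have hi: "?\<delta> \<le> r / real n"
    using P_center_ge[OF n(1)] exp_ge_add_one_self[of "- (r / real n)"] by linarith
  have off: "measure (P n) {x} \<le> ?\<delta>" if "x \<noteq> ?c" for x
  proof -
    have "measure (P n) {x} \<le> measure (P n) (UNIV - {?c})" using that by (intro Pn.finite_measure_mono) auto
    also have "\<dots> = ?\<delta>" using Pn.prob_compl[of "{?c}"] by simp
    finally show ?thesis .
  qed
  \<comment> \<open>The atom at the centre is removed, so that the remaining masses add up to
    \<delta>.\<close>
  let ?L = "\<lambda>x. (- ln ?\<delta>) * (measure (P n) {x} - measure (P n) {?c} * indicator {?c} x)"
  have ii: "integrable (count_space UNIV) (indicator {?c} :: real \<Rightarrow> real)"
    "(\<integral>x. indicator {?c} x \<partial>count_space UNIV) = (1::real)"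
    by (auto intro!: integrable_real_indicator)
  have iL: "integrable (count_space UNIV) ?L"
    by (intro integrable_mult_right Bochner_Integration.integrable_diff Pn.atom_masses_summable ii)
  have "(- ln ?\<delta>) * ?\<delta> = (\<integral>x. ?L x \<partial>count_space UNIV)"
    using Pn.discrete_sum_atoms[OF S] Pn.prob_space Pn.atom_masses_summable(1) ii by simp
  also have "\<dots> \<le> atom_entropy n"
  proof (rule integral_mono[OF iL i])
    fix x
    show "?L x \<le> eta (measure (P n) {x})"
    proof (cases "x = ?c")
      case True then show ?thesis by (simp add: eta_nonneg)
    next
      case False
      show ?thesis
      proof (cases "measure (P n) {x} = 0")
        case F: False
        then have "0 < measure (P n) {x}" by (simp add: zero_less_measure_iff)
        then have "ln (measure (P n) {x}) \<le> ln ?\<delta>" using off[OF False] by (intro ln_mono) auto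
        then have "measure (P n) {x} * ln (measure (P n) {x}) \<le> measure (P n) {x} * ln ?\<delta>"
          by (intro mult_left_mono) auto
        then show ?thesis using False by (simp add: eta_def mult.commute)
      qed (use False in simp)
    qed
  qed
  finally have 1: "?\<delta> * (- ln ?\<delta>) \<le> atom_entropy n" by (simp add: mult.commute)
  have "ln ?\<delta> \<le> ln (r / real n)" using pos hi by (intro ln_mono) auto
  also have "\<dots> = ln r - ln (real n)" using r_pos n by (simp add: ln_div)
  finally have 2: "ln (real n) - ln r \<le> - ln ?\<delta>" by simp
  have 3: "0 \<le> ln (real n) - ln r" using n r_pos by (simp add: ln_mono)
  have "r / real n * exp (- r) * (ln (real n) - ln r) \<le> ?\<delta> * (- ln ?\<delta>)"
    using lo 2 3 pos by (intro mult_mono) auto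
  also note 1
  finally have "real n * (r / real n * exp (- r) * (ln (real n) - ln r)) \<le> real n * atom_entropy n"
    by (intro mult_left_mono) auto
  moreover have "real n * (r / real n * exp (- r) * (ln (real n) - ln r)) = r * exp (- r) * (ln (real n) - ln r)"
    using n by simp
  ultimately show ?thesis by (simp only: right_diff_distrib)
qed

theorem discrete_case:
  assumes disc: "discrete_law (P 1)" and H: "dentropy (P 1) < \<infinity>"
  shows "\<exists>(mn :: nat \<Rightarrow> nat) (\<zeta> :: nat \<Rightarrow> real) c1 c2. 0 < c1 \<and> c1 \<le> c2 \<and>
            (\<forall>n\<ge>1. c1 * ln (real n) \<le> \<zeta> n \<and> \<zeta> n \<le> c2 * ln (real n)) \<and>
            (\<forall>\<epsilon>>0. \<forall>\<^sub>F n in sequentially. \<forall>m\<ge>mn n.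
               Hq m (P n) < \<infinity> \<and>
               \<bar>real n * enn2real (Hq m (P n)) - \<zeta> n\<bar> \<le> \<epsilon>)"
proof -
  interpret P1: real_distribution "P 1" by (rule P_dist) simp
  obtain D where D: "countable D" "emeasure (P 1) (UNIV - D) = 0" using disc by (auto simp: discrete_law_def)
  have fin: "integrable (count_space UNIV) (\<lambda>x. eta (measure (P 1) {x}))"
  proof (rule integrableI_nonneg)
    show "(\<integral>\<^sup>+x. ennreal (eta (measure (P 1) {x})) \<partial>count_space UNIV) < \<infinity>"
      using H by (simp add: dentropy_def eta_def)
    show "AE x in count_space UNIV. 0 \<le> eta (measure (P 1) {x})"
      by (intro AE_I2 eta_nonneg measure_nonneg P1.prob_le_1)
  qed simp
  note ub = atom_entropy_bound[OF fin]
  have "\<exists>\<zeta> c1 c2 N'. 0 < c1 \<and> c1 \<le> c2 \<and> max 1 (nat \<lceil>r\<rceil>) \<le> N' \<and> (\<forall>n\<ge>N'. \<zeta> n = real n * atom_entropy n) \<and>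
     (\<forall>n\<ge>1. c1 * ln (real n) \<le> \<zeta> n \<and> \<zeta> n \<le> c2 * ln (real n))"
  proof (rule logarithmic_sandwich)
    show "0 < r * exp (- r)" using r_pos by simp
    fix n assume n: "max 1 (nat \<lceil>r\<rceil>) \<le> n"
    then have n': "n \<ge> 1" "r \<le> real n" by linarith+
    obtain S where "countable S" "emeasure (P n) (UNIV - S) = 0" using P_discrete[OF D n'(1)] by auto
    then show "r * exp (- r) * ln (real n) - r * exp (- r) * ln r \<le> real n * atom_entropy n"
      using n' ub(1)[OF n'(1)] by (rule atom_entropy_ge)
    show "real n * atom_entropy n \<le> exp r * ln (real n) + (r + (1 + exp r * r) + exp r * atom_entropy 1)"
      by (rule ub(2)[OF n'(1)])
  qed
  then obtain \<zeta> c1 c2 N' where z: "0 < c1" "c1 \<le> c2" "max 1 (nat \<lceil>r\<rceil>) \<le> N'" "\<forall>n\<ge>N'. \<zeta> n = real n * atom_entropy n"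
     "\<forall>n\<ge>1. c1 * ln (real n) \<le> \<zeta> n \<and> \<zeta> n \<le> c2 * ln (real n)" by blast
  have key: "Hq m (P n) < \<infinity>" "(\<lambda>m. real n * enn2real (Hq m (P n)) - \<zeta> n) \<longlonglongrightarrow> 0" if n: "n \<ge> N'" and m: "m \<ge> 1" for n m
  proof -
    have n1: "n \<ge> 1" using n z(3) by simp
    interpret Pn: real_distribution "P n" using n1 by (rule P_dist)
    obtain S where S: "countable S" "emeasure (P n) (UNIV - S) = 0" using P_discrete[OF D n1] by auto
    have le: "measure (P n) UNIV \<le> 1" by simp
    note C = Pn.discrete_quantized_entropy[OF S le ub(1)[OF n1]]
    show "Hq m (P n) < \<infinity>" using Pn.Hq_finite_iff[OF m le] C(1) by simp
    have "(\<lambda>m. real n * (\<integral>k. eta (mass m (P n) k) \<partial>count_space UNIV) - \<zeta> n) \<longlonglongrightarrow> real n * atom_entropy n - \<zeta> n"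
      by (intro tendsto_intros C(2))
    moreover have "\<forall>\<^sub>F m in sequentially. real n * (\<integral>k. eta (mass m (P n) k) \<partial>count_space UNIV) - \<zeta> n = real n * enn2real (Hq m (P n)) - \<zeta> n"
      by (rule eventually_sequentiallyI[of 1]) (use le in \<open>simp add: Pn.enn2real_Hq\<close>)
    ultimately have "(\<lambda>m. real n * enn2real (Hq m (P n)) - \<zeta> n) \<longlonglongrightarrow> real n * atom_entropy n - \<zeta> n"
      by (rule Lim_transform_eventually)
    then show "(\<lambda>m. real n * enn2real (Hq m (P n)) - \<zeta> n) \<longlonglongrightarrow> 0"
      using z(4) n by simp
  qed
  have "\<exists>mn :: nat \<Rightarrow> nat. \<forall>\<epsilon>>0. \<forall>\<^sub>F n in sequentially. \<forall>m\<ge>mn n.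
               Hq m (P n) < \<infinity> \<and> \<bar>real n * enn2real (Hq m (P n)) - \<zeta> n\<bar> \<le> \<epsilon>"
    by (rule choose_resolution[where N=N']) (rule key(2)[OF _ order_refl] key(1), assumption+)+
  then show ?thesis using z by blast
qed

end

section \<open>Discrete-continuous laws\<close>

text \<open>Restriction without normalization, so that the cell masses of the two parts of a split
  simply add.\<close>

abbreviation part :: "real measure \<Rightarrow> real set \<Rightarrow> real measure" where
  "part M S \<equiv> density M (indicator S)"

context real_distribution
begin

lemma emeasure_part:
  assumes "S \<in> sets borel" "T \<in> sets borel"
  shows "emeasure (part M S) T = emeasure M (T \<inter> S)"
proof -
  have "emeasure (part M S) T = (\<integral>\<^sup>+x. indicator S x * indicator T x \<partial>M)"
    using assms by (subst emeasure_density) auto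
  also have "\<dots> = (\<integral>\<^sup>+x. indicator (T \<inter> S) x \<partial>M)"
    by (intro nn_integral_cong) (auto simp: indicator_def)
  also have "\<dots> = emeasure M (T \<inter> S)" using assms by (intro nn_integral_indicator) auto
  finally show ?thesis .
qed

lemma measure_part:
  "S \<in> sets borel \<Longrightarrow> T \<in> sets borel \<Longrightarrow> measure (part M S) T = measure M (T \<inter> S)"
  by (simp add: measure_def emeasure_part)

lemma finite_borel_part:
  assumes "S \<in> sets borel"
  shows "finite_borel_measure (part M S)"
proof (intro finite_borel_measure.intro finite_measureI finite_borel_measure_axioms.intro)
  show "emeasure (part M S) (space (part M S)) \<noteq> \<infinity>"
    using assms by (simp add: emeasure_part)
qed simp

lemma emeasure_cond_law:
  assumes "S \<in> sets borel" "T \<in> sets borel"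
  shows "emeasure (cond_law M S) T = ennreal (1 / measure M S) * emeasure (part M S) T"
  by (simp add: cond_law_def)

lemma finite_borel_cond_law:
  assumes "S \<in> sets borel"
  shows "finite_borel_measure (cond_law M S)"
proof (intro finite_borel_measure.intro finite_measureI finite_borel_measure_axioms.intro)
  show "emeasure (cond_law M S) (space (cond_law M S)) \<noteq> \<infinity>"
  proof -
    have "space (cond_law M S) = UNIV" by (simp add: cond_law_def space_scale_measure)
    then show ?thesis using assms by (simp add: emeasure_cond_law emeasure_part ennreal_mult_eq_top_iff emeasure_eq_measure)
  qed
  show "sets (cond_law M S) = sets borel" by (simp add: cond_law_def)
qed

lemma measure_cond_law:
  assumes "S \<in> sets borel" "T \<in> sets borel"
  shows "measure (cond_law M S) T = measure M (T \<inter> S) / measure M S"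
  using assms by (simp add: measure_def emeasure_cond_law emeasure_part enn2real_mult)

lemma dc_split_sets: "dc_split M D \<Longrightarrow> D \<in> sets borel \<and> UNIV - D \<in> sets borel"
  using countable_in_borel[of D] by (auto simp: dc_split_def)

lemma dc_split_compl: "dc_split M D \<Longrightarrow> measure M (UNIV - D) = 1 - measure M D"
  using prob_compl[of D] dc_split_sets[of D] by simp

lemma dc_split_part_ac:
  assumes D: "dc_split M D"
  shows "absolutely_continuous lborel (part M (UNIV - D))"
  unfolding absolutely_continuous_def
proof
  fix N :: "real set" assume N: "N \<in> null_sets lborel"
  then have Ns: "N \<in> sets borel" by auto
  have "emeasure (cond_law M (UNIV - D)) N = 0"
    using N D by (auto simp: dc_split_def continuous_law_def absolutely_continuous_def)
  then have "ennreal (1 / measure M (UNIV - D)) * emeasure (part M (UNIV - D)) N = 0"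
    using emeasure_cond_law[of "UNIV - D" N] dc_split_sets[OF D] Ns by simp
  moreover have "ennreal (1 / measure M (UNIV - D)) \<noteq> 0"
    using D unfolding dc_split_compl[OF D] by (simp add: dc_split_def)
  ultimately show "N \<in> null_sets (part M (UNIV - D))" using Ns by (intro null_setsI) auto
qed

text \<open>The continuous part does not charge a Lebesgue null set, and D is missed. Consequently
  all atoms lie in D, and countable sets disjoint from D are negligible.\<close>

lemma dc_split_null:
  assumes D: "dc_split M D" and N: "N \<in> null_sets lborel" "N \<inter> D = {}"
  shows "measure M N = 0"
proof -
  have "emeasure (part M (UNIV - D)) N = 0"
    using dc_split_part_ac[OF D] N by (auto simp: absolutely_continuous_def)
  moreover have "N \<inter> (UNIV - D) = N" using N by auto
  moreover have "N \<in> sets borel" using N(1) by auto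
  ultimately show ?thesis using dc_split_sets[OF D] by (simp add: emeasure_part measure_def)
qed

lemma dc_split_atom: "dc_split M D \<Longrightarrow> x \<notin> D \<Longrightarrow> measure M {x} = 0"
  by (rule dc_split_null) auto

lemma dc_split_density_measure:
  "dc_split M D \<Longrightarrow> density_measure (dens (part M (UNIV - D))) (part M (UNIV - D))"
  using dc_split_sets by (intro density_measure_dens finite_borel_part dc_split_part_ac) auto

text \<open>The unnormalized density is \<open>q\<close> times the conditional one, and
  \<open>eta_mult\<close> turns this into a combination of two integrable functions.\<close>

lemma dc_split_eta_density:
  assumes D: "dc_split M D" and wd: "dentropy_wd (cond_law M (UNIV - D))"
  shows "integrable lborel (\<lambda>x. eta (dens (part M (UNIV - D)) x))"
proof -
  define q where "q = 1 - measure M D"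
  have q: "0 < q" "q \<le> 1" using D by (auto simp: q_def dc_split_def)
  note s = dc_split_sets[OF D]
  let ?c = "cond_law M (UNIV - D)" and ?B = "part M (UNIV - D)"
  interpret B: density_measure "dens ?B" ?B using D by (rule dc_split_density_measure)
  have fc: "finite_borel_measure ?c" using s by (intro finite_borel_cond_law) auto
  interpret c: density_measure "dens ?c" ?c
    using fc wd by (intro density_measure_dens) (auto simp: dentropy_wd_def)
  have "density lborel (\<lambda>x. ennreal (dens ?B x)) = density lborel (\<lambda>x. ennreal (q * dens ?c x))"
  proof (rule measure_eqI)
    fix T assume "T \<in> sets (density lborel (\<lambda>x. ennreal (dens ?B x)))"
    then have T[measurable]: "T \<in> sets borel" by simp
    have "emeasure (density lborel (\<lambda>x. ennreal (q * dens ?c x))) T = (\<integral>\<^sup>+x. ennreal q * (ennreal (dens ?c x) * indicator T x) \<partial>lborel)"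
      using q c.g_nonneg by (subst emeasure_density) (auto simp: ennreal_mult mult.assoc)
    also have "\<dots> = ennreal q * (\<integral>\<^sup>+x. ennreal (dens ?c x) * indicator T x \<partial>lborel)"
      by (rule nn_integral_cmult) measurable
    also have "(\<integral>\<^sup>+x. ennreal (dens ?c x) * indicator T x \<partial>lborel) = emeasure (density lborel (\<lambda>x. ennreal (dens ?c x))) T"
      by (subst emeasure_density) auto
    also have "\<dots> = emeasure ?c T" by (simp add: c.B_def[symmetric])
    also have "ennreal q * emeasure ?c T = ennreal q * ennreal (1 / q) * emeasure ?B T"
      using s T dc_split_compl[OF D] by (simp add: emeasure_cond_law q_def mult.assoc)
    also have "ennreal q * ennreal (1 / q) = 1" using q by (simp add: ennreal_mult[symmetric])
    finally show "emeasure (density lborel (\<lambda>x. ennreal (dens ?B x))) T = emeasure (density lborel (\<lambda>x. ennreal (q * dens ?c x))) T"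
      by (simp add: B.B_def[symmetric])
  qed simp
  then have "AE x in lborel. ennreal (dens ?B x) = ennreal (q * dens ?c x)"
    by (intro sigma_finite_measure.density_unique[OF lborel.sigma_finite_measure_axioms]) auto
  then have ae: "AE x in lborel. eta (dens ?B x) = q * eta (dens ?c x) + eta q * dens ?c x"
  proof eventually_elim
    fix x assume "ennreal (dens ?B x) = ennreal (q * dens ?c x)"
    then have "dens ?B x = q * dens ?c x" using B.g_nonneg c.g_nonneg q by simp
    then show "eta (dens ?B x) = q * eta (dens ?c x) + eta q * dens ?c x"
      using q c.g_nonneg by (simp add: eta_mult)
  qed
  have "integrable lborel (\<lambda>x. q * eta (dens ?c x) + eta q * dens ?c x)"
    using dentropy_wd_eta(1)[OF fc wd] c.g_int by auto
  then show ?thesis by (subst integrable_cong_AE[OF _ _ ae]) auto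
qed

lemma dc_split_mass:
  assumes D: "dc_split M D"
  shows "mass m M k = mass m (part M D) k + mass m (part M (UNIV - D)) k"
proof -
  note s = dc_split_sets[OF D]
  let ?c = "cell m -` {k}"
  have "measure M ?c = measure M (?c \<inter> D) + measure M (?c \<inter> (UNIV - D))"
    using s by (subst finite_measure_Union[symmetric]) (auto intro!: arg_cong[where f="measure M"])
  then show ?thesis using s by (simp add: mass_def measure_part)
qed

text \<open>An atom of M is at most the corresponding atom of the conditional law, because
  \<open>measure M D\<close> is below 1; domination with \<open>C = 1\<close> then suffices.\<close>

lemma dc_split_atom_entropy:
  assumes D: "dc_split M D" and H: "dentropy (cond_law M D) < \<infinity>"
  shows "integrable (count_space UNIV) (\<lambda>x. eta (measure M {x}))"
proof -
  note s = dc_split_sets[OF D]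
  let ?c = "cond_law M D"
  interpret c: finite_borel_measure ?c using s by (intro finite_borel_cond_law) auto
  have D01: "0 < measure M D" "measure M D < 1" using D by (auto simp: dc_split_def)
  have le1: "measure ?c {x} \<le> 1" for x
  proof -
    have "measure M ({x} \<inter> D) \<le> measure M D" using s by (intro finite_measure_mono) auto
    then show ?thesis using s D01 by (simp add: measure_cond_law)
  qed
  have ic: "integrable (count_space UNIV) (\<lambda>x. eta (measure ?c {x}))"
  proof (rule integrableI_nonneg)
    show "(\<integral>\<^sup>+x. ennreal (eta (measure ?c {x})) \<partial>count_space UNIV) < \<infinity>"
      using H by (simp add: dentropy_def eta_def)
    show "AE x in count_space UNIV. 0 \<le> eta (measure ?c {x})"
      using le1 by (intro AE_I2 eta_nonneg) auto
  qed simp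
  show ?thesis
  proof (rule Bochner_Integration.integrable_bound)
    show "integrable (count_space UNIV) (\<lambda>x. measure ?c {x} + eta (measure ?c {x}))"
      using ic c.atom_masses_summable(1) by auto
    show "AE x in count_space UNIV. norm (eta (measure M {x})) \<le> norm (measure ?c {x} + eta (measure ?c {x}))"
    proof (rule AE_I2)
      fix x
      have "measure M {x} \<le> 1 * measure ?c {x}"
      proof (cases "x \<in> D")
        case True
        then have "{x} \<inter> D = {x}" by auto
        moreover have "measure M {x} * measure M D \<le> measure M {x}" using D01 by (intro mult_left_le) auto
        ultimately show ?thesis using s D01 by (simp add: measure_cond_law field_simps)
      next
        case False
        then show ?thesis using dc_split_atom[OF D] by simp
      qed
      then have "\<bar>eta (measure M {x})\<bar> \<le> (1 + 1 * ln 1) * measure ?c {x} + 1 * \<bar>eta (measure ?c {x})\<bar>"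
        by (intro abs_eta_dominated) auto
      then show "norm (eta (measure M {x})) \<le> norm (measure ?c {x} + eta (measure ?c {x}))"
        using eta_nonneg[OF _ le1, of x] by simp
    qed
  qed simp
qed

text \<open>\<open>eta\<close> of a cell mass is the sum of \<open>eta\<close> over the two parts
  minus the defect. The atoms contribute a finite limit, the defect vanishes, and the continuous
  part brings its total mass as coefficient of \<open>ln m\<close>.\<close>

theorem mixed_quantized_entropy:
  assumes D: "dc_split M D" and wd: "dentropy_wd (cond_law M (UNIV - D))"
    and fa: "integrable (count_space UNIV) (\<lambda>x. eta (measure M {x}))"
    and f1: "integrable (count_space UNIV) (\<lambda>k. eta (mass 1 M k))"
  shows "m \<ge> 1 \<Longrightarrow> integrable (count_space UNIV) (\<lambda>k. eta (mass m M k))"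
    and "(\<lambda>m. (\<integral>k. eta (mass m M k) \<partial>count_space UNIV) - (1 - measure M D) * ln (real m)) \<longlonglongrightarrow>
      (\<integral>x. eta (measure M {x}) \<partial>count_space UNIV) + (\<integral>x. eta (dens (part M (UNIV - D)) x) \<partial>lborel)"
proof -
  note s = dc_split_sets[OF D]
  let ?A = "part M D" and ?B = "part M (UNIV - D)"
  interpret A: finite_borel_measure ?A using s by (intro finite_borel_part) auto
  interpret B: density_measure "dens ?B" ?B using D by (rule dc_split_density_measure)
  have A1: "measure ?A UNIV \<le> 1" and B1: "measure ?B UNIV \<le> 1" using s by (simp_all add: measure_part)
  have Bq: "measure ?B UNIV = 1 - measure M D" using s dc_split_compl[OF D] by (simp add: measure_part)
  have B0: "0 < measure ?B UNIV" using Bq D by (simp add: dc_split_def)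
  have AD: "countable D" "emeasure ?A (UNIV - D) = 0" using D s
    by (auto simp: dc_split_def emeasure_part Int_commute[of "UNIV - D"])
  have Aatom: "measure ?A {x} = measure M {x}" for x
  proof (cases "x \<in> D")
    case True
    then have "{x} \<inter> D = {x}" by auto
    then show ?thesis using s by (simp add: measure_part)
  next
    case False
    then show ?thesis using s dc_split_atom[OF D False] by (simp add: measure_part)
  qed
  have B_int1: "integrable (count_space UNIV) (\<lambda>k. eta (mass 1 ?B k))"
  proof (rule Bochner_Integration.integrable_bound)
    show "integrable (count_space UNIV) (\<lambda>k. mass 1 M k + \<bar>eta (mass 1 M k)\<bar>)"
      using f1 mass_sums(1)[of 1] by auto
    show "AE k in count_space UNIV. norm (eta (mass 1 ?B k)) \<le> norm (mass 1 M k + \<bar>eta (mass 1 M k)\<bar>)"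
    proof (rule AE_I2)
      fix k
      have "mass 1 ?B k \<le> 1 * mass 1 M k" unfolding dc_split_mass[OF D] by simp
      then have "\<bar>eta (mass 1 ?B k)\<bar> \<le> (1 + 1 * ln 1) * mass 1 M k + 1 * \<bar>eta (mass 1 M k)\<bar>"
        by (intro abs_eta_dominated) auto
      then show "norm (eta (mass 1 ?B k)) \<le> norm (mass 1 M k + \<bar>eta (mass 1 M k)\<bar>)" by simp
    qed
  qed simp
  note Al = A.discrete_quantized_entropy[OF AD A1, unfolded Aatom, OF fa]
  note Bl = B.density_quantized_entropy[OF B0 B1 dc_split_eta_density[OF D wd] B_int1]
  note Jl = eta_defect_vanishes[OF A.finite_borel_measure_axioms B.finite_borel_measure_axioms AD A1 B1 B.measure_B_singleton]
  let ?J = "\<lambda>m k. eta (mass m ?A k) + eta (mass m ?B k) - eta (mass m ?A k + mass m ?B k)"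
  have e: "eta (mass m M k) = eta (mass m ?A k) + eta (mass m ?B k) - ?J m k" for m k
    by (simp add: dc_split_mass[OF D])
  show "integrable (count_space UNIV) (\<lambda>k. eta (mass m M k))" if m: "m \<ge> 1" for m
    unfolding e by (intro Bochner_Integration.integrable_diff Bochner_Integration.integrable_add Al(1) Bl(1)[OF m] Jl(1))
  have v: "(\<integral>k. eta (mass m M k) \<partial>count_space UNIV) =
     (\<integral>k. eta (mass m ?A k) \<partial>count_space UNIV) + (\<integral>k. eta (mass m ?B k) \<partial>count_space UNIV) - (\<integral>k. ?J m k \<partial>count_space UNIV)" if m: "m \<ge> 1" for m
    unfolding e Bochner_Integration.integral_diff[OF Bochner_Integration.integrable_add[OF Al(1) Bl(1)[OF m]] Jl(1)]
      Bochner_Integration.integral_add[OF Al(1) Bl(1)[OF m]] ..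
  have "(\<lambda>m. (\<integral>k. eta (mass m ?A k) \<partial>count_space UNIV) + ((\<integral>k. eta (mass m ?B k) \<partial>count_space UNIV) - measure ?B UNIV * ln (real m)) - (\<integral>k. ?J m k \<partial>count_space UNIV))
    \<longlonglongrightarrow> (\<integral>x. eta (measure M {x}) \<partial>count_space UNIV) + (\<integral>x. eta (dens ?B x) \<partial>lborel) - 0"
    by (intro tendsto_diff tendsto_add Al(2) Bl(2) Jl(2))
  then have l: "(\<lambda>m. (\<integral>k. eta (mass m ?A k) \<partial>count_space UNIV) + ((\<integral>k. eta (mass m ?B k) \<partial>count_space UNIV) - measure ?B UNIV * ln (real m)) - (\<integral>k. ?J m k \<partial>count_space UNIV))
    \<longlonglongrightarrow> (\<integral>x. eta (measure M {x}) \<partial>count_space UNIV) + (\<integral>x. eta (dens ?B x) \<partial>lborel)"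
    by (simp only: diff_0_right)
  show "(\<lambda>m. (\<integral>k. eta (mass m M k) \<partial>count_space UNIV) - (1 - measure M D) * ln (real m)) \<longlonglongrightarrow>
      (\<integral>x. eta (measure M {x}) \<partial>count_space UNIV) + (\<integral>x. eta (dens ?B x) \<partial>lborel)"
  proof (rule Lim_transform_eventually[OF l], rule eventually_sequentiallyI[of 1])
    fix m :: nat assume m: "1 \<le> m"
    show "(\<integral>k. eta (mass m ?A k) \<partial>count_space UNIV) + ((\<integral>k. eta (mass m ?B k) \<partial>count_space UNIV) - measure ?B UNIV * ln (real m)) - (\<integral>k. ?J m k \<partial>count_space UNIV)
      = (\<integral>k. eta (mass m M k) \<partial>count_space UNIV) - (1 - measure M D) * ln (real m)"
      unfolding v[OF m] Bq by simp
  qed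
qed

end

section \<open>Comparison of the continuous parts of \<open>P n\<close> and
  \<open>P 1\<close>\<close>

lemma density_measure_AE_le:
  assumes "density_measure f A" "density_measure g B"
    and le: "\<And>S. S \<in> sets borel \<Longrightarrow> measure A S \<le> c * measure B S"
  shows "AE x in lborel. f x \<le> c * g x"
proof -
  interpret A: density_measure f A by fact
  interpret B: density_measure g B by fact
  define S where "S = {x. f x > c * g x}"
  have S[measurable]: "S \<in> sets borel" unfolding S_def by measurable
  have iA: "integrable lborel (\<lambda>x. indicator S x * f x)" and iB: "integrable lborel (\<lambda>x. indicator S x * g x)"
    using integrable_mult_indicator[OF _ A.g_int, of S] integrable_mult_indicator[OF _ B.g_int, of S] by simp_all
  let ?h = "\<lambda>x. indicator S x * f x - c * (indicator S x * g x)"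
  have ih: "integrable lborel ?h" using iA iB by auto
  have h0: "0 \<le> ?h x" for x by (auto simp: indicator_def S_def)
  have "(\<integral>x. ?h x \<partial>lborel) = measure A S - c * measure B S"
    using iA iB by (simp add: A.measure_B B.measure_B)
  then have "(\<integral>x. ?h x \<partial>lborel) \<le> 0" using le[OF S] by simp
  moreover have "0 \<le> (\<integral>x. ?h x \<partial>lborel)" using h0 by (intro Bochner_Integration.integral_nonneg)
  ultimately have "AE x in lborel. ?h x = 0"
    using integral_nonneg_eq_0_iff_AE[OF ih] h0 by auto
  then show ?thesis by eventually_elim (auto simp: indicator_def S_def split: if_splits)
qed

lemma density_measure_translate:
  assumes "density_measure g B"
  shows "density_measure (\<lambda>x. g (x + c)) (density lborel (\<lambda>x. ennreal (g (x + c))))"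
    and "S \<in> sets borel \<Longrightarrow> measure (density lborel (\<lambda>x. ennreal (g (x + c)))) S = measure B {x. x - c \<in> S}"
proof -
  interpret B: density_measure g B by fact
  show d: "density_measure (\<lambda>x. g (x + c)) (density lborel (\<lambda>x. ennreal (g (x + c))))"
  proof
    show "integrable lborel (\<lambda>x. g (x + c))"
      using lborel_integrable_real_affine[OF B.g_int, of 1 c] by (simp add: add.commute)
  qed (auto simp: B.g_nonneg)
  assume S: "S \<in> sets borel"
  have S': "{x. x - c \<in> S} \<in> sets borel" using S by measurable
  have "measure B {x. x - c \<in> S} = (\<integral>t. indicator S (t - c) * g t \<partial>lborel)"
    unfolding B.measure_B[OF S'] by (intro Bochner_Integration.integral_cong) (auto simp: indicator_def)
  also have "\<dots> = (\<integral>t. indicator S t * g (t + c) \<partial>lborel)"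
    by (subst lborel_integral_real_affine[of 1 _ c]) (auto simp: add.commute)
  finally show "measure (density lborel (\<lambda>x. ennreal (g (x + c)))) S = measure B {x. x - c \<in> S}"
    using density_measure.measure_B[OF d S] by simp
qed

context cp_family
begin

text \<open>The sets \<open>D1\<close> and \<open>Dn\<close> need not correspond. The zero-jump
  point and the translate of \<open>D1\<close> form a countable set, which the continuous part of
  \<open>P n\<close> does not charge; off it the domination of \<open>P n\<close> by the translated
  \<open>P 1\<close> lands outside \<open>D1\<close>.\<close>

lemma cont_part_le_shifted:
  assumes D1: "dc_split (P 1) D1" and n: "n \<ge> 1" and Dn: "dc_split (P n) Dn" and S: "S \<in> sets borel"
  shows "real n * measure (part (P n) (UNIV - Dn)) S \<le> exp r * measure (part (P 1) (UNIV - D1)) {x. x - shift n \<in> S}"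
proof -
  interpret P1: real_distribution "P 1" by (rule P_dist) simp
  interpret Pn: real_distribution "P n" using n by (rule P_dist)
  note s1 = P1.dc_split_sets[OF D1] and sn = Pn.dc_split_sets[OF Dn]
  let ?X = "insert (d / real n) ((\<lambda>x. x - shift n) ` D1)"
  have X: "countable ?X" using D1 by (auto simp: dc_split_def)
  have Xs: "?X \<in> sets borel" using X by (rule countable_in_borel)
  have SX: "S - ?X \<in> sets borel" using S Xs by (rule sets.Diff)
  have Ss: "{x. x - shift n \<in> S} \<in> sets borel" using S by measurable
  have XDn: "?X \<inter> (UNIV - Dn) \<in> null_sets lborel"
    using X by (intro countable_imp_null_set_lborel) auto
  have z: "measure (P n) (?X \<inter> (UNIV - Dn)) = 0"
    by (rule Pn.dc_split_null[OF Dn XDn]) auto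
  have "measure (part (P n) (UNIV - Dn)) S = measure (P n) (S \<inter> (UNIV - Dn))"
    using S sn by (simp add: Pn.measure_part)
  also have "\<dots> \<le> measure (P n) ((S - ?X) \<union> (?X \<inter> (UNIV - Dn)))"
    using S sn Xs by (intro Pn.finite_measure_mono) auto
  also have "\<dots> \<le> measure (P n) (S - ?X) + measure (P n) (?X \<inter> (UNIV - Dn))"
    using SX sn Xs by (intro measure_Un_le) auto
  finally have "real n * measure (part (P n) (UNIV - Dn)) S \<le> real n * measure (P n) (S - ?X)"
    using z by (intro mult_left_mono) auto
  also have "\<dots> \<le> exp r * measure (P 1) {x. x - shift n \<in> S - ?X}"
    by (rule P_le_shifted[OF n SX]) auto
  also have "\<dots> \<le> exp r * measure (P 1) ({x. x - shift n \<in> S} \<inter> (UNIV - D1))"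
  proof (intro mult_left_mono P1.finite_measure_mono)
    show "{x. x - shift n \<in> S} \<inter> (UNIV - D1) \<in> sets (P 1)"
      unfolding P1.events_eq_borel using Ss s1 by (intro sets.Int) auto
  qed auto
  also have "\<dots> = exp r * measure (part (P 1) (UNIV - D1)) {x. x - shift n \<in> S}"
    using Ss s1 P1.measure_part[of "UNIV - D1" "{x. x - shift n \<in> S}"] by simp
  finally show ?thesis .
qed

text \<open>For \<open>f = n * g_n\<close> the scaling rule gives
  \<open>eta f = n * eta g_n - n * ln n * g_n\<close>, and f is below \<open>exp r\<close> times a
  translate of the continuous density of \<open>P 1\<close>. The bound does not depend on n, since
  Lebesgue measure is translation invariant.\<close>

lemma density_entropy_bound:
  assumes D1: "dc_split (P 1) D1" "dentropy_wd (cond_law (P 1) (UNIV - D1))"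
    and n: "n \<ge> 1" and Dn: "dc_split (P n) Dn" "dentropy_wd (cond_law (P n) (UNIV - Dn))"
  shows "\<bar>real n * (\<integral>x. eta (dens (part (P n) (UNIV - Dn)) x) \<partial>lborel) - real n * (1 - measure (P n) Dn) * ln (real n)\<bar>
     \<le> (\<integral>x. (1 + exp r * r) * dens (part (P 1) (UNIV - D1)) x + exp r * \<bar>eta (dens (part (P 1) (UNIV - D1)) x)\<bar> \<partial>lborel)"
proof -
  interpret P1: real_distribution "P 1" by (rule P_dist) simp
  interpret Pn: real_distribution "P n" using n by (rule P_dist)
  let ?B1 = "part (P 1) (UNIV - D1)" and ?Bn = "part (P n) (UNIV - Dn)"
  let ?g1 = "dens ?B1" and ?gn = "dens ?Bn"
  have dm1: "density_measure ?g1 ?B1" using D1(1) by (rule P1.dc_split_density_measure)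
  have dmn: "density_measure ?gn ?Bn" using Dn(1) by (rule Pn.dc_split_density_measure)
  interpret B1: density_measure ?g1 ?B1 by (rule dm1)
  interpret Bn: density_measure ?gn ?Bn by (rule dmn)
  have qn: "(\<integral>x. ?gn x \<partial>lborel) = 1 - measure (P n) Dn"
    using Bn.measure_B_UNIV Pn.dc_split_compl[OF Dn(1)] Pn.dc_split_sets[OF Dn(1)] by (simp add: Pn.measure_part)
  note en = Pn.dc_split_eta_density[OF Dn] and e1 = P1.dc_split_eta_density[OF D1]
  define C where "C = exp r"
  have C: "1 \<le> C" "ln C = r" using r_pos by (auto simp: C_def)
  let ?k = "\<lambda>x. ?g1 (x + shift n)"
  have le: "AE x in lborel. ?gn x \<le> (C / real n) * ?k x"
  proof (rule density_measure_AE_le[OF dmn density_measure_translate(1)[OF dm1]])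
    fix S :: "real set" assume S: "S \<in> sets borel"
    show "measure ?Bn S \<le> C / real n * measure (density lborel (\<lambda>x. ennreal (?k x))) S"
      unfolding density_measure_translate(2)[OF dm1 S]
      using cont_part_le_shifted[OF D1(1) n Dn(1) S] n by (simp add: C_def field_simps)
  qed
  have iw: "integrable lborel (\<lambda>x. (1 + C * r) * ?g1 x + C * \<bar>eta (?g1 x)\<bar>)"
    using B1.g_int e1 by auto
  let ?w = "\<lambda>x. (1 + C * r) * ?k x + C * \<bar>eta (?k x)\<bar>"
  have iwk: "integrable lborel ?w"
    using lborel_integrable_real_affine[OF iw, of 1 "shift n"] by (simp add: add.commute)
  have vwk: "(\<integral>x. ?w x \<partial>lborel) = (\<integral>x. (1 + C * r) * ?g1 x + C * \<bar>eta (?g1 x)\<bar> \<partial>lborel)"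
    by (subst (2) lborel_integral_real_affine[of 1 _ "shift n"]) (auto simp: add.commute)
  let ?f = "\<lambda>x. real n * ?gn x"
  have eq: "eta (?f x) = real n * eta (?gn x) - real n * ln (real n) * ?gn x" for x
    using eta_mult[of "real n" "?gn x"] Bn.g_nonneg[of x] by (simp add: eta_def[of "real n"])
  have "real n * (\<integral>x. eta (?gn x) \<partial>lborel) - real n * (1 - measure (P n) Dn) * ln (real n) = (\<integral>x. eta (?f x) \<partial>lborel)"
    unfolding eq qn[symmetric] using en Bn.g_int by simp
  also have "\<bar>\<dots>\<bar> \<le> (\<integral>x. ?w x \<partial>lborel)"
  proof -
    have ief: "integrable lborel (\<lambda>x. eta (?f x))" unfolding eq using en Bn.g_int by auto
    have "\<bar>\<integral>x. eta (?f x) \<partial>lborel\<bar> \<le> (\<integral>x. \<bar>eta (?f x)\<bar> \<partial>lborel)" by (rule integral_abs_bound)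
    also have "\<dots> \<le> (\<integral>x. ?w x \<partial>lborel)"
    proof (rule integral_mono_AE)
      show "integrable lborel (\<lambda>x. \<bar>eta (?f x)\<bar>)" using ief by auto
      show "AE x in lborel. \<bar>eta (?f x)\<bar> \<le> ?w x"
        using le
      proof eventually_elim
        fix x assume "?gn x \<le> C / real n * ?k x"
        then have "?f x \<le> C * ?k x" using n by (simp add: field_simps)
        then have "\<bar>eta (?f x)\<bar> \<le> (1 + C * ln C) * ?k x + C * \<bar>eta (?k x)\<bar>"
          using Bn.g_nonneg B1.g_nonneg C by (intro abs_eta_dominated) auto
        then show "\<bar>eta (?f x)\<bar> \<le> ?w x" by (simp add: C)
      qed
    qed (rule iwk)
    finally show ?thesis .
  qed
  finally show ?thesis using vwk unfolding C_def by (rule ord_le_eq_trans)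
qed

theorem mixed_case:
  assumes D: "dc_split (P 1) D" and HD: "dentropy (cond_law (P 1) D) < \<infinity>"
    and fin1: "\<And>n. n \<ge> 1 \<Longrightarrow> integrable (count_space UNIV) (\<lambda>k. eta (mass 1 (P n) k))"
    and Dn: "\<forall>n\<ge>1. \<exists>Dn. dc_split (P n) Dn \<and> dentropy_wd (cond_law (P n) (UNIV - Dn))"
    and la: "0 < la" and mass_Dn: "\<And>n Dn. n \<ge> 1 \<Longrightarrow> dc_split (P n) Dn \<Longrightarrow> measure (P n) Dn = exp (- (la / real n))"
  shows "\<exists>(mn :: nat \<Rightarrow> nat) (\<zeta> :: nat \<Rightarrow> real) c1 c2. 0 < c1 \<and> c1 \<le> c2 \<and>
            (\<forall>n\<ge>1. c1 * ln (real n) \<le> \<zeta> n \<and> \<zeta> n \<le> c2 * ln (real n)) \<and>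
            (\<forall>\<epsilon>>0. \<forall>\<^sub>F n in sequentially. \<forall>m\<ge>mn n.
               Hq m (P n) < \<infinity> \<and>
               \<bar>real n * enn2real (Hq m (P n)) / (real n * (1 - exp (- (la / real n)))) - ln (real m) - \<zeta> n\<bar> \<le> \<epsilon>)"
proof -
  interpret P1: real_distribution "P 1" by (rule P_dist) simp
  obtain E where E: "\<And>n. n \<ge> 1 \<Longrightarrow> dc_split (P n) (E n)" "\<And>n. n \<ge> 1 \<Longrightarrow> dentropy_wd (cond_law (P n) (UNIV - E n))"
    using Dn by metis
  define q where "q n = 1 - exp (- (la / real n))" for n
  have qE: "1 - measure (P n) (E n) = q n" if "n \<ge> 1" for n using mass_Dn[OF that E(1)[OF that]] by (simp add: q_def)
  have q_pos: "0 < q n" if "n \<ge> 1" for n using la that by (simp add: q_def)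
  \<comment> \<open>A lower bound for \<open>real n * q n\<close> uniform in n:
    \<open>1 - exp (- x) \<ge> x / (1 + x)\<close> at \<open>x = la / n\<close> gives
    \<open>la / (1 + la / n)\<close>, which is smallest at \<open>n = 1\<close>.\<close>
  define \<rho> where "\<rho> = la / (1 + la)"
  have \<rho>: "0 < \<rho>" using la by (simp add: \<rho>_def)
  have nq: "\<rho> \<le> real n * q n" if n: "n \<ge> 1" for n
  proof -
    have "1 + la / real n \<le> exp (la / real n)" by (rule exp_ge_add_one_self)
    then have "exp (- (la / real n)) \<le> 1 / (1 + la / real n)"
      using la n by (simp add: exp_minus field_simps)
    then have "1 - 1 / (1 + la / real n) \<le> q n" by (simp add: q_def)
    moreover have "1 - 1 / (1 + la / real n) = la / (real n + la)"
      using la n by (simp add: field_simps)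
    ultimately have "real n * (la / (real n + la)) \<le> real n * q n" by (intro mult_left_mono) auto
    moreover have "\<rho> \<le> real n * (la / (real n + la))"
    proof -
      have "1 * (la * la) \<le> real n * (la * la)" using n la by (intro mult_right_mono) auto
      then have "la * (real n + la) \<le> real n * la * (1 + la)" by (simp add: algebra_simps)
      then have "la \<le> real n * la * (1 + la) / (real n + la)" using la n by (subst pos_le_divide_eq) auto
      then have "la \<le> real n * (la / (real n + la)) * (1 + la)" by simp
      then show ?thesis unfolding \<rho>_def using la by (subst pos_divide_le_eq) auto
    qed
    ultimately show ?thesis by linarith
  qed
  note fa = P1.dc_split_atom_entropy[OF D HD]
  note ub = atom_entropy_bound[OF fa]
  define h where "h n = (\<integral>x. eta (dens (part (P n) (UNIV - E n)) x) \<partial>lborel)" for n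
  have "\<exists>K3. \<forall>n\<ge>1. \<bar>real n * h n - real n * q n * ln (real n)\<bar> \<le> K3"
  proof (intro exI allI impI)
    fix n :: nat assume n: "1 \<le> n"
    show "\<bar>real n * h n - real n * q n * ln (real n)\<bar> \<le> (\<integral>x. (1 + exp r * r) * dens (part (P 1) (UNIV - E 1)) x
        + exp r * \<bar>eta (dens (part (P 1) (UNIV - E 1)) x)\<bar> \<partial>lborel)"
      using density_entropy_bound[OF E(1)[OF order_refl] E(2)[OF order_refl] n E(1)[OF n] E(2)[OF n]]
      unfolding qE[OF n] h_def .
  qed
  then obtain K3 where K3: "\<And>n. n \<ge> 1 \<Longrightarrow> \<bar>real n * h n - real n * q n * ln (real n)\<bar> \<le> K3" by blast
  have K3_0: "0 \<le> K3" using K3[of 1] by linarith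
  define K2 where "K2 = r + (1 + exp r * r) + exp r * atom_entropy 1"
  have K2_0: "0 \<le> K2" unfolding K2_def using r_pos ub(3)[of 1] by (intro add_nonneg_nonneg mult_nonneg_nonneg) auto
  \<comment> \<open>The limit in m of the normalized entropy minus \<open>ln m\<close>. After
    division by \<open>q n\<close> the density term is \<open>ln n\<close> up to a bounded error,
    and the atom term is nonnegative and at most a multiple of \<open>ln n\<close> plus a
    constant.\<close>
  define z where "z n = (atom_entropy n + h n) / q n" for n
  have zn: "z n = (real n * atom_entropy n + real n * h n) / (real n * q n)" if "n \<ge> 1" for n
    using that by (simp add: z_def flip: distrib_left)
  have "\<exists>\<zeta> c1 c2 N'. 0 < c1 \<and> c1 \<le> c2 \<and> 1 \<le> N' \<and> (\<forall>n\<ge>N'. \<zeta> n = z n) \<and>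
     (\<forall>n\<ge>1. c1 * ln (real n) \<le> \<zeta> n \<and> \<zeta> n \<le> c2 * ln (real n))"
  proof (rule logarithmic_sandwich)
    show "0 < (1::real)" by simp
    fix n :: nat assume n: "1 \<le> n"
    have p: "0 < real n * q n" using q_pos[OF n] n by simp
    have gen: "(Q * L - K) / Q = L - K / Q" "(Q * L + K) / Q = L + K / Q" if "0 < Q" for Q L K :: real
      using that by (simp_all add: diff_divide_distrib add_divide_distrib)
    have lnn: "0 \<le> ln (real n)" using n by simp
    have "real n * q n * ln (real n) - K3 \<le> real n * atom_entropy n + real n * h n"
      using K3[OF n] ub(3)[OF n] mult_nonneg_nonneg[of "real n" "atom_entropy n"] by linarith
    then have "(real n * q n * ln (real n) - K3) / (real n * q n) \<le> z n"
      unfolding zn[OF n] using p by (intro divide_right_mono) auto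
    moreover have "(real n * q n * ln (real n) - K3) / (real n * q n) = ln (real n) - K3 / (real n * q n)"
      by (rule gen(1)[OF p])
    moreover have "K3 / (real n * q n) \<le> K3 / \<rho>" using K3_0 nq[OF n] \<rho> by (intro divide_left_mono) (auto simp: mult_pos_pos q_pos n)
    ultimately show "1 * ln (real n) - K3 / \<rho> \<le> z n" by linarith
    have "real n * atom_entropy n + real n * h n \<le> real n * q n * ln (real n) + (exp r * ln (real n) + K2 + K3)"
      using K3[OF n] ub(2)[OF n] unfolding K2_def by linarith
    then have "z n \<le> (real n * q n * ln (real n) + (exp r * ln (real n) + K2 + K3)) / (real n * q n)"
      unfolding zn[OF n] using p by (intro divide_right_mono) auto
    moreover have "(real n * q n * ln (real n) + (exp r * ln (real n) + K2 + K3)) / (real n * q n) = ln (real n) + (exp r * ln (real n) + K2 + K3) / (real n * q n)"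
      by (rule gen(2)[OF p])
    moreover have "(exp r * ln (real n) + K2 + K3) / (real n * q n) \<le> (exp r * ln (real n) + K2 + K3) / \<rho>"
      using K3_0 K2_0 lnn nq[OF n] \<rho> by (intro divide_left_mono) (auto simp: mult_pos_pos q_pos n)
    moreover have "(exp r * ln (real n) + K2 + K3) / \<rho> = exp r / \<rho> * ln (real n) + (K2 + K3) / \<rho>"
      by (simp add: add_divide_distrib)
    moreover have "(1 + exp r / \<rho>) * ln (real n) = ln (real n) + exp r / \<rho> * ln (real n)" by (simp add: distrib_right)
    ultimately show "z n \<le> (1 + exp r / \<rho>) * ln (real n) + (K2 + K3) / \<rho>" by linarith
  qed
  then obtain \<zeta> c1 c2 N' where \<zeta>: "0 < c1" "c1 \<le> c2" "1 \<le> N'" "\<forall>n\<ge>N'. \<zeta> n = z n"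
     "\<forall>n\<ge>1. c1 * ln (real n) \<le> \<zeta> n \<and> \<zeta> n \<le> c2 * ln (real n)" by blast
  let ?F = "\<lambda>n m. real n * enn2real (Hq m (P n)) / (real n * (1 - exp (- (la / real n)))) - ln (real m) - \<zeta> n"
  have key: "Hq m (P n) < \<infinity>" "?F n \<longlonglongrightarrow> 0" if n: "n \<ge> N'" and m: "m \<ge> 1" for n m
  proof -
    have n1: "n \<ge> 1" using n \<zeta>(3) by simp
    interpret Pn: real_distribution "P n" using n1 by (rule P_dist)
    have le: "measure (P n) UNIV \<le> 1" by simp
    note C = Pn.mixed_quantized_entropy[OF E(1)[OF n1] E(2)[OF n1] ub(1)[OF n1] fin1[OF n1], unfolded qE[OF n1], folded h_def]
    show "Hq m (P n) < \<infinity>" using Pn.Hq_finite_iff[OF m le] C(1)[OF m] by simp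
    have "(\<lambda>m. ((\<integral>k. eta (mass m (P n) k) \<partial>count_space UNIV) - q n * ln (real m)) / q n - \<zeta> n) \<longlonglongrightarrow> (atom_entropy n + h n) / q n - \<zeta> n"
      using q_pos[OF n1] by (intro tendsto_intros C(2)) auto
    moreover have "\<forall>\<^sub>F m in sequentially. ((\<integral>k. eta (mass m (P n) k) \<partial>count_space UNIV) - q n * ln (real m)) / q n - \<zeta> n = ?F n m"
      using q_pos[OF n1] n1 le
      by (intro eventually_sequentiallyI[of 1]) (simp add: Pn.enn2real_Hq diff_divide_distrib flip: q_def)
    ultimately have "?F n \<longlonglongrightarrow> (atom_entropy n + h n) / q n - \<zeta> n"
      by (rule Lim_transform_eventually)
    then show "?F n \<longlonglongrightarrow> 0" using \<zeta>(4) n by (simp add: z_def)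
  qed
  have "\<exists>mn :: nat \<Rightarrow> nat. \<forall>\<epsilon>>0. \<forall>\<^sub>F n in sequentially. \<forall>m\<ge>mn n. Hq m (P n) < \<infinity> \<and> \<bar>?F n m\<bar> \<le> \<epsilon>"
    by (rule choose_resolution[where N=N']) (rule key(2)[OF _ order_refl] key(1), assumption+)+
  then show ?thesis using \<zeta> by blast
qed

end

section \<open>Levy exponents with a finite Levy measure\<close>

text \<open>Written as a density, so that integrals of characters transfer by the density
  rule.\<close>

definition normalize_law :: "real measure \<Rightarrow> real measure" where
  "normalize_law M = density M (\<lambda>_. ennreal (1 / measure M UNIV))"

context finite_borel_measure
begin

lemma emeasure_normalize:
  "S \<in> sets borel \<Longrightarrow> emeasure (normalize_law M) S = ennreal (measure M S / measure M UNIV)"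
  unfolding normalize_law_def
  by (subst emeasure_density) (auto simp: M_is_borel nn_integral_cmult_indicator emeasure_eq_measure ennreal_mult[symmetric])

lemma measure_normalize:
  "S \<in> sets borel \<Longrightarrow> measure (normalize_law M) S = measure M S / measure M UNIV"
  by (simp add: measure_def[of "normalize_law M"] emeasure_normalize)

lemma real_distribution_normalize:
  assumes "0 < measure M UNIV"
  shows "real_distribution (normalize_law M)"
  unfolding real_distribution_def real_distribution_axioms_def
proof
  show s: "sets (normalize_law M) = sets borel" by (simp add: normalize_law_def M_is_borel)
  have "space (normalize_law M) = UNIV" by (simp add: normalize_law_def)
  then show "prob_space (normalize_law M)"
    using assms by (intro prob_spaceI) (simp add: emeasure_normalize)
qed

lemma integrable_iexp_finite: "integrable M (\<lambda>x. iexp (t * x))"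
  by (rule integrable_const_bound[where B=1]) (auto simp: M_is_borel cong: measurable_cong_sets)

lemma char_normalize:
  assumes "0 < measure M UNIV"
  shows "complex_of_real (measure M UNIV) * char (normalize_law M) t = (\<integral>x. iexp (t * x) \<partial>M)"
proof -
  note [measurable_cong] = M_is_borel
  have "char (normalize_law M) t = (\<integral>x. (1 / measure M UNIV) *\<^sub>R iexp (t * x) \<partial>M)"
    unfolding char_def normalize_law_def by (subst integral_density) auto
  then show ?thesis using assms by (simp add: scaleR_conv_of_real)
qed

text \<open>For a finite Levy measure the compensating term is integrable on its own and moves into
  the drift; what remains besides the Gaussian part is the exponent of a compound Poisson
  law.\<close>

lemma levy_exponent_finite:
  assumes "0 < measure M UNIV"
  shows "levy_exponent \<mu> \<sigma> M t = - complex_of_real (\<sigma>\<^sup>2 / 2 * t\<^sup>2)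
    + \<i> * complex_of_real (t * (\<mu> - (\<integral>a. a * indicator {-1<..<1} a \<partial>M)))
    + complex_of_real (measure M UNIV) * (char (normalize_law M) t - 1)"
proof -
  note [measurable_cong] = M_is_borel
  let ?j = "\<lambda>a. a * indicator {-1<..<1} a :: real"
  have ij: "integrable M ?j"
    by (rule integrable_const_bound[where B=1]) (auto simp: indicator_def)
  have ic: "integrable M (\<lambda>a. \<i> * complex_of_real (t * a * indicator {-1<..<1} a))"
  proof -
    have "integrable M (\<lambda>a. \<i> * complex_of_real (t * ?j a))"
      by (intro integrable_mult_right integrable_of_real ij)
    then show ?thesis by (simp only: mult.assoc)
  qed
  have "(\<integral>a. iexp (t * a) - 1 - \<i> * complex_of_real (t * a * indicator {-1<..<1} a) \<partial>M)
     = (\<integral>a. iexp (t * a) \<partial>M) - (\<integral>a. 1 \<partial>M) - (\<integral>a. \<i> * complex_of_real (t * a * indicator {-1<..<1} a) \<partial>M)"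
    using integrable_iexp_finite[of t] ic
    by (subst Bochner_Integration.integral_diff) (auto intro!: Bochner_Integration.integrable_diff Bochner_Integration.integral_diff)
  also have "(\<integral>a. \<i> * complex_of_real (t * a * indicator {-1<..<1} a) \<partial>M) = \<i> * complex_of_real (t * (\<integral>a. ?j a \<partial>M))"
  proof -
    have "(\<integral>a. \<i> * complex_of_real (t * a * indicator {-1<..<1} a) \<partial>M) = \<i> * (\<integral>a. complex_of_real (t * ?j a) \<partial>M)"
      by (simp add: mult.assoc)
    also have "(\<integral>a. complex_of_real (t * ?j a) \<partial>M) = complex_of_real (\<integral>a. t * ?j a \<partial>M)"
      by (rule integral_of_real) (intro integrable_mult_right ij)
    finally show ?thesis by simp
  qed
  also have "(\<integral>a. (1::complex) \<partial>M) = complex_of_real (measure M UNIV)" by (simp add: scaleR_conv_of_real)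
  finally show ?thesis unfolding levy_exponent_def char_normalize[OF assms, symmetric]
    by (simp add: algebra_simps)
qed

end

lemma gaussian_factor:
  assumes s: "s \<noteq> 0"
  shows "\<exists>G. real_distribution G \<and> absolutely_continuous lborel G \<and> (\<forall>t. char G t = exp (- complex_of_real (s\<^sup>2 / 2 * t\<^sup>2)))"
proof (intro exI conjI allI)
  interpret N: real_distribution std_normal_distribution by (rule real_dist_normal_dist)
  let ?G = "distr std_normal_distribution borel (\<lambda>x. s * x)"
  show "real_distribution ?G" by (rule N.real_distribution_distr) simp
  show "absolutely_continuous lborel ?G"
    unfolding absolutely_continuous_def
  proof
    fix S :: "real set" assume S: "S \<in> null_sets lborel"
    have [measurable]: "S \<in> sets borel" using S by auto
    have "AE x in lborel. x \<notin> S" using S by (rule AE_not_in)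
    then have "AE x in lborel. 0 + s * x \<notin> S" using s by (intro AE_borel_affine) auto
    then have "AE x in std_normal_distribution. s * x \<notin> S"
      by (subst AE_density) (auto elim!: eventually_mono)
    then have "AE x in ?G. x \<notin> S" by (subst AE_distr_iff) auto
    then show "S \<in> null_sets ?G" by (subst (asm) AE_iff_null_sets[symmetric]) auto
  qed
  fix t
  have "char ?G t = char std_normal_distribution (s * t)"
    unfolding char_def by (subst integral_distr) (auto simp: mult_ac)
  also have "\<dots> = complex_of_real (exp (- (s\<^sup>2 / 2 * t\<^sup>2)))"
    unfolding char_std_normal_distribution by (simp add: power_mult_distrib)
  also have "\<dots> = exp (complex_of_real (- (s\<^sup>2 / 2 * t\<^sup>2)))" by (rule exp_of_real[symmetric])
  finally show "char ?G t = exp (- complex_of_real (s\<^sup>2 / 2 * t\<^sup>2))" by (simp only: of_real_minus)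
qed

locale finite_levy = finite_borel_measure \<nu> for \<nu> :: "real measure" +
  fixes \<mu> \<sigma> :: real and P :: "nat \<Rightarrow> real measure"
  assumes mass_pos: "0 < measure \<nu> UNIV" and zero_atom: "measure \<nu> {0} = 0"
    and laws: "\<forall>n\<ge>1. real_distribution (P n) \<and>
                 char (P n) = (\<lambda>\<omega>. exp (levy_exponent \<mu> \<sigma> \<nu> \<omega> / of_nat n))"
begin

abbreviation rate :: real where "rate \<equiv> measure \<nu> UNIV"
abbreviation jump :: "real measure" where "jump \<equiv> normalize_law \<nu>"
definition drift :: real where "drift = \<mu> - (\<integral>a. a * indicator {-1<..<1} a \<partial>\<nu>)"

lemma jump_dist: "real_distribution jump"
  using mass_pos by (rule real_distribution_normalize)

lemma char_P: "n \<ge> 1 \<Longrightarrow> char (P n) t = exp ((- complex_of_real (\<sigma>\<^sup>2 / 2 * t\<^sup>2)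
    + \<i> * complex_of_real (t * drift) + complex_of_real rate * (char jump t - 1)) / of_nat n)"
  using laws by (simp add: levy_exponent_finite[OF mass_pos] drift_def)

text \<open>A nonzero \<open>\<sigma>\<close> splits off a Gaussian factor, and convolution with an
  absolutely continuous law is absolutely continuous.\<close>

lemma sigma_zero:
  assumes "\<not> absolutely_continuous lborel (P 1)"
  shows "\<sigma> = 0"
proof (rule ccontr)
  assume "\<sigma> \<noteq> 0"
  then obtain G where G: "real_distribution G" "absolutely_continuous lborel G"
    "\<And>t. char G t = exp (- complex_of_real (\<sigma>\<^sup>2 / 2 * t\<^sup>2))" using gaussian_factor by blast
  let ?R = "return borel drift \<star> cpois rate jump"
  have R: "real_distribution ?R"
    by (intro real_distribution_convolution real_distribution_return real_distribution_cpois jump_dist) simp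
  have "P 1 = (?R \<star> G)"
  proof (rule convolution_eqI_char[OF R G(1)])
    show "real_distribution (P 1)" using laws by simp
    fix t
    show "char (P 1) t = char ?R t * char G t"
      using char_P[of 1 t] by (simp add: char_convolution real_distribution_return real_distribution_cpois jump_dist
          char_return char_cpois G(3) exp_add[symmetric] algebra_simps)
  qed
  then show False using absolutely_continuous_convolution[OF R G(1,2)] assms by simp
qed

lemma P_compound:
  assumes "\<sigma> = 0" and n: "n \<ge> 1"
  shows "P n = (return borel (drift / real n) \<star> cpois (rate / real n) jump)"
proof (rule convolution_eqI_char)
  fix t
  show "char (P n) t = char (return borel (drift / real n)) t * char (cpois (rate / real n) jump) t"
    using char_P[OF n, of t] n assms(1)
    by (simp add: char_return char_cpois jump_dist exp_add[symmetric] add_divide_distrib)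
qed (use laws n in \<open>auto intro!: real_distribution_return real_distribution_cpois jump_dist\<close>)

lemma cp_family:
  assumes "\<sigma> = 0"
  shows "cp_family P rate drift jump"
  by (intro cp_family.intro mass_pos jump_dist P_compound[OF assms]) (simp_all add: measure_normalize zero_atom)

end

section \<open>Mass of the atoms under a split of the Levy measure\<close>

lemma not_ac_if_countable_mass:
  assumes "countable D" "measure M D > 0"
  shows "\<not> absolutely_continuous lborel M"
proof
  assume "absolutely_continuous lborel M"
  moreover have "D \<in> null_sets lborel" using assms(1) by (rule countable_imp_null_set_lborel)
  ultimately have "emeasure M D = 0" by (auto simp: absolutely_continuous_def)
  then show False using assms(2) by (simp add: measure_def)
qed

text \<open>The split set D is arbitrary, so its mass cannot be read off from a construction. On the
  countable set \<open>D \<union> U\<close>, with U carrying drift and discrete jumps, only the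
  event without continuous jumps contributes, which gives \<open>exp (- ra)\<close>; the points of U
  outside D carry no mass by \<open>dc_split_null\<close>.\<close>

lemma discrete_part_mass:
  assumes Ad: "real_distribution Ad" "countable S" "measure Ad S = 1"
    and Aa: "real_distribution Aa" "absolutely_continuous lborel Aa"
    and r: "0 \<le> rd" "0 \<le> ra"
    and M: "M = ((return borel c \<star> cpois rd Ad) \<star> cpois ra Aa)"
    and D: "dc_split M D"
  shows "measure M D = exp (- ra)"
proof -
  let ?K = "return borel c \<star> cpois rd Ad"
  have cK: "real_distribution (cpois rd Ad)" using Ad(1) r(1) by (rule real_distribution_cpois)
  have K: "real_distribution ?K" by (intro real_distribution_convolution real_distribution_return cK)
  have L: "real_distribution (cpois ra Aa)" using Aa(1) r(2) by (rule real_distribution_cpois)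
  interpret K: real_distribution ?K by (rule K)
  interpret M: real_distribution M unfolding M by (intro real_distribution_convolution K L)
  obtain V where V: "countable V" "measure (cpois rd Ad) V = 1"
    using countable_support_cpois[OF Ad(1) r(1) Ad(2,3)] by auto
  obtain U where U: "countable U" "measure ?K U = 1"
    using countable_support_convolution[OF real_distribution_return[of c] cK, of "{c}" V] V by (auto simp: measure_return)
  let ?T = "D \<union> U"
  have T: "countable ?T" using U(1) D by (auto simp: dc_split_def)
  have Ts: "?T \<in> sets borel" using T by (rule countable_in_borel)
  have "emeasure M ?T = (\<integral>\<^sup>+x. emeasure (cpois ra Aa) {a. a + x \<in> ?T} \<partial>?K)"
    unfolding M by (rule emeasure_convolution_translate[OF K L Ts])
  also have "\<dots> = (\<integral>\<^sup>+x. ennreal (exp (- ra)) * indicator ?T x \<partial>?K)"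
  proof (rule nn_integral_cong)
    fix x
    have "{a. a + x \<in> ?T} \<in> null_sets lborel"
      using countable_imp_null_set_lborel[OF T] by (rule null_sets_lborel_translate)
    from cpois_null_set[OF Aa(1) r(2) Aa(2) this]
    show "emeasure (cpois ra Aa) {a. a + x \<in> ?T} = ennreal (exp (- ra)) * indicator ?T x"
      by (simp add: indicator_def)
  qed
  also have "\<dots> = ennreal (exp (- ra)) * emeasure ?K ?T"
    using Ts by (intro nn_integral_cmult_indicator) simp
  also have "emeasure ?K ?T = 1"
  proof -
    have "1 \<le> measure ?K ?T" unfolding U(2)[symmetric] using Ts by (intro K.finite_measure_mono) auto
    then have "measure ?K ?T = 1" using K.prob_le_1 by (intro antisym)
    then show ?thesis by (simp add: K.emeasure_eq_measure)
  qed
  finally have 1: "measure M ?T = exp (- ra)" by (simp add: measure_def)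
  have UD: "countable (U - D)" using U(1) by auto
  have "measure M (U - D) = 0"
    by (rule M.dc_split_null[OF D countable_imp_null_set_lborel[OF UD]]) auto
  moreover have "measure M (D \<union> (U - D)) = measure M D + measure M (U - D)"
    using M.dc_split_sets[OF D] countable_in_borel[OF UD] by (intro M.finite_measure_Union) auto
  moreover have "D \<union> (U - D) = ?T" by auto
  ultimately show ?thesis using 1 by simp
qed

lemma finite_borel_if_finite_off_zero:
  assumes "sets M = sets borel" "emeasure M {0} = 0" "emeasure M (UNIV - {0}) < \<infinity>"
  shows "finite_borel_measure M" "measure M UNIV = measure M (UNIV - {0})" "measure M {0} = 0"
proof -
  have sp: "space M = UNIV" using assms(1) sets_eq_imp_space_eq by force
  have "emeasure M UNIV = emeasure M {0} + emeasure M (UNIV - {0})"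
    using assms(1) by (subst plus_emeasure) (auto intro!: arg_cong[where f="emeasure M"])
  then have e: "emeasure M UNIV = emeasure M (UNIV - {0})" using assms(2) by simp
  then show "measure M UNIV = measure M (UNIV - {0})" by (simp add: measure_def)
  show "measure M {0} = 0" using assms(2) by (simp add: measure_def)
  show "finite_borel_measure M"
    using assms e sp by (intro finite_borel_measure.intro finite_measureI finite_borel_measure_axioms.intro) auto
qed

locale decomposed_levy = finite_levy \<nu> \<mu> \<sigma> P for \<nu> \<mu> \<sigma> P +
  fixes \<nu>d \<nu>ac \<nu>cs :: "real measure" and S :: "real set"
  assumes sets_d: "sets \<nu>d = sets borel" and sets_ac: "sets \<nu>ac = sets borel"
    and sets_cs: "sets \<nu>cs = sets borel"
    and decomp: "\<forall>A\<in>sets borel. emeasure \<nu> A = emeasure \<nu>d A + emeasure \<nu>ac A + emeasure \<nu>cs A"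
    and S: "countable S" "emeasure \<nu>d (UNIV - S) = 0"
    and ac_ac: "absolutely_continuous lborel \<nu>ac"
    and cs_zero: "emeasure \<nu>cs UNIV = 0"
    and ac_pos: "emeasure \<nu>ac UNIV > 0" and no_gauss: "\<sigma> = 0"
begin

lemma emeasure_cs: "A \<in> sets borel \<Longrightarrow> emeasure \<nu>cs A = 0"
  using emeasure_mono[of A UNIV \<nu>cs] cs_zero sets_cs by simp

lemma S_sets: "S \<in> sets borel" using S(1) by (rule countable_in_borel)

text \<open>The countable set \<open>S\<close> separates the two parts: it is null for
  \<open>\<nu>ac\<close>, its complement is null for \<open>\<nu>d\<close>, and
  \<open>\<nu>cs\<close> vanishes. Writing the parts as densities with respect to
  \<open>\<nu>\<close> reduces the splitting of Fourier integrals to linearity.\<close>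

lemma d_eq: "\<nu>d = density \<nu> (\<lambda>x. ennreal (indicator S x))"
proof (rule measure_eqI)
  show "sets \<nu>d = sets (density \<nu> (\<lambda>x. ennreal (indicator S x)))" by (simp add: sets_d M_is_borel)
  fix A assume "A \<in> sets \<nu>d"
  then have A: "A \<in> sets borel" by (simp add: sets_d)
  have AS: "A \<inter> S \<in> sets borel" using A S_sets by auto
  have "A \<inter> S \<in> null_sets lborel" using S(1) by (intro countable_imp_null_set_lborel) auto
  then have z: "emeasure \<nu>ac (A \<inter> S) = 0" using ac_ac by (auto simp: absolutely_continuous_def)
  have "UNIV - S \<in> null_sets \<nu>d" using S(2) S_sets sets_d by (intro null_setsI) auto
  then have "A - S \<in> null_sets \<nu>d" using A S_sets sets_d by (intro null_sets_subset[of "UNIV - S" \<nu>d "A - S"]) auto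
  then have "emeasure \<nu>d A = emeasure \<nu>d (A - (A - S))"
    using A sets_d by (intro emeasure_Diff_null_set[symmetric]) auto
  also have "A - (A - S) = A \<inter> S" by auto
  also have "emeasure \<nu>d (A \<inter> S) = emeasure \<nu> (A \<inter> S)"
    using decomp[rule_format, OF AS] z emeasure_cs[OF AS] by simp
  also have "\<dots> = (\<integral>\<^sup>+x. indicator (A \<inter> S) x \<partial>\<nu>)" using AS by (simp add: M_is_borel)
  also have "\<dots> = (\<integral>\<^sup>+x. ennreal (indicator S x) * indicator A x \<partial>\<nu>)"
    by (intro nn_integral_cong) (auto simp: indicator_def)
  also have "\<dots> = emeasure (density \<nu> (\<lambda>x. ennreal (indicator S x))) A"
    using A S_sets by (subst emeasure_density) (auto simp: M_is_borel cong: measurable_cong_sets)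
  finally show "emeasure \<nu>d A = emeasure (density \<nu> (\<lambda>x. ennreal (indicator S x))) A" .
qed

lemma ac_eq: "\<nu>ac = density \<nu> (\<lambda>x. ennreal (indicator (UNIV - S) x))"
proof (rule measure_eqI)
  show "sets \<nu>ac = sets (density \<nu> (\<lambda>x. ennreal (indicator (UNIV - S) x)))" by (simp add: sets_ac M_is_borel)
  fix A assume "A \<in> sets \<nu>ac"
  then have A: "A \<in> sets borel" by (simp add: sets_ac)
  have AS: "A - S \<in> sets borel" using A S_sets by auto
  have "emeasure \<nu>d (A - S) \<le> emeasure \<nu>d (UNIV - S)" using A S_sets sets_d by (intro emeasure_mono) auto
  then have z: "emeasure \<nu>d (A - S) = 0" using S(2) by simp
  have "A \<inter> S \<in> null_sets lborel" using S(1) by (intro countable_imp_null_set_lborel) auto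
  then have "A \<inter> S \<in> null_sets \<nu>ac" using ac_ac by (auto simp: absolutely_continuous_def)
  then have "emeasure \<nu>ac A = emeasure \<nu>ac (A - (A \<inter> S))"
    using A sets_ac by (intro emeasure_Diff_null_set[symmetric]) auto
  also have "A - (A \<inter> S) = A - S" by auto
  also have "emeasure \<nu>ac (A - S) = emeasure \<nu> (A - S)"
    using decomp[rule_format, OF AS] z emeasure_cs[OF AS] by simp
  also have "\<dots> = (\<integral>\<^sup>+x. indicator (A - S) x \<partial>\<nu>)" using AS by (simp add: M_is_borel)
  also have "\<dots> = (\<integral>\<^sup>+x. ennreal (indicator (UNIV - S) x) * indicator A x \<partial>\<nu>)"
    by (intro nn_integral_cong) (auto simp: indicator_def)
  also have "\<dots> = emeasure (density \<nu> (\<lambda>x. ennreal (indicator (UNIV - S) x))) A"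
    using A S_sets by (subst emeasure_density) (auto simp: M_is_borel cong: measurable_cong_sets)
  finally show "emeasure \<nu>ac A = emeasure (density \<nu> (\<lambda>x. ennreal (indicator (UNIV - S) x))) A" .
qed

lemma rate_eq: "rate = measure \<nu>d UNIV + measure \<nu>ac UNIV"
  and finite_d: "finite_borel_measure \<nu>d" and finite_ac: "finite_borel_measure \<nu>ac"
proof -
  have e: "emeasure \<nu> UNIV = emeasure \<nu>d UNIV + emeasure \<nu>ac UNIV" using decomp cs_zero by simp
  have "emeasure \<nu> UNIV < \<infinity>" by (simp add: emeasure_eq_measure)
  then have lt: "emeasure \<nu>d UNIV < \<infinity>" "emeasure \<nu>ac UNIV < \<infinity>" unfolding e by auto
  then show "rate = measure \<nu>d UNIV + measure \<nu>ac UNIV" using e by (simp add: measure_def enn2real_plus)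
  have "space \<nu>d = UNIV" "space \<nu>ac = UNIV" using sets_eq_imp_space_eq[OF sets_d] sets_eq_imp_space_eq[OF sets_ac] by simp_all
  then show "finite_borel_measure \<nu>d" "finite_borel_measure \<nu>ac"
    using lt sets_d sets_ac
    by (simp_all add: finite_borel_measure_def finite_borel_measure_axioms_def finite_measureI)
qed

lemma char_split:
  "(\<integral>x. iexp (t * x) \<partial>\<nu>) = (\<integral>x. iexp (t * x) \<partial>\<nu>d) + (\<integral>x. iexp (t * x) \<partial>\<nu>ac)"
proof -
  note [measurable_cong] = M_is_borel
  note [measurable] = S_sets
  have i: "integrable \<nu> (\<lambda>x. indicator A x *\<^sub>R iexp (t * x))" if "A \<in> sets borel" for A
    using integrable_mult_indicator[OF _ integrable_iexp_finite, of A t] that by (simp add: M_is_borel)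
  have S': "UNIV - S \<in> sets borel" by simp
  have "(\<integral>x. iexp (t * x) \<partial>\<nu>) = (\<integral>x. indicator S x *\<^sub>R iexp (t * x) + indicator (UNIV - S) x *\<^sub>R iexp (t * x) \<partial>\<nu>)"
    by (intro Bochner_Integration.integral_cong) (auto simp: indicator_def)
  also have "\<dots> = (\<integral>x. indicator S x *\<^sub>R iexp (t * x) \<partial>\<nu>) + (\<integral>x. indicator (UNIV - S) x *\<^sub>R iexp (t * x) \<partial>\<nu>)"
    by (rule Bochner_Integration.integral_add[OF i[OF S_sets] i[OF S']])
  also have "(\<integral>x. indicator S x *\<^sub>R iexp (t * x) \<partial>\<nu>) = (\<integral>x. iexp (t * x) \<partial>\<nu>d)"
    unfolding d_eq by (subst integral_density) auto
  also have "(\<integral>x. indicator (UNIV - S) x *\<^sub>R iexp (t * x) \<partial>\<nu>) = (\<integral>x. iexp (t * x) \<partial>\<nu>ac)"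
    unfolding ac_eq by (subst integral_density) auto
  finally show ?thesis .
qed

lemma atom_mass_P:
  assumes n: "n \<ge> 1" and Dn: "dc_split (P n) Dn"
  shows "measure (P n) Dn = exp (- (measure \<nu>ac UNIV / real n))"
proof -
  interpret d: finite_borel_measure \<nu>d by (rule finite_d)
  interpret ac: finite_borel_measure \<nu>ac by (rule finite_ac)
  define ld la where "ld = measure \<nu>d UNIV" and "la = measure \<nu>ac UNIV"
  have la: "0 < la" using ac_pos by (simp add: la_def ac.emeasure_eq_measure)
  \<comment> \<open>If the discrete part has no mass, any law may stand in, as it enters with rate
    0.\<close>
  define Ad where "Ad = (if ld = 0 then return borel 0 else normalize_law \<nu>d)"
  let ?Aa = "normalize_law \<nu>ac"
  have ld0: "0 \<le> ld" by (simp add: ld_def)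
  have Aa: "real_distribution ?Aa" using la unfolding la_def by (rule ac.real_distribution_normalize)
  have Aa_ac: "absolutely_continuous lborel ?Aa"
    unfolding absolutely_continuous_def
  proof
    fix N :: "real set" assume N: "N \<in> null_sets lborel"
    then have "emeasure \<nu>ac N = 0" using ac_ac by (auto simp: absolutely_continuous_def)
    moreover have Ns: "N \<in> sets borel" using N by auto
    ultimately have "emeasure ?Aa N = 0" by (simp add: ac.emeasure_normalize measure_def)
    then show "N \<in> null_sets ?Aa" using Ns by (intro null_setsI) (auto simp: normalize_law_def sets_ac)
  qed
  have Ad: "real_distribution Ad" using d.real_distribution_normalize
    by (cases "ld = 0") (auto simp: Ad_def ld_def real_distribution_return less_le)
  have Ad_supp: "\<exists>T. countable T \<and> measure Ad T = 1"
  proof (cases "ld = 0")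
    case True
    then show ?thesis by (intro exI[of _ "{0}"]) (simp add: Ad_def measure_return)
  next
    case False
    have "measure \<nu>d S = measure \<nu>d UNIV"
      using d.finite_measure_compl[of S] S(2) S_sets sets_d by (simp add: measure_def)
    then show ?thesis using False S(1) S_sets
      by (intro exI[of _ S]) (simp add: Ad_def d.measure_normalize ld_def)
  qed
  have char_d: "complex_of_real ld * char Ad t = (\<integral>x. iexp (t * x) \<partial>\<nu>d)" for t
  proof (cases "ld = 0")
    case True
    then have "emeasure \<nu>d UNIV = 0" by (simp add: ld_def d.emeasure_eq_measure)
    then have "AE x in \<nu>d. False" by (intro AE_I[of _ _ UNIV]) (auto simp: sets_d)
    then have "(\<integral>x. iexp (t * x) \<partial>\<nu>d) = 0"
      by (intro integral_eq_zero_AE) (auto elim: eventually_mono)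
    then show ?thesis using True by simp
  next
    case False
    then show ?thesis using d.char_normalize[of t] by (simp add: Ad_def ld_def less_le)
  qed
  have char_a: "complex_of_real la * char ?Aa t = (\<integral>x. iexp (t * x) \<partial>\<nu>ac)" for t
    using ac.char_normalize[of t] la by (simp add: la_def)
  have eq: "complex_of_real rate * (char jump t - 1) = complex_of_real ld * (char Ad t - 1) + complex_of_real la * (char ?Aa t - 1)" for t
  proof -
    have "complex_of_real rate * char jump t = complex_of_real ld * char Ad t + complex_of_real la * char ?Aa t"
      unfolding char_normalize[OF mass_pos] char_split char_d char_a ..
    moreover have "complex_of_real rate = complex_of_real ld + complex_of_real la"
      by (simp add: rate_eq ld_def la_def)
    ultimately show ?thesis by (simp add: algebra_simps)
  qed
  let ?K = "return borel (drift / real n) \<star> cpois (ld / real n) Ad"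
  have rd: "0 \<le> ld / real n" "0 \<le> la / real n" using ld0 la by auto
  have K: "real_distribution ?K"
    by (intro real_distribution_convolution real_distribution_return real_distribution_cpois Ad rd)
  have L: "real_distribution (cpois (la / real n) ?Aa)" by (intro real_distribution_cpois Aa rd)
  have Pn: "P n = (?K \<star> cpois (la / real n) ?Aa)"
  proof (rule convolution_eqI_char[OF K L])
    show "real_distribution (P n)" using laws n by simp
    fix t
    have "char (P n) t = exp ((\<i> * complex_of_real (t * drift) + (complex_of_real ld * (char Ad t - 1) + complex_of_real la * (char ?Aa t - 1))) / of_nat n)"
      unfolding char_P[OF n] eq using no_gauss by simp
    also have "\<dots> = exp (\<i> * complex_of_real (t * (drift / real n)) + complex_of_real (ld / real n) * (char Ad t - 1) + complex_of_real (la / real n) * (char ?Aa t - 1))"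
      by (simp add: add_divide_distrib add.assoc)
    also have "\<dots> = char ?K t * char (cpois (la / real n) ?Aa) t"
      by (simp only: exp_add char_convolution[OF real_distribution_return real_distribution_cpois[OF Ad rd(1)]]
          char_return char_cpois[OF Ad rd(1)] char_cpois[OF Aa rd(2)])
    finally show "char (P n) t = char ?K t * char (cpois (la / real n) ?Aa) t" .
  qed
  from Ad_supp obtain T where "countable T" "measure Ad T = 1" by auto
  from discrete_part_mass[OF Ad this Aa Aa_ac rd Pn Dn] show ?thesis by (simp add: la_def)
qed

end

text \<open>The null set N carrying \<open>\<nu>cs\<close>, translated by the drift and deprived of
  D, is null for \<open>P 1\<close>; by the one-jump term its preimage is null for the jump law,
  hence for \<open>\<nu>cs\<close>. What is left of N is countable, and \<open>\<nu>cs\<close> has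
  no atoms.\<close>

lemma (in finite_levy) singular_part_zero:
  assumes no_gauss: "\<sigma> = 0" and D: "dc_split (P 1) D"
    and sets_cs: "sets \<nu>cs = sets borel"
    and le: "\<And>A. A \<in> sets borel \<Longrightarrow> emeasure \<nu>cs A \<le> emeasure \<nu> A"
    and cs_noatom: "\<forall>x. emeasure \<nu>cs {x} = 0"
    and N: "N \<in> null_sets lborel" "emeasure \<nu>cs (UNIV - N) = 0"
  shows "emeasure \<nu>cs UNIV = 0"
proof -
  interpret cp: cp_family P rate drift jump using no_gauss by (rule cp_family)
  interpret P1: real_distribution "P 1" by (rule cp.P_dist) simp
  have Ns: "N \<in> sets borel" using N by auto
  have Ds: "D \<in> sets borel" "countable D" using P1.dc_split_sets[OF D] D by (auto simp: dc_split_def)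
  let ?S = "{y. y + (- drift) \<in> N} - D"
  have Sn: "?S \<in> null_sets lborel"
    using null_sets_lborel_translate[OF N(1), of "- drift"] Ds by (intro null_set_Diff) auto
  have Ss: "?S \<in> sets borel" using Sn by auto
  have "measure (P 1) ?S = 0" using P1.dc_split_null[OF D Sn] by auto
  then have "rate * exp (- rate) * measure jump {x. x + drift \<in> ?S} \<le> 0"
    using cp.jump_law_le[OF Ss] by simp
  then have "measure jump {x. x + drift \<in> ?S} = 0"
    using mass_pos by (simp add: mult_le_0_iff measure_le_0_iff not_le)
  moreover have Xs: "{x. x + drift \<in> ?S} \<in> sets borel" using Ss by measurable
  ultimately have "measure \<nu> {x. x + drift \<in> ?S} = 0"
    using mass_pos by (simp add: measure_normalize)
  then have X: "emeasure \<nu>cs {x. x + drift \<in> ?S} = 0"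
    using le[OF Xs] by (simp add: emeasure_eq_measure)
  let ?Y = "(\<lambda>x. x - drift) ` D"
  have Y: "countable ?Y" using Ds by auto
  have "emeasure \<nu>cs ?Y = (\<integral>\<^sup>+x. emeasure \<nu>cs {x} \<partial>count_space ?Y)"
    using Y sets_cs by (intro emeasure_countable_singleton) auto
  then have Y0: "emeasure \<nu>cs ?Y = 0" using cs_noatom by simp
  have Ys: "?Y \<in> sets borel" using Y by (rule countable_in_borel)
  have "UNIV \<subseteq> (UNIV - N) \<union> {x. x + drift \<in> ?S} \<union> ?Y"
  proof
    fix x
    have "x \<in> ?Y" if "x + drift \<in> D" using that by (intro image_eqI[of _ _ "x + drift"]) auto
    then show "x \<in> (UNIV - N) \<union> {x. x + drift \<in> ?S} \<union> ?Y" by auto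
  qed
  then have U: "(UNIV - N) \<union> {x. x + drift \<in> ?S} \<union> ?Y = UNIV" by auto
  have "(UNIV - N) \<union> {x. x + drift \<in> ?S} \<union> ?Y \<in> null_sets \<nu>cs"
    using N X Y0 Ns Xs Ys sets_cs by (intro null_sets.Un null_setsI) auto
  then show ?thesis unfolding U by auto
qed

section \<open>Discrete, mixed and continuous laws of a Levy noise\<close>

theorem mainTheorem2:
  fixes \<mu> \<sigma> :: real
    and \<nu> \<nu>d \<nu>ac \<nu>cs :: "real measure"
    and P :: "nat \<Rightarrow> real measure"
  assumes trip: "levy_triplet \<mu> \<sigma> \<nu>"
    and sets_d: "sets \<nu>d = sets borel" and sets_ac: "sets \<nu>ac = sets borel"
    and sets_cs: "sets \<nu>cs = sets borel"
    and decomp: "\<forall>A\<in>sets borel. emeasure \<nu> A = emeasure \<nu>d A + emeasure \<nu>ac A + emeasure \<nu>cs A"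
    and disc_d: "discrete_law \<nu>d"
    and ac_ac: "absolutely_continuous lborel \<nu>ac"
    and cs_noatom: "\<forall>x. emeasure \<nu>cs {x} = 0"
    and cs_sing: "\<exists>N\<in>null_sets lborel. emeasure \<nu>cs (UNIV - N) = 0"
    and laws: "\<forall>n\<ge>1. real_distribution (P n) \<and>
                 char (P n) = (\<lambda>\<omega>. exp (levy_exponent \<mu> \<sigma> \<nu> \<omega> / of_nat n))"
  shows
   "(discrete_law (P 1) \<and> dentropy (P 1) < \<infinity> \<and>
       0 < emeasure \<nu> (UNIV - {0}) \<and> emeasure \<nu> (UNIV - {0}) < \<infinity> \<and>
       dentropy (scale_measure (ennreal (1 / measure \<nu> (UNIV - {0}))) \<nu>) < \<infinity>
     \<longrightarrow> (\<exists>(mn :: nat \<Rightarrow> nat) (\<zeta> :: nat \<Rightarrow> real) c1 c2. 0 < c1 \<and> c1 \<le> c2 \<and>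
            (\<forall>n\<ge>1. c1 * ln (real n) \<le> \<zeta> n \<and> \<zeta> n \<le> c2 * ln (real n)) \<and>
            (\<forall>\<epsilon>>0. \<forall>\<^sub>F n in sequentially. \<forall>m\<ge>mn n.
               Hq m (P n) < \<infinity> \<and>
               \<bar>real n * enn2real (Hq m (P n)) - \<zeta> n\<bar> \<le> \<epsilon>)))
  \<and>
   (\<forall>D. dc_split (P 1) D \<and>
       0 < emeasure \<nu> (UNIV - {0}) \<and> emeasure \<nu> (UNIV - {0}) < \<infinity> \<and>
       Hq 1 (P 1) < \<infinity> \<and>
       (\<forall>n\<ge>1. \<exists>Dn. dc_split (P n) Dn \<and> dentropy_wd (cond_law (P n) (UNIV - Dn))) \<and>
       0 < emeasure \<nu>ac (UNIV - {0}) \<and> emeasure \<nu>ac (UNIV - {0}) < \<infinity> \<and>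
       dentropy_wd (scale_measure (ennreal (1 / measure \<nu>ac (UNIV - {0}))) \<nu>ac) \<and>
       dentropy (cond_law (P 1) D) < \<infinity> \<and>
       (emeasure \<nu>d (UNIV - {0}) \<noteq> 0 \<longrightarrow>
          dentropy (scale_measure (ennreal (1 / measure \<nu>d (UNIV - {0}))) \<nu>d) < \<infinity>)
     \<longrightarrow> (let lam = measure \<nu> (UNIV - {0});
             \<alpha> = measure \<nu>d (UNIV - {0}) / lam;
             \<kappa> = (\<lambda>n::nat. real n * (1 - exp (- (lam / real n) * (1 - \<alpha>))))
          in \<exists>(mn :: nat \<Rightarrow> nat) (\<zeta> :: nat \<Rightarrow> real) c1 c2. 0 < c1 \<and> c1 \<le> c2 \<and>
            (\<forall>n\<ge>1. c1 * ln (real n) \<le> \<zeta> n \<and> \<zeta> n \<le> c2 * ln (real n)) \<and>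
            (\<forall>\<epsilon>>0. \<forall>\<^sub>F n in sequentially. \<forall>m\<ge>mn n.
               Hq m (P n) < \<infinity> \<and>
               \<bar>real n * enn2real (Hq m (P n)) / \<kappa> n - ln (real m) - \<zeta> n\<bar> \<le> \<epsilon>)))
  \<and>
   (continuous_law (P 1) \<and>
       (\<sigma> > 0 \<or> emeasure \<nu>ac (UNIV - {0}) = \<infinity>) \<and>
       Hq 1 (P 1) < \<infinity> \<and>
       (\<forall>n\<ge>1. dentropy_wd (P n))
     \<longrightarrow> (\<exists>mn :: nat \<Rightarrow> nat.
            (\<forall>\<epsilon>>0. \<forall>\<^sub>F n in sequentially. \<forall>m\<ge>mn n.
               Hq m (P n) < \<infinity> \<and>
               \<bar>real n * enn2real (Hq m (P n)) / real n - ln (real m)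
                  - diff_entropy (P n)\<bar> \<le> \<epsilon>))
         \<and> (\<forall>n\<ge>1. diff_entropy (P (Suc n)) \<le> diff_entropy (P n)))"
proof (intro conjI impI allI, goal_cases)
  have triplet: "sets \<nu> = sets borel" "emeasure \<nu> {0} = 0" using trip by (auto simp: levy_triplet_def)
  have levy: "finite_levy \<nu> \<mu> \<sigma> P"
    if "0 < emeasure \<nu> (UNIV - {0})" "emeasure \<nu> (UNIV - {0}) < \<infinity>"
  proof -
    note f = finite_borel_if_finite_off_zero[OF triplet that(2)]
    interpret finite_borel_measure \<nu> by (rule f(1))
    have "0 < measure \<nu> UNIV" using that(1) unfolding f(2) by (simp add: emeasure_eq_measure)
    then show ?thesis using f laws
      by (intro finite_levy.intro finite_levy_axioms.intro) auto
  qed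
  interpret div: divisible_family P "levy_exponent \<mu> \<sigma> \<nu>"
    by (rule divisible_family.intro) (use laws in simp_all)
  {
    case 1
    then have disc: "discrete_law (P 1)" and H: "dentropy (P 1) < \<infinity>"
      and pos: "0 < emeasure \<nu> (UNIV - {0})" "emeasure \<nu> (UNIV - {0}) < \<infinity>" by auto
    interpret finite_levy \<nu> \<mu> \<sigma> P using pos by (rule levy)
    interpret P1: real_distribution "P 1" using laws by simp
    obtain D where D: "countable D" "emeasure (P 1) (UNIV - D) = 0" using disc by (auto simp: discrete_law_def)
    have "measure (P 1) D = 1"
      using P1.prob_compl[of D] D(2) countable_in_borel[OF D(1)] unfolding P1.events_eq_borel P1.space_eq_univ
      by (simp add: measure_def)
    \<comment> \<open>A discrete law lives on a countable, hence Lebesgue null set, which excludes a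
      Gaussian component.\<close>
    then have "\<sigma> = 0" using D(1) by (intro sigma_zero not_ac_if_countable_mass[of D]) auto
    then interpret cp_family P rate drift jump by (rule cp_family)
    show ?case using disc H by (rule discrete_case)
  next
    case (2 D)
    then have D: "dc_split (P 1) D" and pos: "0 < emeasure \<nu> (UNIV - {0})" and fin: "emeasure \<nu> (UNIV - {0}) < \<infinity>"
      and H1: "Hq 1 (P 1) < \<infinity>"
      and Dn: "\<forall>n\<ge>1. \<exists>Dn. dc_split (P n) Dn \<and> dentropy_wd (cond_law (P n) (UNIV - Dn))"
      and ac0: "0 < emeasure \<nu>ac (UNIV - {0})" and HD: "dentropy (cond_law (P 1) D) < \<infinity>" by blast+
    interpret finite_levy \<nu> \<mu> \<sigma> P using pos fin by (rule levy)
    have "countable D" "0 < measure (P 1) D" using D by (auto simp: dc_split_def)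
    then have s0: "\<sigma> = 0" by (intro sigma_zero not_ac_if_countable_mass)
    obtain N where N: "N \<in> null_sets lborel" "emeasure \<nu>cs (UNIV - N) = 0" using cs_sing by auto
    have cs0: "emeasure \<nu>cs UNIV = 0"
      by (rule singular_part_zero[OF s0 D sets_cs _ cs_noatom N]) (use decomp in auto)
    obtain S where S: "countable S" "emeasure \<nu>d (UNIV - S) = 0" using disc_d by (auto simp: discrete_law_def)
    have ac_pos: "0 < emeasure \<nu>ac UNIV"
      using ac0 emeasure_mono[of "UNIV - {0}" UNIV \<nu>ac] sets_ac by (auto intro: less_le_trans)
    interpret decomposed_levy \<nu> \<mu> \<sigma> P \<nu>d \<nu>ac \<nu>cs S
      using sets_d sets_ac sets_cs decomp S ac_ac cs0 ac_pos s0 by unfold_locales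
    interpret cp: cp_family P rate drift jump using s0 by (rule cp_family)
    interpret ac: finite_borel_measure \<nu>ac by (rule finite_ac)
    interpret d: finite_borel_measure \<nu>d by (rule finite_d)
    have la: "0 < measure \<nu>ac UNIV" using ac_pos by (simp add: ac.emeasure_eq_measure)
    have rate0: "measure \<nu> (UNIV - {0}) = rate"
      using finite_borel_if_finite_off_zero(2)[OF triplet fin] by simp
    have d0: "measure \<nu>d (UNIV - {0}) = measure \<nu>d UNIV"
    proof -
      have "emeasure \<nu>d {0} = 0" using decomp[rule_format, of "{0}"] triplet(2) by simp
      then show ?thesis using d.finite_measure_compl[of "{0}"] sets_d by (simp add: measure_def)
    qed
    \<comment> \<open>With the singular part gone, \<open>rate\<close> times one minus the discrete
      fraction is the total mass of \<open>\<nu>ac\<close>, so this exponent is the one in the mass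
      of the atoms.\<close>
    have \<kappa>: "- (rate / real n) * (1 - measure \<nu>d UNIV / rate) = - (measure \<nu>ac UNIV / real n)" for n
    proof -
      have "rate * (1 - measure \<nu>d UNIV / rate) = measure \<nu>ac UNIV"
        using mass_pos rate_eq by (simp add: right_diff_distrib)
      then show ?thesis by (metis minus_mult_left times_divide_eq_left)
    qed
    show ?case
      unfolding Let_def rate0 d0 \<kappa>
      by (rule cp.mixed_case[OF D HD div.quantized_entropy_finite[OF _ H1] Dn la atom_mass_P])
  next
    case 3 then show ?case using div.continuous_case by blast
  next
    case 4 then show ?case using div.continuous_case by blast
  }
qed

end
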